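(* Let $K$ be a number field of degree $d$ and discriminant $\Delta_K$. Let $V\subseteq K^n$ be an $m$-dimensional subspace, $1\le m\le n$. Then $V$ contains a basis $\boldsymbol{x}_1,\dots,\boldsymbol{x}_m$ of $(n-m+1)$-sparse vectors such that $$h(\boldsymbol{x}_i) \le \sqrt{2}\, m\, |\Delta_K|^{\frac{m+1}{2d}}\, \mathcal{H}(V)$$ for each $1\le i\le m$.
   Context: A vector $\boldsymbol{x}\in K^n$ is called $s$-sparse ($1\le s\le n$) if it has no more than $s$ nonzero coordinates. Heights: let $M(K)$ be the set of places of $K$, and for $v\in M(K)$ let $d_v = [K_v:\mathbb{Q}_v]$ be the local degree. The absolute value $|\cdot|_v$ is normalized to extend the usual archimedean or $p$-adic absolute value on $\mathbb{Q}$, so that $\prod_{v\in M(K)} |x|_v^{d_v} = 1$ for all nonzero $x\in K$. For a vector $\boldsymbol{x} = (x_1,\dots,x_N)$ over $K$ put $|\boldsymbol{x}|_v = \max_i |x_i|_v$ and, for $v\mid\infty$, $\|\boldsymbol{x}\|_v = \left(\sum_i |x_i|_v^2\right)^{1/2}$. Define $$H(\boldsymbol{x}) = \Big(\prod_{v\in M(K)} |\boldsymbol{x}|_v^{d_v}\Big)^{1/d},\qquad \mathcal{H}(\boldsymbol{x}) = \Big(\prod_{v\nmid\infty} |\boldsymbol{x}|_v^{d_v} \times \prod_{v\mid\infty}\|\boldsymbol{x}\|_v^{d_v}\Big)^{1/d},$$ and the inhomogeneous (Weil) height $h(\boldsymbol{x}) = H(1,\boldsymbol{x})$. For an $m$-dimensional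 subspace $V\subseteq K^n$, $1\le m\le n$, with basis $\boldsymbol{v}_1,\dots,\boldsymbol{v}_m$, the Schmidt height is $\mathcal{H}(V) = \mathcal{H}(\boldsymbol{v}_1\wedge\dots\wedge\boldsymbol{v}_m)$, where the wedge product is identified with the vector of Grassmann (Plücker) coordinates in $K^{\binom{n}{m}}$ (the $m\times m$ minors of the $n\times m$ basis matrix); this does not depend on the choice of basis. *)

theory Defs
  imports
    "HOL-Algebra.Embedded_Algebras"
    "HOL-Algebra.QuotRing"
    "Jordan_Normal_Form.DL_Rank_Submatrix"
begin

section \<open>Number fields, degree and discriminant\<close>

interpretation Qvs: vector_space "\<lambda>(q::rat) (x::'a::field_char_0). of_rat q * x"
  by unfold_locales (simp_all add: algebra_simps of_rat_add of_rat_mult)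

text \<open>Number fields are given as types of characteristic-0 fields that are finite-dimensional over
  the rationals.\<close>

definition number_field :: "'a::field_char_0 itself \<Rightarrow> bool" where
  "number_field _ \<longleftrightarrow> (\<exists>B::'a set. finite B \<and> Qvs.span B = UNIV)"

definition nf_degree :: "'a::field_char_0 itself \<Rightarrow> nat" where
  "nf_degree _ = Qvs.dim (UNIV :: 'a set)"

text \<open>The trace from \<open>K\<close> to the rationals: the trace of the matrix of multiplication by \<open>x\<close>
  with respect to a basis of \<open>K\<close>; it does not depend on that basis.\<close>

definition nf_trace :: "'a::field_char_0 \<Rightarrow> rat" where
  "nf_trace x =
     (let B = (SOME B :: 'a set. Qvs.independent B \<and> Qvs.span B = UNIV)
      in \<Sum>b\<in>B. Qvs.representation B (x * b) b)"

definition integral_basis :: "'a::field_char_0 list \<Rightarrow> bool" where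
  "integral_basis bs \<longleftrightarrow>
     (\<forall>b\<in>set bs. algebraic_int b) \<and>
     (\<forall>x. algebraic_int x \<longrightarrow>
        (\<exists>!c::int list. length c = length bs \<and> x = (\<Sum>i<length bs. of_int (c ! i) * bs ! i)))"

definition nf_discriminant :: "'a::field_char_0 itself \<Rightarrow> rat" where
  "nf_discriminant _ =
     (let bs = (SOME bs :: 'a list. integral_basis bs)
      in det (mat (length bs) (length bs) (\<lambda>(i, j). nf_trace (bs ! i * bs ! j))))"


section \<open>Places and local degrees\<close>

definition absolute_value :: "('a::field \<Rightarrow> real) \<Rightarrow> bool" where
  "absolute_value v \<longleftrightarrow>
     (\<forall>x. 0 \<le> v x) \<and> (\<forall>x. v x = 0 \<longleftrightarrow> x = 0) \<and>
     (\<forall>x y. v (x * y) = v x * v y) \<and> (\<forall>x y. v (x + y) \<le> v x + v y)"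

definition padic_abs :: "nat \<Rightarrow> rat \<Rightarrow> real" where
  "padic_abs p q =
     (if q = 0 then 0
      else real p powi (int (multiplicity (int p) (snd (quotient_of q)))
                      - int (multiplicity (int p) (fst (quotient_of q)))))"

text \<open>Every place (class of equivalent nontrivial absolute values) of a number field contains
  exactly one absolute value whose restriction to the rationals is the usual or a \<open>p\<close>-adic one.
  A place is identified with this normalized representative.\<close>

definition arch_places :: "('a::field_char_0 \<Rightarrow> real) set" where
  "arch_places = {v. absolute_value v \<and> (\<forall>q. v (of_rat q) = \<bar>real_of_rat q\<bar>)}"

definition finite_places :: "('a::field_char_0 \<Rightarrow> real) set" where
  "finite_places =
     {v. absolute_value v \<and> (\<exists>p. prime p \<and> (\<forall>q. v (of_rat q) = padic_abs p q))}"

definition places :: "('a::field_char_0 \<Rightarrow> real) set" where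
  "places = arch_places \<union> finite_places"

definition cauchy_seqs :: "('a::field_char_0 \<Rightarrow> real) \<Rightarrow> (nat \<Rightarrow> 'a) set" where
  "cauchy_seqs v = {s. \<forall>e>0. \<exists>N. \<forall>i\<ge>N. \<forall>j\<ge>N. v (s i - s j) < e}"

definition null_seqs :: "('a::field_char_0 \<Rightarrow> real) \<Rightarrow> (nat \<Rightarrow> 'a) set" where
  "null_seqs v = {s. (\<lambda>i. v (s i)) \<longlonglongrightarrow> 0}"

definition cauchy_ring :: "('a::field_char_0 \<Rightarrow> real) \<Rightarrow> (nat \<Rightarrow> 'a) ring" where
  "cauchy_ring v =
     \<lparr>carrier = cauchy_seqs v,
      monoid.mult = (\<lambda>s t i. s i * t i), one = (\<lambda>i. 1),
      zero = (\<lambda>i. 0), add = (\<lambda>s t i. s i + t i)\<rparr>"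

definition completion :: "('a::field_char_0 \<Rightarrow> real) \<Rightarrow> (nat \<Rightarrow> 'a) set ring" where
  "completion v = cauchy_ring v Quot null_seqs v"

text \<open>The completion of the rationals at the place below \<open>v\<close>, as a subfield of the completion of
  \<open>K\<close> at \<open>v\<close>: the classes of rational Cauchy sequences.\<close>

definition rat_completion :: "('a::field_char_0 \<Rightarrow> real) \<Rightarrow> (nat \<Rightarrow> 'a) set set" where
  "rat_completion v =
     (\<lambda>s. null_seqs v +>\<^bsub>cauchy_ring v\<^esub> s) ` {s \<in> cauchy_seqs v. \<forall>i. s i \<in> \<rat>}"

definition local_degree :: "('a::field_char_0 \<Rightarrow> real) \<Rightarrow> nat" where
  "local_degree v = ring.dim (completion v) (rat_completion v) (carrier (completion v))"


section \<open>Heights\<close>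

definition max_norm :: "('a::field_char_0 \<Rightarrow> real) \<Rightarrow> 'a vec \<Rightarrow> real" where
  "max_norm v x = Max ((\<lambda>i. v (x $ i)) ` {..<dim_vec x})"

definition l2_norm :: "('a::field_char_0 \<Rightarrow> real) \<Rightarrow> 'a vec \<Rightarrow> real" where
  "l2_norm v x = sqrt (\<Sum>i<dim_vec x. (v (x $ i))\<^sup>2)"

text \<open>The product over all places. For the local factors of a nonzero vector only finitely many
  differ from 1.\<close>

definition places_prod :: "(('a::field_char_0 \<Rightarrow> real) \<Rightarrow> real) \<Rightarrow> real" where
  "places_prod f = (\<Prod>v\<in>{v \<in> places. f v \<noteq> 1}. f v)"

definition max_height :: "'a::field_char_0 vec \<Rightarrow> real" where
  "max_height x = root (nf_degree TYPE('a)) (places_prod (\<lambda>v. max_norm v x ^ local_degree v))"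

definition mixed_height :: "'a::field_char_0 vec \<Rightarrow> real" where
  "mixed_height x =
     root (nf_degree TYPE('a))
       (places_prod (\<lambda>v. (if v \<in> arch_places then l2_norm v x else max_norm v x) ^ local_degree v))"

definition weil_height :: "'a::field_char_0 vec \<Rightarrow> real" where
  "weil_height x = max_height (vCons 1 x)"


section \<open>Subspaces, bases, Schmidt height and sparsity\<close>

abbreviation subvs :: "nat \<Rightarrow> 'a::field vec set \<Rightarrow> ('a, 'a vec) module" where
  "subvs n V \<equiv> (module_vec TYPE('a) n)\<lparr>carrier := V\<rparr>"

definition is_basis_of :: "nat \<Rightarrow> 'a::field vec set \<Rightarrow> 'a vec list \<Rightarrow> bool" where
  "is_basis_of n V bs \<longleftrightarrow> distinct bs \<and> vectorspace.basis class_ring (subvs n V) (set bs)"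

text \<open>The Grassmann coordinates of the wedge product of \<open>m\<close> vectors in \<open>K\<^sup>n\<close>: the \<open>m \<times> m\<close> minors
  of the \<open>n \<times> m\<close> matrix with these columns, indexed by the \<open>m\<close>-element subsets of the rows.\<close>

definition grassmann_coords :: "nat \<Rightarrow> 'a::field vec list \<Rightarrow> 'a vec" where
  "grassmann_coords n bs =
     vec_of_list
       (map (\<lambda>is. det (submatrix (mat_of_cols n bs) (set is) UNIV))
         (filter (\<lambda>is. length is = length bs) (subseqs [0..<n])))"

text \<open>By the product formula the choice of the basis is irrelevant.\<close>

definition schmidt_height :: "nat \<Rightarrow> 'a::field_char_0 vec set \<Rightarrow> real" where
  "schmidt_height n V = mixed_height (grassmann_coords n (SOME bs. is_basis_of n V bs))"

definition sparse_vec :: "nat \<Rightarrow> 'a::zero vec \<Rightarrow> bool" where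
  "sparse_vec s x \<longleftrightarrow> card {i. i < dim_vec x \<and> x $ i \<noteq> 0} \<le> s"

end

theory Submission
  imports Defs "Jordan_Normal_Form.Schur_Decomposition"
begin

text \<open>
  The sparse basis is a reduced echelon basis. Let \<open>A\<close> be the \<open>n \<times>
  m\<close> matrix whose columns are a basis of \<open>V\<close>, and \<open>A\<^sub>r\<close> an
  invertible block of \<open>m\<close> of its rows. The columns of \<open>A
  A\<^sub>r\<^sup>-\<^sup>1\<close> are a basis of \<open>V\<close> which restricts to the unit
  vectors on the chosen rows; so each of them has at least \<open>m - 1\<close> zeros. By Cramer's
  rule the nonzero entries of \<open>A A\<^sub>r\<^sup>-\<^sup>1\<close> are, up to sign,
  quotients \<open>G\<^sub>J / G\<^sub>I\<close> of Grassmann coordinates of \<open>V\<close> with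
  the fixed denominator \<open>G\<^sub>I = det A\<^sub>r\<close>. Hence \<open>|(1, x)|\<^sub>v
  |G\<^sub>I|\<^sub>v \<le> |G|\<^sub>v\<close> for every column \<open>x\<close> and every place
  \<open>v\<close>. In the product over all places the factors of \<open>G\<^sub>I\<close> cancel
  by the product formula, and the height of \<open>x\<close> is at most that of \<open>V\<close>
  (\<open>sparse_basis_of_height_le_schmidt_height\<close>). The constant of the theorem is at
  least \<open>1\<close>, because the discriminant is a nonzero integer
  (\<open>abs_discriminant_ge_1\<close>).

  The arithmetic input is therefore the product formula. It reduces to the rationals once it is
  known that, for an absolute value \<open>w\<close> of the rationals, the product of
  \<open>|c|\<^sub>v\<close> to the power of the local degree, over the extensions
  \<open>v\<close> of \<open>w\<close>, equals \<open>w\<close> of the norm of \<open>c\<close>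
  (\<open>local_product_formula\<close>). Each \<open>v\<close> has a topological basis: finitely
  many elements of the number field whose rational combinations are dense for \<open>v\<close>,
  with coefficients controlled by the value of the combination. Its length is the local degree,
  since its classes form a basis of the completion. Weak approximation gives elements close to the
  basis elements at one extension and close to \<open>0\<close> at the others. All of them
  together are a rational basis of the field, in which the matrix of multiplication by
  \<open>c\<close> has in each row entries bounded by a constant multiple of some
  \<open>|c|\<^sub>v\<close>. So the norm of \<open>c\<close>, the determinant of this matrix, is
  bounded by a constant times the product; passing to powers of \<open>c\<close> removes the
  constant, and passing to \<open>1 / c\<close> gives equality.

  That these elements span the field needs all extensions of \<open>w\<close>, in the form of a
  bound of the trace by the largest absolute value over the extensions. In the archimedean case
  the trace is a sum of images under complex embeddings. In the p-adic case, an element that is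
  not integral over the p-integral rationals has absolute value greater than \<open>1\<close> for
  some extension: by Zorn's lemma there is a maximal subring that contains \<open>1 / x\<close>
  but not \<open>x\<close>, and this subring is a valuation ring
  (\<open>exists_extension_gt_1\<close>).
\<close>

section \<open>Absolute values\<close>

lemma absval_nonneg: "absolute_value v \<Longrightarrow> 0 \<le> v x"
  by (simp add: absolute_value_def)

lemma absval_eq_0_iff: "absolute_value v \<Longrightarrow> v x = 0 \<longleftrightarrow> x = 0"
  by (simp add: absolute_value_def)

lemma absval_0: "absolute_value v \<Longrightarrow> v 0 = 0"
  by (simp add: absolute_value_def)

lemma absval_pos: "absolute_value v \<Longrightarrow> x \<noteq> 0 \<Longrightarrow> 0 < v x"
  using absval_nonneg[of v x] absval_eq_0_iff[of v x] by linarith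

lemma absval_mult: "absolute_value v \<Longrightarrow> v (x * y) = v x * v y"
  by (simp add: absolute_value_def)

lemma absval_add: "absolute_value v \<Longrightarrow> v (x + y) \<le> v x + v y"
  by (simp add: absolute_value_def)

lemma absval_1: "absolute_value v \<Longrightarrow> v 1 = 1"
  using absval_mult[of v 1 1] absval_pos[of v 1] by simp

lemma absval_power: "absolute_value v \<Longrightarrow> v (x ^ n) = v x ^ n"
  by (induction n) (simp_all add: absval_1 absval_mult)

lemma absval_minus: "absolute_value v \<Longrightarrow> v (- x) = v x"
proof -
  assume v: "absolute_value v"
  have "v (-1) ^ 2 = 1"
    using absval_power[OF v, of "-1" 2] absval_1[OF v] by simp
  hence "v (-1) = 1"
    using absval_nonneg[OF v, of "-1"] by (simp add: power2_eq_1_iff)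
  thus ?thesis using absval_mult[OF v, of "-1" x] by simp
qed

lemma absval_diff: "absolute_value v \<Longrightarrow> v (x - y) \<le> v x + v y"
  using absval_add[of v x "-y"] absval_minus[of v y] by simp

lemma absval_diff_commute: "absolute_value v \<Longrightarrow> v (x - y) = v (y - x)"
  using absval_minus[of v "x - y"] by simp

lemma absval_triangle_lower: "absolute_value v \<Longrightarrow> v x - v y \<le> v (x + y)"
  using absval_diff[of v "x + y" y] by simp

lemma absval_inverse: "absolute_value v \<Longrightarrow> v (inverse x) = inverse (v x)"
  for x :: "'a::field"
proof (cases "x = 0")
  case False
  assume v: "absolute_value v"
  have "v x * v (inverse x) = 1"
    using absval_mult[OF v, of x "inverse x"] absval_1[OF v] False by simp
  thus ?thesis by (metis inverse_unique)
qed (simp add: absval_0)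

lemma absval_divide: "absolute_value v \<Longrightarrow> v (x / y) = v x / v y"
  for x :: "'a::field"
  by (simp add: divide_inverse absval_mult absval_inverse)

lemma absval_powi: "absolute_value v \<Longrightarrow> v (x powi k) = v x powi k"
  for x :: "'a::field"
  by (simp add: power_int_def absval_power absval_inverse)

lemma absval_sum: "absolute_value v \<Longrightarrow> v (\<Sum>i\<in>I. f i) \<le> (\<Sum>i\<in>I. v (f i))"
proof (induction I rule: infinite_finite_induct)
  case (insert a A)
  thus ?case using absval_add[of v "f a" "\<Sum>i\<in>A. f i"] by simp
qed (simp_all add: absval_0)

lemma absval_prod: "absolute_value v \<Longrightarrow> v (\<Prod>i\<in>I. f i) = (\<Prod>i\<in>I. v (f i))"
  by (induction I rule: infinite_finite_induct) (simp_all add: absval_1 absval_mult)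

text \<open>For \<open>w\<close> the usual or a p-adic absolute value, these are the places above
  \<open>w\<close>.\<close>

definition extensions :: "(rat \<Rightarrow> real) \<Rightarrow> ('a::field_char_0 \<Rightarrow> real) set" where
  "extensions w = {v. absolute_value v \<and> (\<forall>q. v (of_rat q) = w q)}"

lemma extensions_absval: "v \<in> extensions w \<Longrightarrow> absolute_value v"
  by (simp add: extensions_def)

lemma extensions_of_rat: "v \<in> extensions w \<Longrightarrow> v (of_rat q) = w q"
  by (simp add: extensions_def)

definition nontrivial :: "(rat \<Rightarrow> real) \<Rightarrow> bool" where
  "nontrivial w \<longleftrightarrow> absolute_value w \<and> (\<exists>q. 0 < w q \<and> w q < 1)"

section \<open>Weak approximation\<close>

text \<open>With \<open>c = w r\<close> for a rational number \<open>r\<close>, this turns real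
  bounds into values of powers of \<open>r\<close>, at the cost of a constant factor.\<close>

lemma geometric_bracket:
  fixes c y :: real
  assumes "0 < c" "c < 1" "0 < y"
  shows "\<exists>a::int. c powi a \<le> y \<and> y < c powi (a - 1)"
proof -
  define a where "a = \<lceil>log c y\<rceil>"
  have p: "c powi k = c powr real_of_int k" for k
    using assms by (simp add: powr_real_of_int')
  have y: "y = c powr (log c y)" using assms by simp
  have "c powr (real_of_int a) \<le> c powr (log c y)"
    by (rule powr_mono') (use assms in \<open>auto simp: a_def\<close>)
  moreover have "c powr (log c y) < c powr (real_of_int (a - 1))"
  proof -
    have "real_of_int (a - 1) < log c y" unfolding a_def by linarith
    thus ?thesis using assms(1,2) by (intro powr_less_mono') auto
  qed
  ultimately show ?thesis using p y by metis
qed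

text \<open>An inclusion of open unit balls makes absolute values powers of each other, and here the
  exponent is \<open>1\<close> since both agree on the rationals: if \<open>u x\<close> exceeded
  \<open>v x\<close>, then some power of \<open>x\<close> divided by a rational number would be
  small for \<open>v\<close> but not for \<open>u\<close>.\<close>

lemma extension_eqI:
  fixes u v :: "'a::field_char_0 \<Rightarrow> real"
  assumes w: "nontrivial w" and v: "v \<in> extensions w" and u: "u \<in> extensions w"
    and imp: "\<And>x. v x < 1 \<Longrightarrow> u x < 1"
  shows "u = v"
proof -
  note av = extensions_absval[OF v] and au = extensions_absval[OF u]
  obtain r where r: "0 < w r" "w r < 1" using w by (auto simp: nontrivial_def)
  have le: "u x \<le> v x" for x
  proof (rule ccontr)
    assume "\<not> u x \<le> v x"
    hence lt: "v x < u x" by simp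
    have x0: "x \<noteq> 0" using lt absval_0[OF av] absval_0[OF au] by auto
    have vx: "0 < v x" using absval_pos[OF av x0] .
    have "1 < u x / v x" using lt vx by simp
    then obtain b where b: "inverse (w r) < (u x / v x) ^ b"
      using real_arch_pow by blast
    have ux: "0 < u x ^ b" using lt vx by simp
    obtain a where a: "w r powi a \<le> u x ^ b" "u x ^ b < w r powi (a - 1)"
      using geometric_bracket[OF r ux] by blast
    have "v x ^ b < w r * u x ^ b"
      using b r vx by (simp add: field_simps power_divide)
    also have "\<dots> < w r * w r powi (a - 1)" using a r by simp
    also have "\<dots> = w r powi a" using r by (simp add: power_int_diff)
    finally have 1: "v x ^ b < w r powi a" .
    let ?y = "x ^ b / of_rat r powi a"
    have vr: "v (of_rat r powi a) = w r powi a" "u (of_rat r powi a) = w r powi a"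
      using absval_powi[OF av] absval_powi[OF au] extensions_of_rat[OF v] extensions_of_rat[OF u]
      by auto
    have pp: "0 < w r powi a" using r by (simp add: zero_less_power_int)
    have "v ?y < 1" using 1 pp by (simp add: absval_divide[OF av] absval_power[OF av] vr)
    hence "u ?y < 1" by (rule imp)
    hence "u x ^ b < w r powi a" using pp
      by (simp add: absval_divide[OF au] absval_power[OF au] vr)
    thus False using a by simp
  qed
  have "u x = v x" for x
  proof (cases "x = 0")
    case False
    have "inverse (u x) \<le> inverse (v x)"
      using le[of "inverse x"] by (simp add: absval_inverse[OF av] absval_inverse[OF au])
    hence "v x \<le> u x" using absval_pos[OF av False] absval_pos[OF au False]
      by (simp add: inverse_le_iff_le)
    thus ?thesis using le[of x] by simp
  qed (simp add: absval_0[OF av] absval_0[OF au])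
  thus ?thesis by blast
qed

text \<open>Neither open unit ball contains the other; the quotient of the two witnesses is large
  for \<open>v\<close> and small for \<open>u\<close>.\<close>

lemma extensions_separate:
  fixes u v :: "'a::field_char_0 \<Rightarrow> real"
  assumes w: "nontrivial w" and v: "v \<in> extensions w" and u: "u \<in> extensions w" and "u \<noteq> v"
  shows "\<exists>x. 1 < v x \<and> u x < 1"
proof -
  note av = extensions_absval[OF v] and au = extensions_absval[OF u]
  obtain a where a: "v a < 1" "1 \<le> u a"
    using extension_eqI[OF w v u] \<open>u \<noteq> v\<close> by (meson not_less)
  obtain b where b: "u b < 1" "1 \<le> v b"
    using extension_eqI[OF w u v] \<open>u \<noteq> v\<close> by (metis not_less)
  have "a \<noteq> 0" using a absval_0[OF au] by auto
  hence "0 < v a" using absval_pos[OF av] by auto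
  hence "1 < v (b / a)" using a b by (simp add: absval_divide[OF av])
  moreover have "u (b / a) < 1" using a b by (simp add: absval_divide[OF au])
  ultimately show ?thesis by blast
qed

text \<open>The sequence \<open>a\<^sup>n / (1 + a\<^sup>n)\<close> is a switch: it tends to
  \<open>1\<close> for the absolute values at which \<open>a\<close> is large, and to
  \<open>0\<close> for those at which \<open>a\<close> is small.\<close>

lemma tendsto_power_quotient_1:
  fixes v :: "'a::field \<Rightarrow> real"
  assumes v: "absolute_value v" and a: "1 < v a"
  shows "(\<lambda>n. v (a ^ n / (1 + a ^ n) - 1)) \<longlonglongrightarrow> 0"
proof (rule tendsto_sandwich)
  show "\<forall>\<^sub>F n in sequentially. 0 \<le> v (a ^ n / (1 + a ^ n) - 1)"
    by (simp add: absval_nonneg[OF v])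
  have lim: "filterlim (\<lambda>n. v a ^ n - 1) at_top sequentially"
    unfolding filterlim_at_top
  proof
    fix Z
    obtain N where "Z + 1 < v a ^ N" using real_arch_pow[OF a] by blast
    hence "Z \<le> v a ^ n - 1" if "n \<ge> N" for n
      using power_increasing[OF that, of "v a"] a by linarith
    thus "\<forall>\<^sub>F n in sequentially. Z \<le> v a ^ n - 1" by (auto simp: eventually_sequentially)
  qed
  have ev: "\<forall>\<^sub>F n in sequentially. v a ^ n - 1 > 0"
    using lim unfolding filterlim_at_top_dense by (auto dest: spec[of _ 0])
  show "\<forall>\<^sub>F n in sequentially. v (a ^ n / (1 + a ^ n) - 1) \<le> inverse (v a ^ n - 1)"
    using ev
  proof eventually_elim
    case (elim n)
    have le: "v a ^ n - 1 \<le> v (1 + a ^ n)"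
      using absval_triangle_lower[OF v, of "a ^ n" 1] by (simp add: absval_power[OF v] absval_1[OF v] add.commute)
    hence "1 + a ^ n \<noteq> 0" using elim absval_0[OF v] by auto
    hence "a ^ n / (1 + a ^ n) - 1 = - inverse (1 + a ^ n)" by (simp add: field_simps)
    thus ?case using le elim by (simp add: absval_minus[OF v] absval_inverse[OF v] le_imp_inverse_le)
  qed
  show "(\<lambda>n. inverse (v a ^ n - 1)) \<longlonglongrightarrow> 0"
    using lim by (rule tendsto_inverse_0_at_top)
qed simp

lemma tendsto_power_quotient_0:
  fixes v :: "'a::field \<Rightarrow> real"
  assumes v: "absolute_value v" and a: "v a < 1"
  shows "(\<lambda>n. v (a ^ n / (1 + a ^ n))) \<longlonglongrightarrow> 0"
proof (rule tendsto_sandwich)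
  show "\<forall>\<^sub>F n in sequentially. 0 \<le> v (a ^ n / (1 + a ^ n))"
    by (simp add: absval_nonneg[OF v])
  have lim: "(\<lambda>n. v a ^ n) \<longlonglongrightarrow> 0"
    using a absval_nonneg[OF v] by (intro LIMSEQ_power_zero) simp
  have "(\<lambda>n. v a ^ n / (1 - v a ^ n)) \<longlonglongrightarrow> 0 / (1 - 0)"
    by (intro tendsto_intros lim) simp
  thus "(\<lambda>n. v a ^ n / (1 - v a ^ n)) \<longlonglongrightarrow> 0" by simp
  have ev: "\<forall>\<^sub>F n in sequentially. v a ^ n < 1"
    using order_tendstoD(2)[OF lim, of 1] by simp
  show "\<forall>\<^sub>F n in sequentially. v (a ^ n / (1 + a ^ n)) \<le> v a ^ n / (1 - v a ^ n)"
    using ev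
  proof eventually_elim
    case (elim n)
    have le: "1 - v a ^ n \<le> v (1 + a ^ n)"
      using absval_triangle_lower[OF v, of 1 "a ^ n"] by (simp add: absval_power[OF v] absval_1[OF v] add.commute)
    thus ?case using elim absval_nonneg[OF v, of a]
      by (auto simp: absval_divide[OF v] absval_power[OF v] intro!: divide_left_mono mult_pos_pos)
  qed
qed simp

lemma absval_tendsto_mult_near_1:
  fixes v :: "'a::field \<Rightarrow> real"
  assumes v: "absolute_value v" and lim: "(\<lambda>n. v (f n - 1)) \<longlonglongrightarrow> 0"
  shows "(\<lambda>n. v (f n * c)) \<longlonglongrightarrow> v c"
proof -
  have "(\<lambda>n. v (f n) - 1) \<longlonglongrightarrow> 0"
  proof (rule tendsto_0_le[OF lim, of _ 1])
    have le: "norm (v (f n) - 1) \<le> v (f n - 1)" for n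
      using absval_triangle_lower[OF v, of "f n" "-1"] absval_triangle_lower[OF v, of 1 "- f n"]
      by (simp add: absval_1[OF v] absval_minus[OF v] absval_diff_commute[OF v, of 1])
    thus "\<forall>\<^sub>F n in sequentially. norm (v (f n) - 1) \<le> norm (v (f n - 1)) * 1"
      using absval_nonneg[OF v] le by simp
  qed
  hence "(\<lambda>n. (v (f n) - 1) * v c + v c) \<longlonglongrightarrow> 0 * v c + v c" by (intro tendsto_intros)
  thus ?thesis by (simp add: absval_mult[OF v] algebra_simps)
qed

text \<open>An element \<open>a\<close> that works for \<open>T\<close> is corrected by an element
  \<open>c\<close> that separates \<open>v\<close> from the new \<open>u\<close>. If \<open>u a
  \<le> 1\<close>, a high power of \<open>a\<close> times \<open>c\<close> works; otherwise
  \<open>c\<close> times the switch \<open>a\<^sup>n / (1 + a\<^sup>n)\<close> does, which is near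
  \<open>1\<close> at \<open>u\<close> and \<open>v\<close> and near \<open>0\<close> on
  \<open>T\<close>.\<close>

lemma extensions_separate_finite:
  fixes v :: "'a::field_char_0 \<Rightarrow> real"
  assumes w: "nontrivial w" and v: "v \<in> extensions w"
    and "finite T" "T \<subseteq> extensions w" "v \<notin> T"
  shows "\<exists>a. 1 < v a \<and> (\<forall>u\<in>T. u a < 1)"
  using assms(3-)
proof (induction T rule: finite_induct)
  case empty
  obtain r where r: "0 < w r" "w r < 1" using w by (auto simp: nontrivial_def)
  hence "1 < v (of_rat (inverse r))"
    using w by (simp add: extensions_of_rat[OF v] nontrivial_def absval_inverse one_less_inverse)
  thus ?case by blast
next
  case (insert u T)
  note av = extensions_absval[OF v]
  have u: "u \<in> extensions w" and Te: "T \<subseteq> extensions w" and uv: "u \<noteq> v" using insert.prems by auto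
  note au = extensions_absval[OF u]
  have at: "absolute_value t" if "t \<in> T" for t using Te that extensions_absval by blast
  obtain a where a: "1 < v a" "\<forall>t\<in>T. t a < 1" using insert by auto
  obtain c where c: "1 < v c" "u c < 1" using extensions_separate[OF w v u uv] by blast
  show ?case
  proof (cases "u a \<le> 1")
    case True
    have "\<forall>\<^sub>F n in sequentially. \<forall>t\<in>T. t (a ^ n * c) < 1"
    proof (rule eventually_ball_finite[OF insert.hyps(1)], rule ballI)
      fix t assume t: "t \<in> T"
      have "(\<lambda>n. t a ^ n * t c) \<longlonglongrightarrow> 0 * t c"
        using a t absval_nonneg[OF at[OF t]] by (intro tendsto_intros LIMSEQ_power_zero) simp
      hence "(\<lambda>n. t (a ^ n * c)) \<longlonglongrightarrow> 0" by (simp add: absval_mult[OF at[OF t]] absval_power[OF at[OF t]])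
      thus "\<forall>\<^sub>F n in sequentially. t (a ^ n * c) < 1" by (rule order_tendstoD) simp
    qed
    then obtain n where n: "\<forall>t\<in>T. t (a ^ n * c) < 1" by (auto simp: eventually_sequentially)
    have "1 \<le> v a ^ n" using a by simp
    hence "1 * 1 < v a ^ n * v c" using c by (intro mult_le_less_imp_less) auto
    hence "1 < v (a ^ n * c)" by (simp add: absval_mult[OF av] absval_power[OF av])
    moreover have "u a ^ n * u c \<le> 1 * u c"
      using True absval_nonneg[OF au] by (intro mult_right_mono power_le_one) auto
    hence "u (a ^ n * c) < 1" using c by (simp add: absval_mult[OF au] absval_power[OF au])
    ultimately show ?thesis using n by blast
  next
    case False
    let ?f = "\<lambda>n. a ^ n / (1 + a ^ n)"
    have 1: "\<forall>\<^sub>F n in sequentially. 1 < v (?f n * c)"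
      using absval_tendsto_mult_near_1[OF av tendsto_power_quotient_1[OF av a(1)]] c(1)
      by (rule order_tendstoD)
    have 2: "\<forall>\<^sub>F n in sequentially. u (?f n * c) < 1"
      using absval_tendsto_mult_near_1[OF au tendsto_power_quotient_1[OF au]] False c(2)
      by (intro order_tendstoD(2)) auto
    have 3: "\<forall>\<^sub>F n in sequentially. \<forall>t\<in>T. t (?f n * c) < 1"
    proof (rule eventually_ball_finite[OF insert.hyps(1)], rule ballI)
      fix t assume t: "t \<in> T"
      have "(\<lambda>n. t (?f n) * t c) \<longlonglongrightarrow> 0 * t c"
        using a t by (intro tendsto_intros tendsto_power_quotient_0 at) auto
      hence "(\<lambda>n. t (?f n * c)) \<longlonglongrightarrow> 0" by (simp only: absval_mult[OF at[OF t]]) simp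
      thus "\<forall>\<^sub>F n in sequentially. t (?f n * c) < 1" by (rule order_tendstoD) simp
    qed
    have "\<forall>\<^sub>F n in sequentially. 1 < v (?f n * c) \<and> (\<forall>t\<in>insert u T. t (?f n * c) < 1)"
      using 1 2 3 by eventually_elim auto
    thus ?thesis by (metis (lifting) eventually_happens trivial_limit_sequentially)
  qed
qed

lemma weak_approximation_unit:
  fixes v :: "'a::field_char_0 \<Rightarrow> real"
  assumes w: "nontrivial w" and v: "v \<in> extensions w"
    and T: "finite T" "T \<subseteq> extensions w" "v \<notin> T" and e: "0 < e"
  shows "\<exists>a. v (a - 1) < e \<and> (\<forall>u\<in>T. u a < e)"
proof -
  note av = extensions_absval[OF v]
  obtain a where a: "1 < v a" "\<forall>t\<in>T. t a < 1" using extensions_separate_finite[OF w v T] by auto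
  let ?f = "\<lambda>n. a ^ n / (1 + a ^ n)"
  have 1: "\<forall>\<^sub>F n in sequentially. v (?f n - 1) < e"
    using tendsto_power_quotient_1[OF av a(1)] e by (rule order_tendstoD)
  have 2: "\<forall>\<^sub>F n in sequentially. \<forall>t\<in>T. t (?f n) < e"
  proof (rule eventually_ball_finite[OF T(1)], rule ballI)
    fix t assume t: "t \<in> T"
    hence "absolute_value t" using T extensions_absval by blast
    thus "\<forall>\<^sub>F n in sequentially. t (?f n) < e"
      using a t e by (intro order_tendstoD(2)[OF tendsto_power_quotient_0]) auto
  qed
  have "\<forall>\<^sub>F n in sequentially. v (?f n - 1) < e \<and> (\<forall>t\<in>T. t (?f n) < e)"
    using 1 2 by eventually_elim auto
  thus ?thesis by (metis (lifting) eventually_happens trivial_limit_sequentially)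
qed

section \<open>Topological bases\<close>

text \<open>Independence over the completion of the rationals at \<open>w\<close>, expressed inside
  the field: the coefficients of a combination are controlled by its value.\<close>

definition top_indep :: "(rat \<Rightarrow> real) \<Rightarrow> ('a::field_char_0 \<Rightarrow> real) \<Rightarrow> nat \<Rightarrow> (nat \<Rightarrow> 'a) \<Rightarrow> bool" where
  "top_indep w v n b \<longleftrightarrow>
     (\<exists>C>0. \<forall>q. \<forall>j<n. C * w (q j) \<le> v (\<Sum>i<n. of_rat (q i) * b i))"

text \<open>Density is spanning over the completion of the rationals, again expressed inside the
  field.\<close>

definition top_basis :: "(rat \<Rightarrow> real) \<Rightarrow> ('a::field_char_0 \<Rightarrow> real) \<Rightarrow> nat \<Rightarrow> (nat \<Rightarrow> 'a) \<Rightarrow> bool" where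
  "top_basis w v n b \<longleftrightarrow> top_indep w v n b \<and>
     (\<forall>x. \<forall>e>0. \<exists>q. v (x - (\<Sum>i<n. of_rat (q i) * b i)) < e)"

lemma top_indep_linear_indep:
  assumes w: "absolute_value w" and v: "absolute_value v" and ti: "top_indep w v n b"
    and z: "(\<Sum>i<n. of_rat (q i) * b i) = 0" and i: "i < n"
  shows "q i = 0"
proof -
  obtain C where C: "C > 0" "\<And>q j. j < n \<Longrightarrow> C * w (q j) \<le> v (\<Sum>i<n. of_rat (q i) * b i)"
    using ti unfolding top_indep_def by blast
  have "C * w (q i) \<le> 0" using C(2)[OF i, of q] z absval_0[OF v] by simp
  hence "w (q i) \<le> 0" using C(1) by (simp add: mult_le_0_iff)
  thus ?thesis using absval_pos[OF w] by (metis not_less)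
qed

text \<open>A maximal topologically independent family spans a dense subspace: if \<open>x\<close> cannot be added to
  it, then some combination with bounded coefficients and a nonzero coefficient at \<open>x\<close> is small
  relative to its largest coefficient, and dividing by the coefficient of \<open>x\<close> approximates \<open>x\<close>.\<close>

lemma maximal_top_indep_dense:
  fixes v :: "'a::field_char_0 \<Rightarrow> real"
  assumes w: "absolute_value w" and v: "v \<in> extensions w" and ti: "top_indep w v n b"
    and max: "\<And>c. \<not> top_indep w v (Suc n) c" and e: "0 < e"
  shows "\<exists>q. v (x - (\<Sum>i<n. of_rat (q i) * b i)) < e"
proof -
  note av = extensions_absval[OF v]
  obtain C where C: "C > 0" "\<And>q j. j < n \<Longrightarrow> C * w (q j) \<le> v (\<Sum>i<n. of_rat (q i) * b i)"
    using ti unfolding top_indep_def by blast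
  \<comment> \<open>\<open>M\<close> bounds the largest coefficient by a multiple of the one at
    \<open>x\<close>, for combinations of value less than \<open>d\<close> times the largest
    coefficient\<close>
  define M where "M = max 1 (2 * v x / C)"
  define d where "d = min (C / 2) (e / M)"
  have M: "M \<ge> 1" by (simp add: M_def)
  have d: "d > 0" "d \<le> C / 2" "d * M \<le> e" using C e M by (auto simp: d_def min_def field_simps)
  define c where "c = (\<lambda>i. if i < n then b i else x)"
  have sumc: "(\<Sum>i<Suc n. of_rat (q i) * c i) = (\<Sum>i<n. of_rat (q i) * b i) + of_rat (q n) * x" for q
    by (simp add: c_def)
  from max[of c] obtain q j where j: "j < Suc n"
    and lt: "v (\<Sum>i<Suc n. of_rat (q i) * c i) < d * w (q j)"
    unfolding top_indep_def using d(1) by (metis not_le)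
  define m where "m = Max ((\<lambda>i. w (q i)) ` {..<Suc n})"
  have mge: "w (q i) \<le> m" if "i < Suc n" for i unfolding m_def using that by (intro Max_ge) auto
  have "m \<in> (\<lambda>i. w (q i)) ` {..<Suc n}" unfolding m_def by (rule Max_in) auto
  then obtain k where k: "k < Suc n" "m = w (q k)" by auto
  let ?s = "\<Sum>i<n. of_rat (q i) * b i"
  have lt2: "v (?s + of_rat (q n) * x) < d * m"
    using lt mult_left_mono[OF mge[OF j], of d] d(1) unfolding sumc by linarith
  have m0: "m \<ge> 0" using k absval_nonneg[OF w] by simp
  have mM: "m \<le> M * w (q n)"
  proof (cases "k = n")
    case True
    thus ?thesis using k M m0 mult_right_mono[OF M, of m] by simp
  next
    case False
    hence "C * m \<le> v ?s" using C(2)[of k q] k by simp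
    also have "\<dots> \<le> v (?s + of_rat (q n) * x) + w (q n) * v x"
      using absval_diff[OF av, of "?s + of_rat (q n) * x" "of_rat (q n) * x"]
      by (simp add: absval_mult[OF av] extensions_of_rat[OF v])
    also have "\<dots> \<le> C / 2 * m + w (q n) * v x"
      using lt2 mult_right_mono[OF d(2) m0] by simp
    finally have "C / 2 * m \<le> w (q n) * v x" by (simp add: field_simps)
    hence "m \<le> 2 * v x / C * w (q n)" using C(1) by (simp add: field_simps)
    also have "\<dots> \<le> M * w (q n)" using absval_nonneg[OF w]
      by (intro mult_right_mono) (auto simp: M_def)
    finally show ?thesis .
  qed
  have q0: "q n \<noteq> 0"
  proof
    assume "q n = 0"
    hence "m \<le> 0" using mM absval_0[OF w] by simp
    hence "v (?s + of_rat (q n) * x) < 0" using lt2 m0 d(1) by (simp add: antisym)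
    thus False using absval_nonneg[OF av] by (simp add: not_less[symmetric])
  qed
  define q' where "q' = (\<lambda>i. - q i / q n)"
  have "x - (\<Sum>i<n. of_rat (q' i) * b i) = (?s + of_rat (q n) * x) / of_rat (q n)"
    using q0 by (simp add: q'_def sum_negf of_rat_divide of_rat_minus add_divide_distrib sum_divide_distrib
      add.commute)
  hence "v (x - (\<Sum>i<n. of_rat (q' i) * b i)) = v (?s + of_rat (q n) * x) / w (q n)"
    by (simp add: absval_divide[OF av] extensions_of_rat[OF v])
  also have "\<dots> < d * m / w (q n)"
    using lt2 absval_pos[OF w q0] by (simp add: divide_strict_right_mono)
  also have "\<dots> \<le> d * M" using mM d(1) absval_pos[OF w q0] by (simp add: field_simps)
  also have "\<dots> \<le> e" by (rule d(3))
  finally show ?thesis by blast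
qed

lemma top_basis_exists:
  fixes v :: "'a::field_char_0 \<Rightarrow> real"
  assumes w: "absolute_value w" and v: "v \<in> extensions w"
    and bound: "\<And>n (b :: nat \<Rightarrow> 'a). top_indep w v n b \<Longrightarrow> n \<le> d"
  shows "\<exists>n b. top_basis w v n b"
proof -
  let ?P = "\<lambda>n. \<exists>b. top_indep w v n b"
  have P0: "?P 0" unfolding top_indep_def by (intro exI[of _ undefined] exI[of _ 1]) auto
  \<comment> \<open>a family of the greatest possible length is maximal\<close>
  define n where "n = (GREATEST n. ?P n)"
  have "?P n" unfolding n_def by (rule GreatestI_nat[of ?P 0 d]) (use P0 bound in auto)
  then obtain b where b: "top_indep w v n b" by blast
  have "\<not> ?P (Suc n)"
  proof
    assume "?P (Suc n)"
    hence "Suc n \<le> n" using Greatest_le_nat[of ?P "Suc n" d] bound unfolding n_def by blast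
    thus False by simp
  qed
  hence "top_basis w v n b"
    unfolding top_basis_def using b maximal_top_indep_dense[OF w v b] by blast
  thus ?thesis by blast
qed

section \<open>Algebraic integers\<close>

text \<open>The number \<open>y\<close> is an eigenvalue of an integer matrix, hence a root of its
  characteristic polynomial, which is monic.\<close>

lemma algebraic_int_if_int_matrix:
  fixes y :: "'a::field_char_0" and M :: "nat \<Rightarrow> nat \<Rightarrow> int"
  assumes eq: "\<And>i. i < n \<Longrightarrow> y * b i = (\<Sum>j<n. of_int (M i j) * b j)"
    and nz: "\<exists>i<n. b i \<noteq> 0"
  shows "algebraic_int y"
proof -
  define A where "A = mat n n (\<lambda>(i, j). M i j)"
  have A: "A \<in> carrier_mat n n" by (simp add: A_def)
  let ?A = "map_mat of_int A :: 'a mat"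
  have A': "?A \<in> carrier_mat n n" using A by simp
  have "?A *\<^sub>v vec n b = y \<cdot>\<^sub>v vec n b"
  proof (rule eq_vecI)
    fix i assume "i < dim_vec (y \<cdot>\<^sub>v vec n b)"
    hence i: "i < n" by simp
    have "(?A *\<^sub>v vec n b) $ i = (\<Sum>j<n. of_int (M i j) * b j)"
      using i by (simp add: A_def scalar_prod_def lessThan_atLeast0)
    thus "(?A *\<^sub>v vec n b) $ i = (y \<cdot>\<^sub>v vec n b) $ i" using i eq by simp
  qed (simp add: A_def)
  moreover have "vec n b \<noteq> 0\<^sub>v n"
    using nz by (metis index_vec index_zero_vec(1))
  ultimately have "eigenvalue ?A y"
    unfolding eigenvalue_def eigenvector_def using A by (intro exI[of _ "vec n b"]) simp
  hence "poly (map_poly of_int (char_poly A)) y = 0"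
    using eigenvalue_root_char_poly[OF A'] of_int_hom.char_poly_hom[OF A, where ?'a = 'a] by simp
  moreover have "lead_coeff (char_poly A) = 1"
    using degree_monic_char_poly[OF A] by simp
  ultimately show ?thesis unfolding algebraic_int_altdef_ipoly by blast
qed

interpretation Zm: Modules.module "\<lambda>(c::int) (x::'a::field_char_0). of_int c * x"
  by unfold_locales (simp_all add: algebra_simps)

lemma algebraic_int_if_stable_span:
  fixes y :: "'a::field_char_0"
  assumes fin: "finite G" and nz: "\<exists>g\<in>G. g \<noteq> 0" and st: "\<And>g. g \<in> G \<Longrightarrow> y * g \<in> Zm.span G"
  shows "algebraic_int y"
proof -
  obtain e where e: "bij_betw e {..<card G} G"
    using ex_bij_betw_nat_finite[OF fin] by (auto simp: lessThan_atLeast0)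
  have "\<exists>u. y * g = (\<Sum>v\<in>G. of_int (u v) * v)" if "g \<in> G" for g
    using st[OF that] unfolding Zm.span_finite[OF fin] by auto
  then obtain u where u: "\<And>g. g \<in> G \<Longrightarrow> y * g = (\<Sum>v\<in>G. of_int (u g v) * v)" by metis
  show ?thesis
  proof (rule algebraic_int_if_int_matrix)
    fix i assume i: "i < card G"
    hence "e i \<in> G" using e bij_betwE by blast
    hence "y * e i = (\<Sum>v\<in>G. of_int (u (e i) v) * v)" by (rule u)
    also have "\<dots> = (\<Sum>j<card G. of_int (u (e i) (e j)) * e j)"
      by (rule sum.reindex_bij_betw[OF e, symmetric])
    finally show "y * e i = (\<Sum>j<card G. of_int (u (e i) (e j)) * e j)" .
  next
    show "\<exists>i<card G. e i \<noteq> 0" using nz e by (metis bij_betw_iff_bijections lessThan_iff)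
  qed
qed

lemma algebraic_int_if_monic_relation:
  fixes z :: "'a::field_char_0"
  assumes "z ^ Suc n = (\<Sum>i\<le>n. of_int (b i) * z ^ (n - i))"
  shows "algebraic_int z"
proof (rule algebraic_int_if_stable_span[where G = "(\<lambda>k. z ^ k) ` {..n}"])
  have "1 \<in> (\<lambda>k. z ^ k) ` {..n}" by (rule image_eqI[of _ _ 0]) auto
  thus "\<exists>g\<in>(\<lambda>k. z ^ k) ` {..n}. g \<noteq> 0" by (intro bexI[of _ 1]) auto
  fix g assume "g \<in> (\<lambda>k. z ^ k) ` {..n}"
  then obtain k where k: "k \<le> n" "g = z ^ k" by auto
  show "z * g \<in> Zm.span ((\<lambda>k. z ^ k) ` {..n})"
  proof (cases "k = n")
    case True
    hence "z * g = (\<Sum>i\<le>n. of_int (b i) * z ^ (n - i))" using k assms by simp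
    also have "\<dots> \<in> Zm.span ((\<lambda>k. z ^ k) ` {..n})"
      by (intro Zm.span_sum Zm.span_scale Zm.span_base) auto
    finally show ?thesis .
  next
    case False
    hence "z * g = z ^ Suc k" "z ^ Suc k \<in> (\<lambda>k. z ^ k) ` {..n}" using k by (simp, intro imageI) simp
    thus ?thesis by (simp only: Zm.span_base)
  qed
qed simp

lemma algebraic_int_obtain_power_relation:
  fixes x :: "'a::field_char_0"
  assumes "algebraic_int x"
  obtains m a where "m > 0" "x ^ m = (\<Sum>k<m. of_int (a k) * x ^ k)"
proof -
  obtain p where p: "poly (map_poly of_int p) x = 0" "lead_coeff p = 1"
    using assms unfolding algebraic_int_altdef_ipoly by blast
  define m where "m = Polynomial.degree p"
  have "(\<Sum>i\<le>m. of_int (poly.coeff p i) * x ^ i) = 0"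
    using p(1) by (simp add: poly_altdef m_def)
  hence "x ^ m + (\<Sum>i<m. of_int (poly.coeff p i) * x ^ i) = 0"
    using p(2) by (simp add: m_def lessThan_Suc_atMost[symmetric] add.commute)
  hence eq: "x ^ m = (\<Sum>i<m. of_int (- poly.coeff p i) * x ^ i)"
    by (simp add: sum_negf eq_neg_iff_add_eq_0)
  moreover have "m > 0"
  proof (rule ccontr)
    assume "\<not> m > 0"
    thus False using eq by simp
  qed
  ultimately show ?thesis using that[of m "\<lambda>k. - poly.coeff p k"] by simp
qed

lemma Zspan_mult_closed:
  assumes "\<And>g. g \<in> G \<Longrightarrow> x * g \<in> Zm.span G" and "z \<in> Zm.span G"
  shows "x * z \<in> Zm.span G"
  using assms(2)
proof (induction rule: Zm.span_induct_alt)
  case base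
  thus ?case by (simp add: Zm.span_zero)
next
  case (step c g y)
  have "x * (of_int c * g + y) = of_int c * (x * g) + x * y" by (simp add: algebra_simps)
  thus ?case using step assms(1) by (simp add: Zm.span_add Zm.span_scale)
qed

text \<open>The products \<open>x\<^sup>i y\<^sup>j\<close> with bounded exponents generate a group
  that is stable under multiplication by \<open>x\<close> and by \<open>y\<close>, hence by \<open>x
  + y\<close> and \<open>x y\<close>.\<close>

lemma algebraic_int_plus_times:
  fixes x y :: "'a::field_char_0"
  assumes "algebraic_int x" "algebraic_int y"
  shows "algebraic_int (x + y)" "algebraic_int (x * y)"
proof -
  obtain m a where m: "m > 0" "x ^ m = (\<Sum>k<m. of_int (a k) * x ^ k)"
    using algebraic_int_obtain_power_relation[OF assms(1)] .
  obtain n b where n: "n > 0" "y ^ n = (\<Sum>k<n. of_int (b k) * y ^ k)"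
    using algebraic_int_obtain_power_relation[OF assms(2)] .
  define G where "G = (\<lambda>(i, j). x ^ i * y ^ j) ` ({..<m} \<times> {..<n})"
  have fin: "finite G" by (simp add: G_def)
  have mem: "x ^ i * y ^ j \<in> G" if "i < m" "j < n" for i j
    using that by (force simp: G_def)
  have "1 \<in> G" using mem[of 0 0] m n by simp
  hence nz: "\<exists>g\<in>G. g \<noteq> 0" by (intro bexI[of _ 1]) auto
  have Gcases: "\<exists>i j. g = x ^ i * y ^ j \<and> i < m \<and> j < n" if "g \<in> G" for g
    using that unfolding G_def by auto
  have sx: "x * g \<in> Zm.span G" if gG: "g \<in> G" for g
  proof -
    obtain i j where g: "g = x ^ i * y ^ j" "i < m" "j < n" using Gcases[OF gG] by blast
    show ?thesis
    proof (cases "Suc i < m")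
      case True
      hence "x * g \<in> G" using mem[of "Suc i" j] g by (simp add: mult.assoc)
      thus ?thesis by (rule Zm.span_base)
    next
      case False
      hence "Suc i = m" using g by simp
      hence "x * g = x ^ m * y ^ j" using g by (metis power_Suc mult.assoc)
      also have "\<dots> = (\<Sum>k<m. of_int (a k) * (x ^ k * y ^ j))"
        unfolding m(2) by (simp add: sum_distrib_right mult.assoc)
      also have "\<dots> \<in> Zm.span G"
        using g by (intro Zm.span_sum Zm.span_scale Zm.span_base mem) auto
      finally show ?thesis .
    qed
  qed
  have sy: "y * g \<in> Zm.span G" if gG: "g \<in> G" for g
  proof -
    obtain i j where g: "g = x ^ i * y ^ j" "i < m" "j < n" using Gcases[OF gG] by blast
    show ?thesis
    proof (cases "Suc j < n")
      case True
      hence "y * g \<in> G" using mem[of i "Suc j"] g by (simp add: mult.left_commute)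
      thus ?thesis by (rule Zm.span_base)
    next
      case False
      hence "Suc j = n" using g by simp
      hence "y * g = x ^ i * y ^ n" using g by (metis power_Suc mult.left_commute)
      also have "\<dots> = (\<Sum>k<n. of_int (b k) * (x ^ i * y ^ k))"
        unfolding n(2) by (simp add: sum_distrib_left mult.left_commute)
      also have "\<dots> \<in> Zm.span G"
        using g by (intro Zm.span_sum Zm.span_scale Zm.span_base mem) auto
      finally show ?thesis .
    qed
  qed
  show "algebraic_int (x + y)"
    by (rule algebraic_int_if_stable_span[OF fin nz]) (simp add: distrib_right Zm.span_add sx sy)
  show "algebraic_int (x * y)"
    by (rule algebraic_int_if_stable_span[OF fin nz])
      (simp add: mult.assoc Zspan_mult_closed[of G x, OF sx] sy)
qed

lemma algebraic_int_sum_list: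
  "(\<And>x. x \<in> set xs \<Longrightarrow> algebraic_int x) \<Longrightarrow> algebraic_int (sum_list xs :: 'a::field_char_0)"
  by (induction xs) (auto intro: algebraic_int_plus_times)

section \<open>The trace of a matrix as the sum of its eigenvalues\<close>

lemma diag_sum_mult_commute:
  fixes A B :: "'a::comm_ring_1 mat"
  assumes "A \<in> carrier_mat n n" "B \<in> carrier_mat n n"
  shows "(\<Sum>i<n. (A * B) $$ (i, i)) = (\<Sum>i<n. (B * A) $$ (i, i))"
proof -
  have "(\<Sum>i<n. (A * B) $$ (i, i)) = (\<Sum>i<n. \<Sum>j<n. A $$ (i, j) * B $$ (j, i))"
    using assms by (intro sum.cong) (auto simp: scalar_prod_def lessThan_atLeast0)
  also have "\<dots> = (\<Sum>j<n. \<Sum>i<n. A $$ (i, j) * B $$ (j, i))" by (rule sum.swap)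
  also have "\<dots> = (\<Sum>i<n. (B * A) $$ (i, i))"
    using assms by (intro sum.cong) (auto simp: scalar_prod_def lessThan_atLeast0 mult.commute)
  finally show ?thesis .
qed

text \<open>The sum of the diagonal is invariant under conjugation, and by Schur decomposition the
  matrix is conjugate to a triangular one with the eigenvalues on the diagonal.\<close>

lemma complex_diag_sum_eigenvalues:
  fixes A :: "complex mat"
  assumes A: "A \<in> carrier_mat n n"
  shows "\<exists>es. length es = n \<and> (\<Sum>i<n. A $$ (i, i)) = sum_list es \<and> (\<forall>e\<in>set es. eigenvalue A e)"
proof -
  obtain es where es: "char_poly A = (\<Prod>a\<leftarrow>es. [:- a, 1:])" "length es = n"
    using char_poly_factorized[OF A] by blast
  obtain B P Q where s: "schur_decomposition A es = (B, P, Q)"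
    by (cases "schur_decomposition A es") auto
  note sd = schur_decomposition[OF A es(1) s]
  have c: "B \<in> carrier_mat n n" "P \<in> carrier_mat n n" "Q \<in> carrier_mat n n" "Q * P = 1\<^sub>m n" "A = P * B * Q"
    using similar_mat_witD2[OF A] sd by auto
  have "(\<Sum>i<n. A $$ (i, i)) = (\<Sum>i<n. ((P * B) * Q) $$ (i, i))" using c(5) by simp
  also have "\<dots> = (\<Sum>i<n. (Q * (P * B)) $$ (i, i))"
    using c by (intro diag_sum_mult_commute) auto
  also have "Q * (P * B) = B"
    using c assoc_mult_mat[of Q n n P n B n] by simp
  also have "(\<Sum>i<n. B $$ (i, i)) = sum_list (diag_mat B)"
    using c by (simp add: diag_mat_def interv_sum_list_conv_sum_set_nat lessThan_atLeast0)
  also have "diag_mat B = es" using sd by simp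
  finally have 1: "(\<Sum>i<n. A $$ (i, i)) = sum_list es" .
  have "eigenvalue A e" if "e \<in> set es" for e
    unfolding eigenvalue_root_char_poly[OF A] es(1) using that
    by (auto simp: poly_prod_list prod_list_zero_iff)
  thus ?thesis using 1 es by blast
qed

section \<open>Number fields as vector spaces over the rationals\<close>

lemma rational_independent_family:
  fixes b :: "'i \<Rightarrow> 'a::field_char_0"
  assumes fin: "finite I"
    and ind: "\<And>q i. (\<Sum>i\<in>I. of_rat (q i) * b i) = 0 \<Longrightarrow> i \<in> I \<Longrightarrow> q i = 0"
  shows "inj_on b I" "Qvs.independent (b ` I)"
proof -
  show inj: "inj_on b I"
  proof (rule inj_onI, rule ccontr)
    fix i j assume ij: "i \<in> I" "j \<in> I" "b i = b j" "i \<noteq> j"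
    define q :: "'i \<Rightarrow> rat" where "q = (\<lambda>k. (if k = i then 1 else 0) - (if k = j then 1 else 0))"
    have "(\<Sum>k\<in>I. of_rat (q k) * b k) = (\<Sum>k\<in>I. (if k = i then b k else 0)) - (\<Sum>k\<in>I. (if k = j then b k else 0))"
      unfolding sum_subtractf[symmetric] by (rule sum.cong) (auto simp: q_def)
    also have "\<dots> = 0" using ij fin by simp
    finally have "q i = 0" using ind ij(1) by blast
    thus False using ij by (simp add: q_def)
  qed
  show "Qvs.independent (b ` I)"
  proof (rule Qvs.independent_if_scalars_zero)
    show "finite (b ` I)" using fin by simp
    fix f x assume s: "(\<Sum>x\<in>b ` I. of_rat (f x) * x) = 0" and x: "x \<in> b ` I"
    have "(\<Sum>i\<in>I. of_rat (f (b i)) * b i) = 0" using s by (simp add: sum.reindex[OF inj] o_def)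
    thus "f x = 0" using ind[of "f \<circ> b"] x by auto
  qed
qed

locale number_field_type =
  fixes ty :: "'a::field_char_0 itself"
  assumes number_field: "number_field TYPE('a)"
begin

definition B :: "'a set" where
  "B = (SOME B. Qvs.independent B \<and> Qvs.span B = UNIV)"

definition coord :: "'a \<Rightarrow> 'a \<Rightarrow> rat" where
  "coord = Qvs.representation B"

lemma B_props: "Qvs.independent B" "Qvs.span B = UNIV"
proof -
  obtain C :: "'a set" where "Qvs.independent C" "UNIV \<subseteq> Qvs.span C"
    using Qvs.maximal_independent_subset[of UNIV] by blast
  hence "\<exists>C::'a set. Qvs.independent C \<and> Qvs.span C = UNIV" by blast
  hence "Qvs.independent B \<and> Qvs.span B = UNIV" unfolding B_def by (rule someI_ex)
  thus "Qvs.independent B" "Qvs.span B = UNIV" by auto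
qed

lemma finite_B: "finite B"
proof -
  obtain C :: "'a set" where "finite C" "Qvs.span C = UNIV"
    using number_field unfolding number_field_def by blast
  thus ?thesis using Qvs.independent_span_bound[of C B] B_props by simp
qed

interpretation fd: finite_dimensional_vector_space "\<lambda>(q::rat) (x::'a). of_rat q * x" B
  by unfold_locales (use finite_B B_props in auto)

abbreviation d where "d \<equiv> nf_degree ty"

lemma d_eq: "d = card B"
  unfolding nf_degree_def by (rule fd.dim_UNIV)

lemma d_pos: "d > 0"
proof -
  have "B \<noteq> {}" using B_props(2) by (metis Qvs.span_empty UNIV_I singletonD zero_neq_one)
  thus ?thesis using finite_B by (simp add: d_eq card_gt_0_iff)
qed

lemma coord_sum: "(\<Sum>b\<in>B. of_rat (coord x b) * b) = x"
  unfolding coord_def using Qvs.sum_representation_eq[of B x B] B_props finite_B by simp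

lemma coord_add: "coord (x + y) b = coord x b + coord y b"
  unfolding coord_def using Qvs.representation_add[of B y x] B_props by simp

lemma coord_scale: "coord (of_rat q * x) b = q * coord x b"
  unfolding coord_def using Qvs.representation_scale[of B x q] B_props by simp

lemma coord_sum_distrib: "coord (\<Sum>i\<in>I. f i) b = (\<Sum>i\<in>I. coord (f i) b)"
  unfolding coord_def using Qvs.representation_sum[of B I f] B_props by simp

lemma coord_basis: "b \<in> B \<Longrightarrow> coord b c = (if c = b then 1 else 0)"
  unfolding coord_def using Qvs.representation_basis[of B b] B_props by simp

lemma coord_combination: "c \<in> B \<Longrightarrow> coord (\<Sum>b\<in>B. of_rat (f b) * b) c = f c"
  by (simp add: coord_sum_distrib coord_scale coord_basis finite_B if_distrib[of "\<lambda>x. _ * x"] cong: if_cong)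

lemma card_le_degree:
  fixes b :: "'i \<Rightarrow> 'a"
  assumes fin: "finite I"
    and ind: "\<And>q i. (\<Sum>i\<in>I. of_rat (q i) * b i) = 0 \<Longrightarrow> i \<in> I \<Longrightarrow> q i = 0"
  shows "card I \<le> d"
proof -
  have inj: "inj_on b I" and "Qvs.independent (b ` I)"
    using rational_independent_family[OF fin, of b] ind by blast+
  hence "card (b ` I) \<le> card B" using fd.independent_card_le_dim[of "b ` I" UNIV] by (simp add: fd.dim_UNIV)
  thus ?thesis using inj by (simp add: card_image d_eq)
qed

lemma card_eq_degree_if_spanning:
  fixes b :: "'i \<Rightarrow> 'a"
  assumes fin: "finite I"
    and span: "\<And>x. \<exists>q. x = (\<Sum>i\<in>I. of_rat (q i) * b i)"
  shows "d \<le> card I"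
proof -
  have "UNIV \<subseteq> Qvs.span (b ` I)"
  proof
    fix x obtain q where "x = (\<Sum>i\<in>I. of_rat (q i) * b i)" using span by blast
    also have "\<dots> \<in> Qvs.span (b ` I)" by (intro Qvs.span_sum Qvs.span_scale Qvs.span_base) auto
    finally show "x \<in> Qvs.span (b ` I)" .
  qed
  hence "d \<le> card (b ` I)" unfolding nf_degree_def using fin by (intro Qvs.dim_le_card) auto
  also have "\<dots> \<le> card I" using fin by (rule card_image_le)
  finally show ?thesis .
qed

section \<open>The trace form\<close>

lemma nf_trace_eq: "nf_trace x = (\<Sum>b\<in>B. coord (x * b) b)"
  unfolding nf_trace_def Let_def B_def coord_def ..

lemma nf_trace_add: "nf_trace (x + y :: 'a) = nf_trace x + nf_trace y"
  by (simp add: nf_trace_eq distrib_right coord_add sum.distrib)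

lemma nf_trace_scale: "nf_trace (of_rat q * x :: 'a) = q * nf_trace x"
  by (simp add: nf_trace_eq mult.assoc coord_scale sum_distrib_left)

lemma nf_trace_0: "nf_trace (0 :: 'a) = 0"
  using nf_trace_scale[of 0 0] by simp

lemma nf_trace_sum: "nf_trace (\<Sum>i\<in>I. f i :: 'a) = (\<Sum>i\<in>I. nf_trace (f i))"
  by (induction I rule: infinite_finite_induct) (simp_all add: nf_trace_0 nf_trace_add)

lemma nf_trace_1: "nf_trace (1 :: 'a) = of_nat d"
  by (simp add: nf_trace_eq coord_basis d_eq)

lemma trace_form_nondegenerate: "x = 0" if "\<And>y. nf_trace (x * y :: 'a) = 0"
proof (rule ccontr)
  assume "x \<noteq> 0"
  thus False using that[of "inverse x"] nf_trace_1 d_pos by simp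
qed

text \<open>The linear map sending \<open>a\<close> to the values of the trace form at
  \<open>a\<close> and the basis elements is injective as the form is nondegenerate, hence
  surjective.\<close>

lemma functional_eq_trace:
  fixes g :: "'a \<Rightarrow> rat"
  shows "\<exists>a. \<forall>b\<in>B. nf_trace (a * b) = g b"
proof -
  define T where "T = (\<lambda>a. \<Sum>b\<in>B. of_rat (nf_trace (a * b)) * b)"
  have lin: "Vector_Spaces.linear (\<lambda>(q::rat) (x::'a). of_rat q * x) (\<lambda>(q::rat) (x::'a). of_rat q * x) T"
    unfolding Vector_Spaces.linear_iff
  proof (intro conjI allI)
    fix x y :: 'a and q :: rat
    show "T (x + y) = T x + T y"
      unfolding T_def distrib_right nf_trace_add of_rat_add sum.distrib ..
    show "T (of_rat q * x) = of_rat q * T x"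
      unfolding T_def mult.assoc nf_trace_scale of_rat_mult sum_distrib_left ..
  qed (rule Qvs.vector_space_axioms)+
  interpret lin: Vector_Spaces.linear "\<lambda>(q::rat) (x::'a). of_rat q * x" "\<lambda>(q::rat) (x::'a). of_rat q * x" T by (rule lin)
  have "inj T"
  proof (subst lin.inj_iff_eq_0, intro allI impI)
    fix a assume "T a = 0"
    hence "coord (T a) b = 0" for b using coord_scale[of 0 0 b] by simp
    hence z: "nf_trace (a * b) = 0" if "b \<in> B" for b
      using coord_combination[OF that, of "\<lambda>b. nf_trace (a * b)"] by (simp add: T_def)
    show "a = 0"
    proof (rule trace_form_nondegenerate)
      fix y
      have "a * y = (\<Sum>b\<in>B. of_rat (coord y b) * (a * b))"
        by (subst coord_sum[of y, symmetric]) (simp add: sum_distrib_left mult.left_commute)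
      thus "nf_trace (a * y) = 0" by (simp add: nf_trace_sum nf_trace_scale z)
    qed
  qed
  hence "surj T" using fd.linear_inj_imp_surj[OF lin] by blast
  then obtain a where a: "T a = (\<Sum>b\<in>B. of_rat (g b) * b)" by (metis surjD)
  have "nf_trace (a * b) = g b" if "b \<in> B" for b
    using coord_combination[OF that, of "\<lambda>b. nf_trace (a * b)"] coord_combination[OF that, of g] a
    by (simp add: T_def)
  thus ?thesis by blast
qed

lemma linear_functional_eq_trace:
  fixes l :: "'a \<Rightarrow> rat"
  assumes add: "\<And>x y. l (x + y) = l x + l y" and scale: "\<And>q x. l (of_rat q * x) = q * l x"
  shows "\<exists>a. \<forall>x. l x = nf_trace (a * x)"
proof -
  obtain a where a: "\<And>b. b \<in> B \<Longrightarrow> nf_trace (a * b) = l b" using functional_eq_trace[of l] by blast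
  have l0: "l 0 = 0" using scale[of 0 0] by simp
  have ls: "l (\<Sum>i\<in>I. f i) = (\<Sum>i\<in>I. l (f i))" for I and f :: "'a \<Rightarrow> 'a"
    by (induction I rule: infinite_finite_induct) (simp_all add: l0 add)
  have "l x = nf_trace (a * x)" for x
  proof -
    have "l x = (\<Sum>b\<in>B. coord x b * l b)"
      by (subst coord_sum[of x, symmetric]) (simp add: ls scale)
    also have "\<dots> = (\<Sum>b\<in>B. nf_trace (of_rat (coord x b) * (a * b)))"
      using a by (simp add: nf_trace_scale)
    also have "\<dots> = nf_trace (a * x)"
      by (subst (2) coord_sum[of x, symmetric]) (simp add: nf_trace_sum sum_distrib_left mult.left_commute)
    finally show ?thesis .
  qed
  thus ?thesis by blast
qed

text \<open>A left eigenvector of multiplication by \<open>x\<close>. The common eigenvectors for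
  all \<open>x\<close> are, up to scaling, the complex embeddings; so this is a first step towards
  an embedding that sends \<open>x\<close> to \<open>e\<close>.\<close>

definition eigen_functional :: "'a \<Rightarrow> complex \<Rightarrow> ('a \<Rightarrow> complex) \<Rightarrow> bool" where
  "eigen_functional x e f \<longleftrightarrow>
     (\<forall>y z. f (y + z) = f y + f z) \<and> (\<forall>q y. f (of_rat q * y) = of_rat q * f y) \<and>
     (\<exists>y. f y \<noteq> 0) \<and> (\<forall>y. f (x * y) = e * f y)"

text \<open>An eigenvector of the complex matrix of multiplication by \<open>x\<close> lists the
  values of an eigenfunctional on the basis.\<close>

lemma trace_eq_sum_eigenvalues:
  "\<exists>es. length es = d \<and> of_rat (nf_trace x) = sum_list es \<and> (\<forall>e\<in>set es. \<exists>f. eigen_functional x e f)"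
proof -
  obtain b where b: "bij_betw b {..<d} B"
    using ex_bij_betw_nat_finite[OF finite_B] unfolding lessThan_atLeast0 d_eq by blast
  have bB: "b i \<in> B" if "i < d" for i using b that bij_betwE by blast
  define A where "A = mat d d (\<lambda>(i, j). of_rat (coord (x * b i) (b j)) :: complex)"
  have A: "A \<in> carrier_mat d d" by (simp add: A_def)
  have "of_rat (nf_trace x) = (\<Sum>c\<in>B. of_rat (coord (x * c) c))"
    by (simp add: nf_trace_eq of_rat_sum)
  also have "\<dots> = (\<Sum>i<d. A $$ (i, i))"
    by (subst sum.reindex_bij_betw[OF b, symmetric]) (simp add: A_def)
  finally have tr: "of_rat (nf_trace x) = (\<Sum>i<d. A $$ (i, i))" .
  obtain es where es: "length es = d" "(\<Sum>i<d. A $$ (i, i)) = sum_list es" "\<forall>e\<in>set es. eigenvalue A e"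
    using complex_diag_sum_eigenvalues[OF A] by blast
  have "\<exists>f. eigen_functional x e f" if e: "e \<in> set es" for e
  proof -
    obtain u where u: "u \<in> carrier_vec d" "u \<noteq> 0\<^sub>v d" "A *\<^sub>v u = e \<cdot>\<^sub>v u"
      using es(3) e A unfolding eigenvalue_def eigenvector_def by auto
    define ix where "ix = the_inv_into {..<d} b"
    have ix: "ix (b i) = i" if "i < d" for i
      unfolding ix_def using b that by (simp add: bij_betw_def the_inv_into_f_f)
    define f where "f = (\<lambda>y. \<Sum>c\<in>B. of_rat (coord y c) * u $ ix c)"
    have fadd: "f (y + z) = f y + f z" for y z
      by (simp add: f_def coord_add of_rat_add distrib_right sum.distrib)
    have fsc: "f (of_rat q * y) = of_rat q * f y" for q y
      unfolding f_def coord_scale of_rat_mult mult.assoc sum_distrib_left ..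
    have fs: "f (\<Sum>i\<in>I. h i) = (\<Sum>i\<in>I. f (h i))" for I and h :: "'a \<Rightarrow> 'a"
      using fsc[of 0 0] by (induction I rule: infinite_finite_induct) (simp_all add: fadd)
    have fb: "f (b i) = u $ i" if "i < d" for i
      unfolding f_def using bB[OF that] ix[OF that] finite_B
      by (simp add: coord_basis if_distrib[of of_rat] if_distrib[of "\<lambda>t. t * _"] cong: if_cong)
    have feb: "f (x * b i) = e * f (b i)" if i: "i < d" for i
    proof -
      have "f (x * b i) = (\<Sum>j<d. of_rat (coord (x * b i) (b j)) * u $ j)"
        unfolding f_def by (subst sum.reindex_bij_betw[OF b, symmetric]) (simp add: ix)
      also have "\<dots> = (A *\<^sub>v u) $ i"
        using i u(1) by (simp add: A_def scalar_prod_def lessThan_atLeast0)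
      also have "\<dots> = e * f (b i)" using u i by (simp add: fb)
      finally show ?thesis .
    qed
    have feB: "f (x * c) = e * f c" if "c \<in> B" for c
    proof -
      have "c \<in> b ` {..<d}" using b that by (simp add: bij_betw_imp_surj_on)
      thus ?thesis using feb by blast
    qed
    have "f (x * y) = e * f y" for y
    proof -
      have "x * y = (\<Sum>c\<in>B. of_rat (coord y c) * (x * c))"
        by (subst coord_sum[of y, symmetric]) (simp add: sum_distrib_left mult.left_commute)
      hence "f (x * y) = (\<Sum>c\<in>B. of_rat (coord y c) * f (x * c))"
        by (simp add: fs fsc)
      also have "\<dots> = e * (\<Sum>c\<in>B. f (of_rat (coord y c) * c))"
        unfolding sum_distrib_left by (rule sum.cong[OF refl]) (simp add: feB fsc)
      also have "\<dots> = e * f y" by (simp add: fs[symmetric] coord_sum)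
      finally show ?thesis .
    qed
    moreover have "\<exists>y. f y \<noteq> 0"
    proof -
      obtain i where "i < d" "u $ i \<noteq> 0" using u(1,2) by (metis carrier_vecD eq_vecI index_zero_vec)
      thus ?thesis using fb by metis
    qed
    ultimately have "eigen_functional x e f" unfolding eigen_functional_def using fadd fsc by blast
    thus ?thesis by blast
  qed
  thus ?thesis using es tr by metis
qed

lemma eigen_functional_poly:
  assumes "eigen_functional x e f"
  shows "f (poly (map_poly of_rat p) x * y) = poly (map_poly of_rat p) e * f y"
proof (induction p arbitrary: y)
  case 0
  have "f 0 = 0" using assms unfolding eigen_functional_def by (metis mult_zero_left of_rat_0)
  thus ?case by simp
next
  case (pCons a p)
  have "poly (map_poly of_rat (pCons a p)) x * y = of_rat a * y + x * (poly (map_poly of_rat p) x * y)"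
    by (simp add: of_rat_hom.map_poly_pCons_hom distrib_right mult.assoc)
  hence "f (poly (map_poly of_rat (pCons a p)) x * y) = of_rat a * f y + e * (f (poly (map_poly of_rat p) x * y))"
    using assms unfolding eigen_functional_def by metis
  thus ?case using pCons.IH by (simp add: of_rat_hom.map_poly_pCons_hom algebra_simps)
qed

lemma map_poly_of_rat_of_int:
  "map_poly of_rat (map_poly of_int p) = (map_poly of_int p :: 'b::field_char_0 poly)"
  by (intro poly_eqI) (simp add: coeff_map_poly)

text \<open>An eigenfunctional turns multiplication by \<open>P(x)\<close> into multiplication by
  \<open>P(e)\<close>, so every polynomial with root \<open>x\<close> has the root
  \<open>e\<close>.\<close>

lemma eigenvalue_algebraic_int:
  assumes "eigen_functional x e f" "algebraic_int x"
  shows "algebraic_int e"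
proof -
  obtain p where p: "poly (map_poly of_int p) x = 0" "lead_coeff p = 1"
    using assms(2) unfolding algebraic_int_altdef_ipoly by blast
  obtain y where y: "f y \<noteq> 0" using assms(1) unfolding eigen_functional_def by blast
  have "f 0 = 0" using assms(1) unfolding eigen_functional_def by (metis mult_zero_left of_rat_0)
  hence "poly (map_poly of_int p) e * f y = 0"
    using eigen_functional_poly[OF assms(1), of "map_poly of_int p" y] p(1) by (simp add: map_poly_of_rat_of_int)
  thus ?thesis using p(2) y unfolding algebraic_int_altdef_ipoly by auto
qed

lemma nf_trace_Ints: "nf_trace x \<in> \<int>" if "algebraic_int (x::'a)"
proof -
  obtain es where es: "of_rat (nf_trace x) = sum_list es" "\<forall>e\<in>set es. \<exists>f. eigen_functional x e f"
    using trace_eq_sum_eigenvalues[of x] by blast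
  have "algebraic_int (sum_list es)"
    using es(2) eigenvalue_algebraic_int that by (intro algebraic_int_sum_list) blast
  hence "of_rat (nf_trace x) \<in> (\<int> :: complex set)"
    using es(1) by (metis Rats_of_rat rational_algebraic_int_is_int)
  then obtain k :: int where "of_rat (nf_trace x) = (of_int k :: complex)" by (rule Ints_cases)
  hence "nf_trace x = of_int k" by (metis of_rat_of_int_eq of_rat_eq_iff)
  thus ?thesis by simp
qed

section \<open>The norm\<close>

definition enum :: "nat \<Rightarrow> 'a" where
  "enum = (SOME b. bij_betw b {..<d} B)"

lemma bij_enum: "bij_betw enum {..<d} B"
proof -
  have "\<exists>b. bij_betw b {..<d} B"
    using ex_bij_betw_nat_finite[OF finite_B] unfolding lessThan_atLeast0 d_eq by blast
  thus ?thesis unfolding enum_def by (rule someI_ex)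
qed

lemma enum_mem: "i < d \<Longrightarrow> enum i \<in> B"
  using bij_enum bij_betwE by blast

lemma coord_enum_sum: "(\<Sum>i<d. of_rat (coord x (enum i)) * enum i) = x"
proof -
  have "(\<Sum>i<d. of_rat (coord x (enum i)) * enum i) = (\<Sum>b\<in>B. of_rat (coord x b) * b)"
    by (rule sum.reindex_bij_betw[OF bij_enum])
  thus ?thesis by (simp add: coord_sum)
qed

definition mult_mat :: "'a \<Rightarrow> rat mat" where
  "mult_mat x = mat d d (\<lambda>(i, j). coord (x * enum i) (enum j))"

definition nf_norm :: "'a \<Rightarrow> rat" where
  "nf_norm x = det (mult_mat x)"

lemma mult_mat_carrier: "mult_mat x \<in> carrier_mat d d"
  by (simp add: mult_mat_def)

lemma nf_norm_mult: "nf_norm (x * y) = nf_norm x * nf_norm y"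
proof -
  have "mult_mat (x * y) = mult_mat y * mult_mat x"
  proof (rule eq_matI)
    fix i k assume "i < dim_row (mult_mat y * mult_mat x)" "k < dim_col (mult_mat y * mult_mat x)"
    hence ik: "i < d" "k < d" by (simp_all add: mult_mat_def)
    have "x * y * enum i = x * (\<Sum>j<d. of_rat (coord (y * enum i) (enum j)) * enum j)"
      by (simp add: coord_enum_sum mult.assoc)
    also have "\<dots> = (\<Sum>j<d. of_rat (coord (y * enum i) (enum j)) * (x * enum j))"
      by (simp add: sum_distrib_left mult.left_commute)
    finally have "coord (x * y * enum i) (enum k)
        = (\<Sum>j<d. coord (y * enum i) (enum j) * coord (x * enum j) (enum k))"
      by (simp add: coord_sum_distrib coord_scale)
    thus "mult_mat (x * y) $$ (i, k) = (mult_mat y * mult_mat x) $$ (i, k)"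
      using ik by (simp add: mult_mat_def scalar_prod_def lessThan_atLeast0)
  qed (simp_all add: mult_mat_def)
  thus ?thesis
    unfolding nf_norm_def using det_mult[OF mult_mat_carrier mult_mat_carrier] by (simp add: mult.commute)
qed

lemma nf_norm_1: "nf_norm 1 = 1"
proof -
  have "mult_mat 1 = 1\<^sub>m d"
  proof (rule eq_matI)
    fix i j assume "i < dim_row (1\<^sub>m d :: rat mat)" "j < dim_col (1\<^sub>m d :: rat mat)"
    hence ij: "i < d" "j < d" by simp_all
    have "enum j = enum i \<longleftrightarrow> j = i" using bij_enum ij by (auto simp: bij_betw_def inj_on_def)
    thus "mult_mat 1 $$ (i, j) = 1\<^sub>m d $$ (i, j)" using ij enum_mem
      by (auto simp: mult_mat_def coord_basis)
  qed (simp_all add: mult_mat_def)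
  thus ?thesis by (simp add: nf_norm_def)
qed

lemma nf_norm_power: "nf_norm (x ^ k) = nf_norm x ^ k"
  by (induction k) (simp_all add: nf_norm_1 nf_norm_mult)

lemma nf_norm_nonzero: "x \<noteq> 0 \<Longrightarrow> nf_norm x \<noteq> 0"
  using nf_norm_mult[of x "inverse x"] nf_norm_1 by auto

text \<open>In the basis \<open>f\<close> multiplication by \<open>x\<close> has the matrix
  \<open>R\<close>, and matrices conjugate by a change of basis have equal determinants.\<close>

lemma nf_norm_eq_det:
  fixes f :: "nat \<Rightarrow> 'a"
  assumes R: "R \<in> carrier_mat d d"
    and ind: "\<And>q i. (\<Sum>i<d. of_rat (q i) * f i) = 0 \<Longrightarrow> i < d \<Longrightarrow> q i = 0"
    and rep: "\<And>i. i < d \<Longrightarrow> x * f i = (\<Sum>j<d. of_rat (R $$ (i, j)) * f j)"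
  shows "nf_norm x = det R"
proof -
  define P where "P = mat d d (\<lambda>(i, j). coord (f i) (enum j))"
  have P: "P \<in> carrier_mat d d" by (simp add: P_def)
  have "P * mult_mat x = R * P"
  proof (rule eq_matI)
    fix i k assume "i < dim_row (R * P)" "k < dim_col (R * P)"
    hence ik: "i < d" "k < d" using R P by simp_all
    have "x * f i = x * (\<Sum>j<d. of_rat (coord (f i) (enum j)) * enum j)"
      by (simp add: coord_enum_sum)
    also have "\<dots> = (\<Sum>j<d. of_rat (coord (f i) (enum j)) * (x * enum j))"
      by (simp add: sum_distrib_left mult.left_commute)
    finally have "coord (x * f i) (enum k) = (\<Sum>j<d. coord (f i) (enum j) * coord (x * enum j) (enum k))"
      by (simp add: coord_sum_distrib coord_scale)
    moreover have "coord (x * f i) (enum k) = (\<Sum>j<d. R $$ (i, j) * coord (f j) (enum k))"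
      by (simp add: rep[OF ik(1)] coord_sum_distrib coord_scale)
    ultimately show "(P * mult_mat x) $$ (i, k) = (R * P) $$ (i, k)"
      using ik R by (simp add: P_def mult_mat_def scalar_prod_def lessThan_atLeast0)
  qed (use R in \<open>simp_all add: P_def mult_mat_def\<close>)
  hence "det P * nf_norm x = det R * det P"
    unfolding nf_norm_def using det_mult[OF P mult_mat_carrier[of x]] det_mult[OF R P] by metis
  moreover have "det P \<noteq> 0"
  proof
    assume "det P = 0"
    hence "det (transpose_mat P) = 0" using det_transpose[OF P] by simp
    then obtain u where u: "u \<in> carrier_vec d" "u \<noteq> 0\<^sub>v d" "transpose_mat P *\<^sub>v u = 0\<^sub>v d"
      using det_0_iff_vec_prod_zero_field[of "transpose_mat P" d] P by auto
    have z: "(\<Sum>i<d. coord (f i) (enum j) * u $ i) = 0" if "j < d" for j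
    proof -
      have "(transpose_mat P *\<^sub>v u) $ j = (\<Sum>i<d. coord (f i) (enum j) * u $ i)"
        using that u(1) by (simp add: P_def scalar_prod_def lessThan_atLeast0)
      thus ?thesis using u(3) that by simp
    qed
    have "(\<Sum>i<d. of_rat (u $ i) * f i) = 0"
    proof -
      let ?s = "\<Sum>i<d. of_rat (u $ i) * f i"
      have "coord ?s (enum j) = 0" if "j < d" for j
        using z[OF that] unfolding coord_sum_distrib coord_scale by (simp add: mult.commute)
      thus ?thesis by (subst coord_enum_sum[of ?s, symmetric]) simp
    qed
    hence "u $ i = 0" if "i < d" for i using ind[of "\<lambda>i. u $ i"] that by blast
    hence "u = 0\<^sub>v d" using u(1) by (intro eq_vecI) auto
    thus False using u(2) by simp
  qed
  ultimately show ?thesis by simp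
qed

end

text \<open>Each of the \<open>n!\<close> terms of the Leibniz expansion takes one entry from every
  row.\<close>

lemma absval_det_bound:
  assumes w: "absolute_value (w :: rat \<Rightarrow> real)" and R: "R \<in> carrier_mat n n"
    and le: "\<And>i j. i < n \<Longrightarrow> j < n \<Longrightarrow> w (R $$ (i, j)) \<le> r i"
  shows "w (det R) \<le> fact n * (\<Prod>i<n. r i)"
proof -
  let ?P = "{p. p permutes {0..<n}}"
  have "w (det R) \<le> (\<Sum>p\<in>?P. w (signof p * (\<Prod>i = 0..<n. R $$ (i, p i))))"
    unfolding det_def'[OF R] by (rule absval_sum[OF w])
  also have "\<dots> \<le> (\<Sum>p\<in>?P. \<Prod>i<n. r i)"
  proof (rule sum_mono)
    fix p assume "p \<in> ?P"
    hence p: "p permutes {0..<n}" by simp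
    have "w (signof p) = 1"
      by (cases "signof p = (1::rat)") (auto simp: sign_def absval_1[OF w] absval_minus[OF w])
    hence "w (signof p * (\<Prod>i = 0..<n. R $$ (i, p i))) = (\<Prod>i = 0..<n. w (R $$ (i, p i)))"
      by (simp add: absval_mult[OF w] absval_prod[OF w])
    also have "\<dots> \<le> (\<Prod>i = 0..<n. r i)"
      using permutes_in_image[OF p] by (intro prod_mono) (auto simp: absval_nonneg[OF w] intro!: le)
    finally show "w (signof p * (\<Prod>i = 0..<n. R $$ (i, p i))) \<le> (\<Prod>i<n. r i)"
      by (simp add: lessThan_atLeast0)
  qed
  also have "\<dots> = fact n * (\<Prod>i<n. r i)"
    by (simp add: card_permutations)
  finally show ?thesis .
qed

section \<open>Independent families concentrated at single places\<close>

text \<open>Elements close to \<open>b v\<close> at \<open>v\<close> and close to \<open>0\<close>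
  at the other members of \<open>T\<close> inherit the control of the coefficients from the families
  \<open>b v\<close>. If the coefficient at \<open>(u, j)\<close> is the largest one, with absolute
  value \<open>m\<close>, then at \<open>u\<close> the combination differs by at most \<open>card I
  * m * e\<close> from its part in \<open>b u\<close>, which has absolute value at least \<open>C *
  m\<close>.\<close>

lemma concentrated_lower_bound:
  fixes b :: "('a::field_char_0 \<Rightarrow> real) \<Rightarrow> nat \<Rightarrow> 'a"
  assumes w: "absolute_value w" and T: "finite T" "T \<subseteq> extensions w"
    and C: "\<And>v q j. v \<in> T \<Longrightarrow> j < n v \<Longrightarrow> C * w (q j) \<le> v (\<Sum>i<n v. of_rat (q i) * b v i)"
    and f: "\<And>u v j. u \<in> T \<Longrightarrow> v \<in> T \<Longrightarrow> j < n v \<Longrightarrow> u (f (v, j) - (if u = v then b v j else 0)) \<le> e"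
    and e: "0 \<le> e" "real (card (Sigma T (\<lambda>v. {..<n v}))) * e \<le> C"
    and M: "\<And>u. u \<in> T \<Longrightarrow> u (\<Sum>i\<in>Sigma T (\<lambda>v. {..<n v}). of_rat (q i) * f i) \<le> M"
    and i: "i \<in> Sigma T (\<lambda>v. {..<n v})"
  shows "(C - real (card (Sigma T (\<lambda>v. {..<n v}))) * e) * w (q i) \<le> M"
proof -
  let ?I = "Sigma T (\<lambda>v. {..<n v})"
  let ?y = "\<Sum>i\<in>?I. of_rat (q i) * f i"
  have fin: "finite ?I" using T by simp
  define m where "m = Max ((\<lambda>i. w (q i)) ` ?I)"
  have mge: "w (q i) \<le> m" if "i \<in> ?I" for i unfolding m_def using that fin by (intro Max_ge) auto
  have "m \<in> (\<lambda>i. w (q i)) ` ?I" unfolding m_def by (rule Max_in) (use fin i in auto)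
  then obtain u j where uj: "u \<in> T" "j < n u" "m = w (q (u, j))" by auto
  have u: "u \<in> extensions w" using uj T by blast
  note au = extensions_absval[OF u]
  let ?s = "\<Sum>k<n u. of_rat (q (u, k)) * b u k"
  have s: "?s = (\<Sum>i\<in>?I. of_rat (q i) * (if u = fst i then b (fst i) (snd i) else 0))"
  proof -
    have "(\<Sum>i\<in>?I. of_rat (q i) * (if u = fst i then b (fst i) (snd i) else 0))
       = (\<Sum>v\<in>T. \<Sum>k<n v. of_rat (q (v, k)) * (if u = v then b v k else 0))"
      using T by (simp add: sum.Sigma split_def)
    also have "\<dots> = (\<Sum>v\<in>T. if v = u then ?s else 0)"
      by (rule sum.cong) auto
    also have "\<dots> = ?s" using T uj by simp
    finally show ?thesis ..
  qed
  have "u (?s - ?y) \<le> (\<Sum>i\<in>?I. u (of_rat (q i) * ((if u = fst i then b (fst i) (snd i) else 0) - f i)))"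
    unfolding s by (simp only: sum_subtractf[symmetric] right_diff_distrib[symmetric]) (rule absval_sum[OF au])
  also have "\<dots> \<le> (\<Sum>i\<in>?I. m * e)"
  proof (rule sum_mono)
    fix i assume i: "i \<in> ?I"
    obtain v k where vk: "i = (v, k)" "v \<in> T" "k < n v" using i by auto
    have "u (of_rat (q i) * ((if u = fst i then b (fst i) (snd i) else 0) - f i))
       = w (q i) * u (f i - (if u = fst i then b (fst i) (snd i) else 0))"
      by (simp add: absval_mult[OF au] extensions_of_rat[OF u] absval_diff_commute[OF au])
    also have "\<dots> \<le> m * e"
      using f[OF uj(1) vk(2,3)] mge[OF i] e absval_nonneg[OF au] absval_nonneg[OF w] vk
      by (intro mult_mono) (auto intro: order_trans)
    finally show "u (of_rat (q i) * ((if u = fst i then b (fst i) (snd i) else 0) - f i)) \<le> m * e" .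
  qed
  finally have 1: "u (?s - ?y) \<le> real (card ?I) * (m * e)" by simp
  have "C * m \<le> u ?s" using C[OF uj(1,2), of "\<lambda>k. q (u, k)"] uj(3) by simp
  also have "\<dots> \<le> u ?y + u (?s - ?y)" using absval_add[OF au, of ?y "?s - ?y"] by simp
  also have "\<dots> \<le> M + real (card ?I) * (m * e)" using 1 M[OF uj(1)] by simp
  finally have "(C - real (card ?I) * e) * m \<le> M" by (simp add: algebra_simps)
  moreover have "(C - real (card ?I) * e) * w (q i) \<le> (C - real (card ?I) * e) * m"
    using mge[OF i] e by (intro mult_left_mono) auto
  ultimately show ?thesis by linarith
qed

text \<open>The element \<open>b v j\<close> is multiplied by an element close to \<open>1\<close>
  at \<open>v\<close> and close to \<open>0\<close> at the rest of \<open>T\<close>.\<close>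

lemma concentrated_family_exists:
  fixes b :: "('a::field_char_0 \<Rightarrow> real) \<Rightarrow> nat \<Rightarrow> 'a"
  assumes w: "nontrivial w" and T: "finite T" "T \<subseteq> extensions w" and e: "0 < e"
  shows "\<exists>f. \<forall>u\<in>T. \<forall>v\<in>T. \<forall>j. u (f (v, j) - (if u = v then b v j else 0)) \<le> e"
proof -
  have "\<exists>x. \<forall>u\<in>T. u (x - (if u = v then b v j else 0)) \<le> e" if v: "v \<in> T" for v j
  proof -
    have ab: "absolute_value u" if "u \<in> T" for u using T that extensions_absval by blast
    define K where "K = 1 + (\<Sum>u\<in>T. u (b v j))"
    have K0: "(\<Sum>u\<in>T. u (b v j)) \<ge> 0" using absval_nonneg ab by (intro sum_nonneg) auto
    have K: "u (b v j) \<le> K" if "u \<in> T" for u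
    proof -
      have "u (b v j) \<le> (\<Sum>u\<in>T. u (b v j))"
        using that T absval_nonneg ab by (intro member_le_sum) auto
      thus ?thesis by (simp add: K_def)
    qed
    have ve: "v \<in> extensions w" using v T by blast
    have "\<exists>a. v (a - 1) < e / K \<and> (\<forall>u\<in>T - {v}. u a < e / K)"
      by (rule weak_approximation_unit[OF w ve]) (use T e K0 in \<open>auto simp: K_def\<close>)
    then obtain a where a: "v (a - 1) < e / K" "\<And>u. u \<in> T - {v} \<Longrightarrow> u a < e / K" by blast
    have Kpos: "K > 0" using K0 by (simp add: K_def)
    have bd: "u (y * b v j) \<le> e" if "u \<in> T" "u y < e / K" for u y
    proof -
      have "u (y * b v j) = u y * u (b v j)" by (rule absval_mult[OF ab[OF that(1)]])
      also have "\<dots> \<le> e / K * K"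
        using that K[OF that(1)] absval_nonneg[OF ab[OF that(1)]] e Kpos by (intro mult_mono) auto
      also have "\<dots> = e" using Kpos by simp
      finally show ?thesis .
    qed
    have "u (a * b v j - (if u = v then b v j else 0)) \<le> e" if "u \<in> T" for u
    proof (cases "u = v")
      case True
      have "v ((a - 1) * b v j) \<le> e" using bd[OF v a(1)] .
      thus ?thesis using True by (simp add: left_diff_distrib)
    qed (use bd[OF that] a(2)[of u] that in auto)
    thus ?thesis by blast
  qed
  then obtain g where g: "\<And>v j u. v \<in> T \<Longrightarrow> u \<in> T \<Longrightarrow> u (g v j - (if u = v then b v j else 0)) \<le> e"
    by metis
  show ?thesis by (rule exI[of _ "\<lambda>(v, j). g v j"]) (use g in auto)
qed

lemma finite_positive_lower_bound:
  assumes "finite A" "\<And>x. x \<in> A \<Longrightarrow> (g x :: real) > 0"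
  shows "\<exists>c>0. \<forall>x\<in>A. c \<le> g x"
  using assms
proof (induction A rule: finite_induct)
  case empty
  show ?case by (rule exI[of _ 1]) auto
next
  case (insert a A)
  then obtain c where "c > 0" "\<forall>x\<in>A. c \<le> g x" by auto
  thus ?case using insert.prems[of a] by (intro exI[of _ "min c (g a)"]) auto
qed

context number_field_type
begin

lemma top_indep_le_degree:
  assumes w: "absolute_value w" and v: "absolute_value v" and "top_indep w v n (b :: nat \<Rightarrow> 'a)"
  shows "n \<le> d"
proof -
  have "card {..<n} \<le> d"
    by (rule card_le_degree[of _ b]) (use top_indep_linear_indep[OF w v assms(3)] in auto)
  thus ?thesis by simp
qed

text \<open>Elements that are close to \<open>1\<close> at one member of \<open>T\<close> and close
  to \<open>0\<close> at the others are linearly independent.\<close>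

lemma card_extensions_le:
  assumes w: "nontrivial w" and T: "finite T" "T \<subseteq> (extensions w :: ('a \<Rightarrow> real) set)"
  shows "card T \<le> d"
proof -
  have aw: "absolute_value w" using w by (simp add: nontrivial_def)
  \<comment> \<open>small enough that \<open>1 - card T * e\<close> is positive\<close>
  define e where "e = 1 / (2 * (real (card T) + 1))"
  have e: "0 < e" "real (card T) * e < 1" by (auto simp: e_def field_simps)
  obtain f where f: "\<And>u v j. u \<in> T \<Longrightarrow> v \<in> T \<Longrightarrow> u (f (v, j::nat) - (if u = v then (1::'a) else 0)) \<le> e"
    using concentrated_family_exists[OF w T e(1), of "\<lambda>_ _. 1"] by blast
  let ?I = "Sigma T (\<lambda>v. {..<1::nat})"
  have cI: "card ?I = card T" using T by simp
  have "card ?I \<le> d"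
  proof (rule card_le_degree[of _ f])
    show "finite ?I" using T by simp
    fix q i assume z: "(\<Sum>i\<in>?I. of_rat (q i) * f i) = 0" and i: "i \<in> ?I"
    have "(1 - real (card ?I) * e) * w (q i) \<le> 0"
    proof (rule concentrated_lower_bound[OF aw T, where n = "\<lambda>_. 1" and b = "\<lambda>_ _. 1" and C = 1 and e = e and f = f, OF _ _ _ _ _ i])
      fix v :: "'a \<Rightarrow> real" and q :: "nat \<Rightarrow> rat" and j :: nat assume "v \<in> T" "j < 1"
      thus "1 * w (q j) \<le> v (\<Sum>i<1. of_rat (q i) * 1)" using extensions_of_rat[of v w] T by auto
    next
      fix u assume "u \<in> T"
      hence "u 0 = 0" using T extensions_absval absval_0 by blast
      thus "u (\<Sum>i\<in>?I. of_rat (q i) * f i) \<le> 0" using z by simp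
    qed (use f e cI in auto)
    hence "w (q i) \<le> 0" using e cI by (simp add: mult_le_0_iff)
    thus "q i = 0" using absval_pos[OF aw] by (metis not_less)
  qed
  thus ?thesis using cI by simp
qed

lemma finite_extensions:
  assumes w: "nontrivial w"
  shows "finite (extensions w :: ('a \<Rightarrow> real) set)"
proof (rule ccontr)
  assume "infinite (extensions w :: ('a \<Rightarrow> real) set)"
  then obtain T :: "('a \<Rightarrow> real) set" where "T \<subseteq> extensions w" "finite T" "card T = Suc d"
    using infinite_arbitrarily_large by blast
  thus False using card_extensions_le[OF w, of T] by simp
qed

section \<open>The product of the extensions of one absolute value\<close>

text \<open>This property requires that \<open>w\<close> has sufficiently many extensions: at too
  few of them an element could be small without having a small trace.\<close>

definition trace_bounded :: "(rat \<Rightarrow> real) \<Rightarrow> bool" where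
  "trace_bounded w \<longleftrightarrow>
     (\<exists>k. \<forall>(x::'a) M. (\<forall>v\<in>extensions w. v x \<le> M) \<longrightarrow> w (nf_trace x) \<le> k * M)"

text \<open>Every functional is the trace after multiplication by a fixed element.\<close>

lemma functional_bounded:
  assumes w: "nontrivial w" and tb: "trace_bounded w"
    and l: "\<And>x y. l (x + y) = l x + l y" "\<And>q x. l (of_rat q * x) = q * l (x::'a)"
  shows "\<exists>k. \<forall>x M. (\<forall>v\<in>extensions w. v x \<le> M) \<longrightarrow> w (l x) \<le> k * M"
proof -
  obtain a where a: "\<And>x. l x = nf_trace (a * x)" using linear_functional_eq_trace[of l] l by blast
  obtain k where k: "\<And>(x::'a) M. (\<forall>v\<in>extensions w. v x \<le> M) \<Longrightarrow> w (nf_trace x) \<le> k * M"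
    using tb unfolding trace_bounded_def by blast
  define A where "A = (\<Sum>v\<in>(extensions w :: ('a \<Rightarrow> real) set). v a)"
  have "w (l x) \<le> k * A * M" if M: "\<forall>v\<in>extensions w. v x \<le> M" for x M
  proof -
    have "\<forall>v\<in>extensions w. v (a * x) \<le> A * M"
    proof
      fix v :: "'a \<Rightarrow> real" assume v: "v \<in> extensions w"
      note av = extensions_absval[OF v]
      have "v a \<le> A" unfolding A_def using finite_extensions[OF w] v
        by (intro member_le_sum) (auto intro: absval_nonneg extensions_absval)
      hence "v a * v x \<le> A * M" using M v absval_nonneg[OF av]
        by (intro mult_mono) (auto intro: order_trans[OF absval_nonneg[OF av]])
      thus "v (a * x) \<le> A * M" by (simp add: absval_mult[OF av])
    qed
    thus ?thesis using k[of "a * x" "A * M"] a by (simp add: mult.assoc)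
  qed
  thus ?thesis by blast
qed

text \<open>A coordinate functional with respect to a basis that extends the family.\<close>

lemma exists_functional_vanishing:
  fixes f :: "'i \<Rightarrow> 'a"
  assumes ind: "\<And>q i. (\<Sum>i\<in>I. of_rat (q i) * f i) = 0 \<Longrightarrow> i \<in> I \<Longrightarrow> q i = 0"
    and "finite I" and x: "\<And>q. x \<noteq> (\<Sum>i\<in>I. of_rat (q i) * f i)"
  shows "\<exists>l c. (\<forall>x y. l (x + y) = l x + l y) \<and> (\<forall>q x. l (of_rat q * x) = q * l x)
     \<and> (\<forall>i\<in>I. l (f i) = (0::rat)) \<and> l (c::'a) = 1"
proof -
  have inj: "inj_on f I" and i: "Qvs.independent (f ` I)"
    using rational_independent_family[OF \<open>finite I\<close>, of f] ind by blast+
  obtain D where D: "f ` I \<subseteq> D" "Qvs.independent D" "UNIV \<subseteq> Qvs.span D"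
    using Qvs.maximal_independent_subset_extend[of "f ` I" UNIV] i by auto
  have "D \<noteq> f ` I"
  proof
    assume "D = f ` I"
    hence "x \<in> Qvs.span (f ` I)" using D(3) by auto
    then obtain u where "x = (\<Sum>y\<in>f ` I. of_rat (u y) * y)"
      using \<open>finite I\<close> by (auto simp: Qvs.span_finite)
    hence "x = (\<Sum>i\<in>I. of_rat (u (f i)) * f i)" by (simp add: sum.reindex[OF inj] o_def)
    thus False using x[of "u \<circ> f"] by simp
  qed
  then obtain c where c: "c \<in> D" "c \<notin> f ` I" using D(1) by blast
  define l where "l = (\<lambda>x. Qvs.representation D x c)"
  have sp: "y \<in> Qvs.span D" for y using D(3) by auto
  show ?thesis
  proof (intro exI[of _ l] exI[of _ c] conjI allI ballI)
    show "l (x + y) = l x + l y" for x y unfolding l_def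
      using Qvs.representation_add[OF D(2) sp sp, of y x] by (simp add: add.commute)
    show "l (of_rat q * x) = q * l x" for q x unfolding l_def
      using Qvs.representation_scale[OF D(2) sp] by simp
    show "l (f i) = 0" if "i \<in> I" for i unfolding l_def
      using Qvs.representation_basis[OF D(2), of "f i"] that D(1) c(2) by (auto simp: image_subset_iff)
    show "l c = 1" unfolding l_def using Qvs.representation_basis[OF D(2) c(1)] by simp
  qed
qed

text \<open>If the family did not span, a nonzero functional \<open>l\<close> would vanish on it.
  Approximation of an element at every extension at once by a combination of the family leaves a
  remainder at which \<open>l\<close> has the same value, and which is half as large at every
  extension. Repeating this from an element at which \<open>l\<close> is \<open>1\<close>
  contradicts the boundedness of \<open>l\<close>.\<close>

lemma concentrated_family_spans:
  fixes b :: "('a \<Rightarrow> real) \<Rightarrow> nat \<Rightarrow> 'a" and w :: "rat \<Rightarrow> real"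
  defines "I \<equiv> \<lambda>n. Sigma (extensions w :: ('a \<Rightarrow> real) set) (\<lambda>v. {..<n v})"
  assumes w: "nontrivial w" and tb: "trace_bounded w"
    and C: "C > 0" "\<And>v q j. v \<in> extensions w \<Longrightarrow> j < n v \<Longrightarrow> C * w (q j) \<le> v (\<Sum>i<n v. of_rat (q i) * b v i)"
    and dense: "\<And>v x e. v \<in> extensions w \<Longrightarrow> 0 < e \<Longrightarrow> \<exists>q. v (x - (\<Sum>i<n v. of_rat (q i) * b v i)) < e"
    and f: "\<And>u v j. u \<in> extensions w \<Longrightarrow> v \<in> extensions w \<Longrightarrow> j < n v \<Longrightarrow>
        u (f (v, j) - (if u = v then b v j else 0)) \<le> e"
    and e: "0 \<le> e" "8 * real (card (I n)) * e \<le> C"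
    and ind: "\<And>q i. (\<Sum>i\<in>I n. of_rat (q i) * f i) = 0 \<Longrightarrow> i \<in> I n \<Longrightarrow> q i = 0"
  shows "\<exists>q. x = (\<Sum>i\<in>I n. of_rat (q i) * f i)"
proof (rule ccontr)
  assume "\<nexists>q. x = (\<Sum>i\<in>I n. of_rat (q i) * f i)"
  hence nx: "\<And>q. x \<noteq> (\<Sum>i\<in>I n. of_rat (q i) * f i)" by blast
  let ?S = "extensions w :: ('a \<Rightarrow> real) set"
  have finS: "finite ?S" by (rule finite_extensions[OF w])
  have fin: "finite (I n)" unfolding I_def using finS by simp
  have aw: "absolute_value w" using w by (simp add: nontrivial_def)
  obtain l c where l: "\<And>x y. l (x + y) = l x + l y" "\<And>q x. l (of_rat q * x) = q * l x"
     "\<And>i. i \<in> I n \<Longrightarrow> l (f i) = (0::rat)" "l (c::'a) = 1"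
    using exists_functional_vanishing[where I = "I n" and f = f and x = x] ind fin nx by blast
  have l0: "l 0 = 0" using l(2)[of 0 0] by simp
  have lsum: "l (\<Sum>i\<in>J. g i) = (\<Sum>i\<in>J. l (g i))" for J and g :: "('a \<Rightarrow> real) \<times> nat \<Rightarrow> 'a"
    by (induction J rule: infinite_finite_induct) (simp_all add: l0 l)
  obtain k where k: "\<And>x M. (\<forall>v\<in>?S. v x \<le> M) \<Longrightarrow> w (l x) \<le> k * M"
    using functional_bounded[OF w tb l(1,2)] by blast
  \<comment> \<open>one approximation step halves all absolute values without changing the value of the functional\<close>
  have step: "\<exists>z. l z = l y \<and> (\<forall>v\<in>?S. v z \<le> M / 2)" if M: "M > 0" "\<forall>v\<in>?S. v y \<le> M" for y M
  proof -
    have "\<exists>q. v (y - (\<Sum>i<n v. of_rat (q i) * b v i)) < M / 4" if "v \<in> ?S" for v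
      using dense[OF that, of "M / 4"] M by simp
    then obtain q where q: "\<And>v. v \<in> ?S \<Longrightarrow> v (y - (\<Sum>i<n v. of_rat (q v i) * b v i)) < M / 4" by metis
    have wq: "w (q v j) \<le> 2 * M / C" if v: "v \<in> ?S" "j < n v" for v j
    proof -
      note av = extensions_absval[OF v(1)]
      let ?s = "\<Sum>i<n v. of_rat (q v i) * b v i"
      have "v ?s \<le> v y + v (y - ?s)" using absval_diff[OF av, of y "y - ?s"] by simp
      also have "\<dots> \<le> M + M / 4" using q[OF v(1)] M(2) v by (intro add_mono) auto
      finally have "C * w (q v j) \<le> 2 * M" using C(2)[OF v, of "q v"] M(1) by simp
      thus ?thesis using C(1) by (simp add: field_simps)
    qed
    define s where "s = (\<Sum>i\<in>I n. of_rat (q (fst i) (snd i)) * f i)"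
    have "l s = 0" unfolding s_def by (simp add: lsum l)
    hence "l (y - s) = l y" using l(1)[of "y - s" s] by simp
    moreover have "u (y - s) \<le> M / 2" if u: "u \<in> ?S" for u
    proof -
      note au = extensions_absval[OF u]
      let ?s = "\<Sum>k<n u. of_rat (q u k) * b u k"
      have s: "?s = (\<Sum>i\<in>I n. of_rat (q (fst i) (snd i)) * (if u = fst i then b (fst i) (snd i) else 0))"
      proof -
        have "(\<Sum>i\<in>I n. of_rat (q (fst i) (snd i)) * (if u = fst i then b (fst i) (snd i) else 0))
           = (\<Sum>v\<in>?S. \<Sum>k<n v. of_rat (q v k) * (if u = v then b v k else 0))"
          using finS by (simp add: I_def sum.Sigma split_def)
        also have "\<dots> = (\<Sum>v\<in>?S. if v = u then ?s else 0)"
          by (rule sum.cong) auto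
        also have "\<dots> = ?s" using finS u by simp
        finally show ?thesis ..
      qed
      have "u (?s - s) \<le> (\<Sum>i\<in>I n. u (of_rat (q (fst i) (snd i)) * ((if u = fst i then b (fst i) (snd i) else 0) - f i)))"
        unfolding s s_def by (simp only: sum_subtractf[symmetric] right_diff_distrib[symmetric]) (rule absval_sum[OF au])
      also have "\<dots> \<le> (\<Sum>i\<in>I n. 2 * M / C * e)"
      proof (rule sum_mono)
        fix i assume i: "i \<in> I n"
        obtain v k where vk: "i = (v, k)" "v \<in> ?S" "k < n v" using i by (auto simp: I_def)
        have "u (of_rat (q (fst i) (snd i)) * ((if u = fst i then b (fst i) (snd i) else 0) - f i))
           = w (q v k) * u (f i - (if u = fst i then b (fst i) (snd i) else 0))"
          using vk by (simp add: absval_mult[OF au] extensions_of_rat[OF u] absval_diff_commute[OF au])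
        also have "\<dots> \<le> 2 * M / C * e"
          using f[OF u vk(2,3)] wq[OF vk(2,3)] e absval_nonneg[OF au] absval_nonneg[OF aw] vk M C
          by (intro mult_mono) auto
        finally show "u (of_rat (q (fst i) (snd i)) * ((if u = fst i then b (fst i) (snd i) else 0) - f i)) \<le> 2 * M / C * e" .
      qed
      also have "\<dots> = (8 * real (card (I n)) * e) * (M / (4 * C))" by (simp add: field_simps)
      also have "\<dots> \<le> C * (M / (4 * C))" using e M C by (intro mult_right_mono) auto
      also have "\<dots> = M / 4" using C by simp
      finally have "u (?s - s) \<le> M / 4" .
      moreover have "u (y - s) \<le> u (y - ?s) + u (?s - s)" using absval_add[OF au, of "y - ?s" "?s - s"] by simp
      ultimately show ?thesis using q[OF u] by simp
    qed
    ultimately show ?thesis by blast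
  qed
  define M where "M = 1 + (\<Sum>v\<in>?S. v c)"
  have M: "M > 0" "\<forall>v\<in>?S. v c \<le> M"
  proof -
    have nn: "v c \<ge> 0" if "v \<in> ?S" for v using that extensions_absval absval_nonneg by blast
    have "(\<Sum>v\<in>?S. v c) \<ge> 0" using nn by (intro sum_nonneg) auto
    thus "M > 0" by (simp add: M_def)
    show "\<forall>v\<in>?S. v c \<le> M"
    proof
      fix v assume "v \<in> ?S"
      hence "v c \<le> (\<Sum>v\<in>?S. v c)" using nn finS by (intro member_le_sum) auto
      thus "v c \<le> M" by (simp add: M_def)
    qed
  qed
  have it: "\<exists>z. l z = 1 \<and> (\<forall>v\<in>?S. v z \<le> M / 2 ^ j)" for j
  proof (induction j)
    case 0
    show ?case using M l(4) by auto
  next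
    case (Suc j)
    then obtain z where z: "l z = 1" "\<forall>v\<in>?S. v z \<le> M / 2 ^ j" by blast
    obtain z' where "l z' = l z" "\<forall>v\<in>?S. v z' \<le> M / 2 ^ j / 2"
      using step[OF _ z(2)] M(1) by auto
    thus ?case using z(1) by (auto simp: field_simps)
  qed
  have le: "1 \<le> k * M * (1/2) ^ j" for j
  proof -
    obtain z where z: "l z = 1" "\<forall>v\<in>?S. v z \<le> M / 2 ^ j" using it by blast
    have "w 1 \<le> k * (M / 2 ^ j)" using k[OF z(2)] z(1) by simp
    thus ?thesis by (simp add: absval_1[OF aw] power_divide)
  qed
  have "(\<lambda>j. k * M * (1/2) ^ j) \<longlonglongrightarrow> k * M * 0"
    by (intro tendsto_intros LIMSEQ_power_zero) simp
  hence "1 \<le> k * M * 0" by (rule LIMSEQ_le_const) (use le in auto)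
  thus False by simp
qed

text \<open>In a basis concentrated at the single extensions, the row at \<open>(v, j)\<close> of
  the matrix of multiplication by \<open>c\<close> is bounded by a multiple of \<open>v c\<close>.
  So the norm of \<open>c\<close> is bounded by \<open>K\<close> times the product, where
  \<open>K\<close> does not depend on \<open>c\<close>, although the basis does. For powers of
  \<open>c\<close> the constant is negligible, and \<open>1 / c\<close> gives the reverse
  inequality.\<close>

lemma local_product_formula_top_basis:
  assumes w: "nontrivial w" and tb: "trace_bounded w"
    and tbs: "\<And>v. v \<in> extensions w \<Longrightarrow> top_basis w v (n v) (b v)"
    and c: "(c::'a) \<noteq> 0"
  shows "(\<Prod>v\<in>(extensions w :: ('a \<Rightarrow> real) set). v c ^ n v) = w (nf_norm c)"
proof -
  let ?S = "extensions w :: ('a \<Rightarrow> real) set"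
  let ?I = "Sigma ?S (\<lambda>v. {..<n v})"
  let ?P = "\<lambda>c. \<Prod>v\<in>?S. v c ^ n v"
  have finS: "finite ?S" by (rule finite_extensions[OF w])
  have fin: "finite ?I" using finS by simp
  have aw: "absolute_value w" using w by (simp add: nontrivial_def)
  have av: "absolute_value v" if "v \<in> ?S" for v using that by (rule extensions_absval)
  have Ppos: "?P c > 0" if "c \<noteq> 0" for c
    using absval_pos[OF av that] by (intro prod_pos) auto
  have "\<exists>C>0. \<forall>q j. j < n v \<longrightarrow> C * w (q j) \<le> v (\<Sum>i<n v. of_rat (q i) * b v i)" if "v \<in> ?S" for v
    using tbs[OF that] unfolding top_basis_def top_indep_def by blast
  then obtain C0 where C0: "\<And>v. v \<in> ?S \<Longrightarrow> C0 v > 0"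
    "\<And>v q j. v \<in> ?S \<Longrightarrow> j < n v \<Longrightarrow> C0 v * w (q j) \<le> v (\<Sum>i<n v. of_rat (q i) * b v i)" by metis
  obtain C where C: "C > 0" "\<And>v. v \<in> ?S \<Longrightarrow> C \<le> C0 v"
    using finite_positive_lower_bound[OF finS, of C0] C0(1) by blast
  have Cle: "C * w (q j) \<le> v (\<Sum>i<n v. of_rat (q i) * b v i)" if "v \<in> ?S" "j < n v" for v q j
    using C0(2)[OF that, of q] mult_right_mono[OF C(2)[OF that(1)] absval_nonneg[OF aw, of "q j"]] by linarith
  define D where "D = 1 + (\<Sum>i\<in>?I. fst i (b (fst i) (snd i)))"
  have nnb: "0 \<le> fst i (b (fst i) (snd i))" if "i \<in> ?I" for i
    using that absval_nonneg[OF av] by (cases i) auto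
  have D: "1 + v (b v j) \<le> D" if "v \<in> ?S" "j < n v" for v j
    using member_le_sum[of "(v, j)" ?I "\<lambda>i. fst i (b (fst i) (snd i))"] that fin nnb by (auto simp: D_def)
  have D1: "D \<ge> 1" using sum_nonneg[of ?I "\<lambda>i. fst i (b (fst i) (snd i))"] nnb by (simp add: D_def)
  define N where "N = real (card ?I)"
  \<comment> \<open>\<open>C / 2\<close> is the control of the coefficients that the concentrated
    basis inherits, and \<open>D\<close> bounds its elements at their own place\<close>
  define K where "K = fact d * (2 * D / C) ^ d"
  have bound: "w (nf_norm c) \<le> K * ?P c" if c: "c \<noteq> 0" for c
  proof -
    \<comment> \<open>a precision of \<open>e1\<close> makes \<open>c f\<close>, for
      \<open>f\<close> concentrated at \<open>v\<close>, at most \<open>v c\<close> at the other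
      extensions\<close>
    obtain e1 where e1: "e1 > 0" "\<And>u v. u \<in> ?S \<Longrightarrow> v \<in> ?S \<Longrightarrow> e1 \<le> v c / u c"
      using finite_positive_lower_bound[of "?S \<times> ?S" "\<lambda>(u, v). v c / u c"] finS absval_pos[OF av c] by fastforce
    define e where "e = min 1 (min e1 (C / (8 * (N + 1))))"
    have Nn: "N \<ge> 0" by (simp add: N_def)
    have e: "e > 0" "e \<le> 1" "e \<le> e1" using e1 C Nn by (auto simp: e_def)
    have Ne: "8 * N * e \<le> C"
    proof -
      have "8 * N * e \<le> 8 * (N + 1) * (C / (8 * (N + 1)))"
        using e Nn by (intro mult_mono) (auto simp: e_def)
      thus ?thesis using Nn by simp
    qed
    obtain f where f: "\<And>u v j. u \<in> ?S \<Longrightarrow> v \<in> ?S \<Longrightarrow> u (f (v, j) - (if u = v then b v j else 0)) \<le> e"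
      using concentrated_family_exists[OF w finS _ e(1), of b] by blast
    have low: "C / 2 * w (q i) \<le> M" if M: "\<And>u. u \<in> ?S \<Longrightarrow> u (\<Sum>i\<in>?I. of_rat (q i) * f i) \<le> M" and i: "i \<in> ?I" for q i M
    proof -
      have "(C - real (card ?I) * e) * w (q i) \<le> M"
      proof (rule concentrated_lower_bound[where w = w and T = ?S and n = n and b = b and f = f])
        have "0 \<le> N * e" using Nn e by simp
        thus "real (card ?I) * e \<le> C" using Ne C(1) unfolding N_def by linarith
      qed (use aw finS Cle f M i e in auto)
      moreover have "C / 2 * w (q i) \<le> (C - N * e) * w (q i)"
      proof (rule mult_right_mono[OF _ absval_nonneg[OF aw]])
        have "0 \<le> N * e" using Nn e by simp
        thus "C / 2 \<le> C - N * e" using Ne C(1) by (simp add: mult.assoc)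
      qed
      ultimately show ?thesis unfolding N_def by linarith
    qed
    have ind: "q i = 0" if z: "(\<Sum>i\<in>?I. of_rat (q i) * f i) = 0" and i: "i \<in> ?I" for q i
    proof -
      have "C / 2 * w (q i) \<le> 0" by (rule low[OF _ i]) (simp add: z absval_0 av)
      hence "w (q i) \<le> 0" using C(1) by (simp add: mult_le_0_iff)
      thus ?thesis using absval_pos[OF aw] by (metis not_less)
    qed
    have span: "\<exists>q. x = (\<Sum>i\<in>?I. of_rat (q i) * f i)" for x
    proof (rule concentrated_family_spans[where w = w and n = n and b = b and f = f and C = C and e = e])
      show "8 * real (card ?I) * e \<le> C" using Ne unfolding N_def .
      show "\<exists>q. v (x - (\<Sum>i<n v. of_rat (q i) * b v i)) < e'" if "v \<in> ?S" "0 < e'" for v x e'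
        using tbs that unfolding top_basis_def by blast
    qed (use w tb C Cle f ind e in auto)
    have cI: "card ?I = d"
    proof (rule antisym)
      show "card ?I \<le> d" by (rule card_le_degree[where b = f]) (use fin ind in auto)
      show "d \<le> card ?I" by (rule card_eq_degree_if_spanning[where b = f]) (use fin span in auto)
    qed
    obtain g where g: "bij_betw g {..<d} ?I"
      using ex_bij_betw_nat_finite[OF fin, unfolded atLeast0LessThan cI] by blast
    have gI: "g i \<in> ?I" if "i < d" for i using g that bij_betwE by blast
    have gsum: "(\<Sum>i\<in>?I. of_rat (q i) * f i) = (\<Sum>j<d. of_rat (q (g j)) * f (g j))" for q
      by (rule sum.reindex_bij_betw[OF g, symmetric])
    from span obtain Q where Q: "\<And>x. x = (\<Sum>i\<in>?I. of_rat (Q x i) * f i)" by metis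
    define R where "R = mat d d (\<lambda>(i, j). Q (c * f (g i)) (g j))"
    have R: "R \<in> carrier_mat d d" by (simp add: R_def)
    have "nf_norm c = det R"
    proof (rule nf_norm_eq_det[OF R])
      fix q :: "nat \<Rightarrow> rat" and i assume z: "(\<Sum>i<d. of_rat (q i) * f (g i)) = 0" and i: "i < d"
      define q' where "q' = (\<lambda>i. q (the_inv_into {..<d} g i))"
      have q': "q' (g j) = q j" if "j < d" for j
        using g that by (simp add: q'_def bij_betw_def the_inv_into_f_f)
      have "(\<Sum>i\<in>?I. of_rat (q' i) * f i) = 0" unfolding gsum using z by (simp add: q')
      hence "q' (g i) = 0" using ind[of q' "g i"] gI[OF i] by simp
      thus "q i = 0" using q'[OF i] by simp
    next
      fix i assume i: "i < d"
      have "c * f (g i) = (\<Sum>j<d. of_rat (Q (c * f (g i)) (g j)) * f (g j))"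
        by (rule trans[OF Q gsum])
      thus "c * f (g i) = (\<Sum>j<d. of_rat (R $$ (i, j)) * f (g j))" using i by (simp add: R_def)
    qed
    also have "w (det R) \<le> fact d * (\<Prod>i<d. 2 * D / C * fst (g i) c)"
    proof (rule absval_det_bound[OF aw R])
      fix i j assume ij: "i < d" "j < d"
      obtain v k where vk: "g i = (v, k)" "v \<in> ?S" "k < n v" using gI[OF ij(1)] by auto
      have row: "u (c * f (g i)) \<le> D * v c" if u: "u \<in> ?S" for u
      proof (cases "u = v")
        case True
        have "v (f (v, k)) \<le> v (b v k) + v (f (v, k) - b v k)"
          using absval_add[OF av[OF vk(2)], of "b v k" "f (v, k) - b v k"] by simp
        also have "\<dots> \<le> D" using D[OF vk(2,3)] f[OF vk(2) vk(2), of k] e by simp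
        finally have "v c * v (f (v, k)) \<le> v c * D"
          using absval_nonneg[OF av[OF vk(2)]] by (intro mult_left_mono)
        thus ?thesis using True vk by (simp add: absval_mult[OF av] mult.commute)
      next
        case False
        have "u (c * f (g i)) \<le> u c * e"
          using f[OF u vk(2), of k] False vk absval_nonneg[OF av[OF u]]
          by (simp add: absval_mult[OF av[OF u]] mult_left_mono)
        also have "\<dots> \<le> u c * (v c / u c)"
          using e e1(2)[OF u vk(2)] absval_nonneg[OF av[OF u]] by (intro mult_left_mono) auto
        also have "\<dots> = 1 * v c" using absval_pos[OF av[OF u] c] by simp
        also have "\<dots> \<le> D * v c" using D1 absval_nonneg[OF av[OF vk(2)]] by (intro mult_right_mono)
        finally show ?thesis .
      qed
      have "C / 2 * w (Q (c * f (g i)) (g j)) \<le> D * v c"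
        by (rule low[OF _ gI[OF ij(2)]]) (simp only: Q[symmetric] row)
      hence "w (Q (c * f (g i)) (g j)) \<le> 2 * D / C * v c" using C(1) by (simp add: field_simps)
      thus "w (R $$ (i, j)) \<le> 2 * D / C * fst (g i) c" using ij vk by (simp add: R_def)
    qed
    also have "\<dots> = K * (\<Prod>i<d. fst (g i) c)"
      by (simp only: prod.distrib K_def prod_constant card_lessThan mult.assoc)
    also have "(\<Prod>i<d. fst (g i) c) = (\<Prod>i\<in>?I. fst i c)"
      by (rule prod.reindex_bij_betw[OF g])
    also have "\<dots> = ?P c" using finS prod.Sigma[of ?S "\<lambda>v. {..<n v}" "\<lambda>v j. v c"] by (simp add: split_def)
    finally show ?thesis .
  qed
  have Pmult: "?P (x * y) = ?P x * ?P y" for x y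
    by (simp add: absval_mult[OF av] power_mult_distrib prod.distrib)
  have Ppow: "?P (x ^ k) = ?P x ^ k" for x k
    by (simp add: absval_power[OF av] prod_power_distrib power_mult[symmetric] mult.commute)
  have le: "w (nf_norm c) \<le> ?P c" if c: "c \<noteq> 0" for c
  proof (rule ccontr)
    assume "\<not> ?thesis"
    hence "1 < w (nf_norm c) / ?P c" using Ppos[OF c] by simp
    then obtain k where "K < (w (nf_norm c) / ?P c) ^ k" using real_arch_pow by blast
    moreover have "(w (nf_norm c) / ?P c) ^ k \<le> K"
      using bound[of "c ^ k"] c Ppos[of "c ^ k"] by (simp add: nf_norm_power absval_power[OF aw] Ppow power_divide field_simps)
    ultimately show False by simp
  qed
  have "w (nf_norm (inverse c)) \<le> ?P (inverse c)" using le c by simp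
  moreover have "w (nf_norm (inverse c)) = inverse (w (nf_norm c))"
  proof -
    have "nf_norm c * nf_norm (inverse c) = 1" using nf_norm_mult[of c "inverse c"] c nf_norm_1 by simp
    hence "nf_norm (inverse c) = inverse (nf_norm c)" by (metis inverse_unique)
    thus ?thesis by (simp add: absval_inverse[OF aw])
  qed
  moreover have "?P (inverse c) = inverse (?P c)"
    using prod_inversef[of "\<lambda>v. v c ^ n v" ?S] by (simp add: absval_inverse[OF av] power_inverse o_def)
  ultimately have "?P c \<le> w (nf_norm c)"
    using Ppos[OF c] absval_pos[OF aw nf_norm_nonzero[OF c]] by (simp add: inverse_le_iff_le)
  thus ?thesis using le[OF c] by simp
qed

end

section \<open>Completions and local degrees\<close>

lemma cauchy_seqsD: "s \<in> cauchy_seqs v \<Longrightarrow> 0 < e \<Longrightarrow> \<exists>N. \<forall>i\<ge>N. \<forall>j\<ge>N. v (s i - s j) < e"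
  by (simp add: cauchy_seqs_def)

lemma cauchy_seqs_add:
  assumes v: "absolute_value v" and "s \<in> cauchy_seqs v" "t \<in> cauchy_seqs v"
  shows "(\<lambda>i. s i + t i) \<in> cauchy_seqs v"
  unfolding cauchy_seqs_def
proof (clarify)
  fix e :: real assume "e > 0"
  then obtain N1 N2 where N: "\<forall>i\<ge>N1. \<forall>j\<ge>N1. v (s i - s j) < e / 2" "\<forall>i\<ge>N2. \<forall>j\<ge>N2. v (t i - t j) < e / 2"
    using cauchy_seqsD[OF assms(2), of "e/2"] cauchy_seqsD[OF assms(3), of "e/2"] by auto
  have "v (s i + t i - (s j + t j)) < e" if "i \<ge> max N1 N2" "j \<ge> max N1 N2" for i j
  proof -
    have "v (s i + t i - (s j + t j)) \<le> v (s i - s j) + v (t i - t j)"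
      using absval_add[OF v, of "s i - s j" "t i - t j"] by (simp add: algebra_simps)
    also have "\<dots> < e / 2 + e / 2" using N that by (intro add_strict_mono) auto
    finally show ?thesis by simp
  qed
  thus "\<exists>N. \<forall>i\<ge>N. \<forall>j\<ge>N. v (s i + t i - (s j + t j)) < e" by blast
qed

lemma cauchy_seqs_bounded:
  assumes v: "absolute_value v" and s: "s \<in> cauchy_seqs v"
  shows "\<exists>K>0. \<forall>i. v (s i) \<le> K"
proof -
  obtain N where N: "\<forall>i\<ge>N. \<forall>j\<ge>N. v (s i - s j) < 1" using cauchy_seqsD[OF s, of 1] by auto
  define K where "K = 1 + (\<Sum>i\<le>N. v (s i))"
  have "v (s i) \<le> K" for i
  proof (cases "i \<le> N")
    case True
    hence "v (s i) \<le> (\<Sum>i\<le>N. v (s i))" by (intro member_le_sum) (auto simp: absval_nonneg[OF v])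
    thus ?thesis by (simp add: K_def)
  next
    case False
    hence "v (s i - s N) < 1" using N by simp
    moreover have "v (s N) \<le> (\<Sum>i\<le>N. v (s i))" by (intro member_le_sum) (auto simp: absval_nonneg[OF v])
    ultimately show ?thesis using absval_add[OF v, of "s i - s N" "s N"] by (simp add: K_def)
  qed
  moreover have "K > 0" unfolding K_def using absval_nonneg[OF v] by (simp add: add_pos_nonneg sum_nonneg)
  ultimately show ?thesis by blast
qed

lemma cauchy_seqs_mult:
  assumes v: "absolute_value v" and s: "s \<in> cauchy_seqs v" and t: "t \<in> cauchy_seqs v"
  shows "(\<lambda>i. s i * t i) \<in> cauchy_seqs v"
  unfolding cauchy_seqs_def
proof (clarify)
  fix e :: real assume e: "e > 0"
  obtain K L where K: "K > 0" "\<And>i. v (s i) \<le> K" and L: "L > 0" "\<And>i. v (t i) \<le> L"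
    using cauchy_seqs_bounded[OF v s] cauchy_seqs_bounded[OF v t] by auto
  obtain N1 N2 where N: "\<forall>i\<ge>N1. \<forall>j\<ge>N1. v (s i - s j) < e / (2 * L)" "\<forall>i\<ge>N2. \<forall>j\<ge>N2. v (t i - t j) < e / (2 * K)"
    using cauchy_seqsD[OF s, of "e/(2*L)"] cauchy_seqsD[OF t, of "e/(2*K)"] e K L by auto
  have "v (s i * t i - s j * t j) < e" if "i \<ge> max N1 N2" "j \<ge> max N1 N2" for i j
  proof -
    have "v (s i * t i - s j * t j) \<le> v (s i) * v (t i - t j) + v (s i - s j) * v (t j)"
    proof -
      have "s i * t i - s j * t j = s i * (t i - t j) + (s i - s j) * t j" by (simp add: algebra_simps)
      thus ?thesis
        using absval_add[OF v, of "s i * (t i - t j)" "(s i - s j) * t j"] by (simp add: absval_mult[OF v])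
    qed
    also have "\<dots> \<le> K * v (t i - t j) + v (s i - s j) * L"
      using K L absval_nonneg[OF v] by (intro add_mono mult_mono) (auto intro: less_imp_le)
    also have "\<dots> < K * (e / (2 * K)) + e / (2 * L) * L"
      using N that K L by (intro add_strict_mono mult_strict_left_mono mult_strict_right_mono) auto
    also have "\<dots> = e" using K L by simp
    finally show ?thesis .
  qed
  thus "\<exists>N. \<forall>i\<ge>N. \<forall>j\<ge>N. v (s i * t i - s j * t j) < e" by blast
qed

lemma cauchy_seqs_const: "absolute_value v \<Longrightarrow> (\<lambda>i. c) \<in> cauchy_seqs v"
  by (auto simp: cauchy_seqs_def absval_0)

lemma cauchy_seqs_uminus: "absolute_value v \<Longrightarrow> s \<in> cauchy_seqs v \<Longrightarrow> (\<lambda>i. - s i) \<in> cauchy_seqs v"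
  using cauchy_seqs_mult[OF _ cauchy_seqs_const[of v "-1"]] by fastforce

lemma cauchy_seqs_diff:
  assumes "absolute_value v" "s \<in> cauchy_seqs v" "t \<in> cauchy_seqs v"
  shows "(\<lambda>i. s i - t i) \<in> cauchy_seqs v"
  using cauchy_seqs_add[OF assms(1,2) cauchy_seqs_uminus[OF assms(1,3)]] by simp

lemma cauchy_seqs_sum:
  assumes v: "absolute_value v" and "\<And>j. j \<in> J \<Longrightarrow> s j \<in> cauchy_seqs v"
  shows "(\<lambda>i. \<Sum>j\<in>J. s j i) \<in> cauchy_seqs v"
  using assms(2) by (induction J rule: infinite_finite_induct)
    (auto intro: cauchy_seqs_const[OF v] cauchy_seqs_add[OF v])

lemma null_seqs_cauchy:
  assumes v: "absolute_value v" and s: "s \<in> null_seqs v"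
  shows "s \<in> cauchy_seqs v"
  unfolding cauchy_seqs_def
proof (clarify)
  fix e :: real assume "e > 0"
  have "(\<lambda>i. v (s i)) \<longlonglongrightarrow> 0" using s by (simp add: null_seqs_def)
  hence "\<forall>\<^sub>F i in sequentially. v (s i) < e / 2" by (rule order_tendstoD) (use \<open>e > 0\<close> in auto)
  then obtain N where N: "\<And>i. i \<ge> N \<Longrightarrow> v (s i) < e / 2" by (auto simp: eventually_sequentially)
  have "v (s i - s j) < e" if "i \<ge> N" "j \<ge> N" for i j
    using N[OF that(1)] N[OF that(2)] absval_diff[OF v, of "s i" "s j"] by simp
  thus "\<exists>N. \<forall>i\<ge>N. \<forall>j\<ge>N. v (s i - s j) < e" by blast
qed

lemma null_seqs_add:
  assumes v: "absolute_value v" and "s \<in> null_seqs v" "t \<in> null_seqs v"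
  shows "(\<lambda>i. s i + t i) \<in> null_seqs v"
proof -
  have "(\<lambda>i. v (s i) + v (t i)) \<longlonglongrightarrow> 0 + 0"
    using assms(2,3) unfolding null_seqs_def by (intro tendsto_intros) auto
  hence "(\<lambda>i. v (s i) + v (t i)) \<longlonglongrightarrow> 0" by simp
  thus ?thesis unfolding null_seqs_def mem_Collect_eq
    by (rule tendsto_sandwich[rotated -2, OF tendsto_const]) (auto simp: absval_nonneg[OF v] absval_add[OF v])
qed

lemma null_seqs_mult:
  assumes v: "absolute_value v" and s: "s \<in> null_seqs v" and t: "t \<in> cauchy_seqs v"
  shows "(\<lambda>i. s i * t i) \<in> null_seqs v"
proof -
  obtain K where K: "K > 0" "\<And>i. v (t i) \<le> K" using cauchy_seqs_bounded[OF v t] by auto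
  have "(\<lambda>i. v (s i) * K) \<longlonglongrightarrow> 0 * K"
    using s unfolding null_seqs_def by (intro tendsto_intros) auto
  hence "(\<lambda>i. v (s i) * K) \<longlonglongrightarrow> 0" by simp
  thus ?thesis unfolding null_seqs_def mem_Collect_eq
    by (rule tendsto_sandwich[rotated -2, OF tendsto_const])
      (auto simp: absval_nonneg[OF v] absval_mult[OF v] intro!: mult_left_mono K always_eventually)
qed

lemma null_seqs_uminus: "absolute_value v \<Longrightarrow> s \<in> null_seqs v \<Longrightarrow> (\<lambda>i. - s i) \<in> null_seqs v"
  by (simp add: null_seqs_def absval_minus)

lemma cauchy_not_null_bounded_below:
  assumes v: "absolute_value v" and s: "s \<in> cauchy_seqs v" and nn: "s \<notin> null_seqs v"
  shows "\<exists>c>0. \<exists>N. \<forall>i\<ge>N. c \<le> v (s i)"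
proof (rule ccontr)
  assume H: "\<not> ?thesis"
  have "(\<lambda>i. v (s i)) \<longlonglongrightarrow> 0"
  proof (rule LIMSEQ_I)
    fix e :: real assume e: "e > 0"
    obtain N where N: "\<And>i j. i \<ge> N \<Longrightarrow> j \<ge> N \<Longrightarrow> v (s i - s j) < e / 2"
      using cauchy_seqsD[OF s, of "e / 2"] e by auto
    obtain j where j: "j \<ge> N" "v (s j) < e / 2" using H e by (metis half_gt_zero not_le)
    have "v (s i) < e" if "i \<ge> N" for i
      using N[OF that j(1)] j(2) absval_add[OF v, of "s i - s j" "s j"] by simp
    thus "\<exists>N. \<forall>i\<ge>N. norm (v (s i) - 0) < e" using absval_nonneg[OF v] by (intro exI[of _ N]) auto
  qed
  thus False using nn by (simp add: null_seqs_def)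
qed

lemma cauchy_ring_simps:
  "carrier (cauchy_ring v) = cauchy_seqs v"
  "s \<otimes>\<^bsub>cauchy_ring v\<^esub> t = (\<lambda>i. s i * t i)"
  "s \<oplus>\<^bsub>cauchy_ring v\<^esub> t = (\<lambda>i. s i + t i)"
  "\<one>\<^bsub>cauchy_ring v\<^esub> = (\<lambda>i. 1)"
  "\<zero>\<^bsub>cauchy_ring v\<^esub> = (\<lambda>i. 0)"
  by (simp_all add: cauchy_ring_def)

lemma cauchy_ring_cring:
  assumes v: "absolute_value v"
  shows "cring (cauchy_ring v)"
proof (rule cringI)
  show "abelian_group (cauchy_ring v)"
  proof (rule abelian_groupI)
    fix x assume "x \<in> carrier (cauchy_ring v)"
    thus "\<exists>y\<in>carrier (cauchy_ring v). y \<oplus>\<^bsub>cauchy_ring v\<^esub> x = \<zero>\<^bsub>cauchy_ring v\<^esub>"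
      by (intro bexI[of _ "\<lambda>i. - x i"]) (auto simp: cauchy_ring_simps cauchy_seqs_uminus[OF v])
  qed (auto simp: cauchy_ring_simps cauchy_seqs_add[OF v] cauchy_seqs_const[OF v] algebra_simps)
  show "comm_monoid (cauchy_ring v)"
    by (rule comm_monoidI)
      (auto simp: cauchy_ring_simps cauchy_seqs_mult[OF v] cauchy_seqs_const[OF v] algebra_simps)
qed (auto simp: cauchy_ring_simps algebra_simps)

lemma cauchy_ring_uminus:
  assumes v: "absolute_value v" and s: "s \<in> cauchy_seqs v"
  shows "\<ominus>\<^bsub>cauchy_ring v\<^esub> s = (\<lambda>i. - s i)"
proof -
  interpret cring "cauchy_ring v" by (rule cauchy_ring_cring[OF v])
  show ?thesis
    by (rule minus_equality) (auto simp: cauchy_ring_simps s cauchy_seqs_uminus[OF v])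
qed

lemma null_seqs_ideal:
  assumes v: "absolute_value v"
  shows "ideal (null_seqs v) (cauchy_ring v)"
proof -
  interpret cring "cauchy_ring v" by (rule cauchy_ring_cring[OF v])
  show ?thesis
  proof (rule idealI)
    show "ring (cauchy_ring v)" by (rule ring_axioms)
    show "subgroup (null_seqs v) (add_monoid (cauchy_ring v))"
    proof (rule add.subgroupI)
      show "null_seqs v \<subseteq> carrier (cauchy_ring v)" using null_seqs_cauchy[OF v] by (auto simp: cauchy_ring_simps)
      have "(\<lambda>i. 0) \<in> null_seqs v" by (simp add: null_seqs_def absval_0[OF v])
      thus "null_seqs v \<noteq> {}" by blast
      show "\<ominus>\<^bsub>cauchy_ring v\<^esub> a \<in> null_seqs v" if "a \<in> null_seqs v" for a
        using that by (simp add: cauchy_ring_uminus[OF v null_seqs_cauchy[OF v that]] null_seqs_uminus[OF v])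
      show "a \<oplus>\<^bsub>cauchy_ring v\<^esub> b \<in> null_seqs v" if "a \<in> null_seqs v" "b \<in> null_seqs v" for a b
        using null_seqs_add[OF v that] by (simp add: cauchy_ring_simps)
    qed
    fix a x assume a: "a \<in> null_seqs v" and "x \<in> carrier (cauchy_ring v)"
    hence "(\<lambda>i. a i * x i) \<in> null_seqs v" by (intro null_seqs_mult[OF v]) (auto simp: cauchy_ring_simps)
    thus "a \<otimes>\<^bsub>cauchy_ring v\<^esub> x \<in> null_seqs v" "x \<otimes>\<^bsub>cauchy_ring v\<^esub> a \<in> null_seqs v"
      by (simp_all add: cauchy_ring_simps mult.commute)
  qed
qed

locale completed_field =
  fixes v :: "'a::field_char_0 \<Rightarrow> real"
  assumes v: "absolute_value v"
begin

abbreviation "R \<equiv> cauchy_ring v"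
abbreviation "Kv \<equiv> completion v"
abbreviation "h \<equiv> \<lambda>s. null_seqs v +>\<^bsub>R\<^esub> s"
abbreviation "QS \<equiv> {s \<in> cauchy_seqs v. \<forall>i. s i \<in> \<rat>}"

sublocale R: cring R by (rule cauchy_ring_cring[OF v])
sublocale I: ideal "null_seqs v" R by (rule null_seqs_ideal[OF v])
sublocale Kv: cring Kv unfolding completion_def by (rule I.quotient_is_cring[OF R.is_cring])
sublocale h: ring_hom_ring R Kv h
  unfolding completion_def by (rule I.rcos_ring_hom_ring)

lemma carrier_Kv: "carrier Kv = h ` cauchy_seqs v"
  unfolding completion_def FactRing_def A_RCOSETS_def' by (auto simp: cauchy_ring_simps)

lemma h_eq_iff:
  assumes "s \<in> cauchy_seqs v" "t \<in> cauchy_seqs v"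
  shows "h s = h t \<longleftrightarrow> (\<lambda>i. s i - t i) \<in> null_seqs v"
  using R.quotient_eq_iff_same_a_r_cos[OF null_seqs_ideal[OF v], of s t] assms
  by (simp add: cauchy_ring_simps a_minus_def cauchy_ring_uminus[OF v])

lemma zero_Kv: "\<zero>\<^bsub>Kv\<^esub> = h (\<lambda>i. 0)"
  using h.hom_zero by (simp add: cauchy_ring_simps)

lemma h_eq_zero_iff: "s \<in> cauchy_seqs v \<Longrightarrow> h s = \<zero>\<^bsub>Kv\<^esub> \<longleftrightarrow> s \<in> null_seqs v"
  using h_eq_iff[of s "\<lambda>i. 0"] cauchy_seqs_const[OF v] by (simp add: zero_Kv)

lemma rat_completion_eq: "rat_completion v = h ` QS"
  by (simp add: rat_completion_def)

lemma QS_subring: "subring QS R"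
proof (rule R.subringI)
  show "\<ominus>\<^bsub>R\<^esub> s \<in> QS" if "s \<in> QS" for s
    using that by (auto simp: cauchy_ring_uminus[OF v] cauchy_seqs_uminus[OF v])
qed (auto simp: cauchy_ring_simps cauchy_seqs_const[OF v] cauchy_seqs_add[OF v] cauchy_seqs_mult[OF v])

text \<open>A Cauchy sequence that does not tend to \<open>0\<close> eventually stays away from
  \<open>0\<close>, so the termwise inverses are a Cauchy sequence.\<close>

lemma rational_inverse:
  assumes s: "s \<in> QS" and nn: "s \<notin> null_seqs v"
  shows "\<exists>t\<in>QS. h s \<otimes>\<^bsub>Kv\<^esub> h t = \<one>\<^bsub>Kv\<^esub>"
proof -
  obtain c N where c: "c > 0" "\<And>i. i \<ge> N \<Longrightarrow> c \<le> v (s i)"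
    using cauchy_not_null_bounded_below[OF v _ nn] s by auto
  \<comment> \<open>the finitely many vanishing terms of \<open>s\<close> have the inverse
    \<open>0\<close>, which does not affect the class\<close>
  define t where "t = (\<lambda>i. inverse (s i))"
  have nz: "s i \<noteq> 0" if "i \<ge> N" for i using c(2)[OF that] c(1) absval_0[OF v] by auto
  have t: "t \<in> cauchy_seqs v"
    unfolding cauchy_seqs_def
  proof (clarify)
    fix e :: real assume e: "e > 0"
    obtain M where M: "\<And>i j. i \<ge> M \<Longrightarrow> j \<ge> M \<Longrightarrow> v (s i - s j) < e * c * c"
      using cauchy_seqsD[of s v "e * c * c"] e c s by auto
    have "v (t i - t j) < e" if "i \<ge> max M N" "j \<ge> max M N" for i j
    proof -
      have nzs: "s i \<noteq> 0" "s j \<noteq> 0" using nz that by auto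
      have p: "0 < v (s i)" "0 < v (s j)" using nzs absval_pos[OF v] by auto
      have "t i - t j = (s j - s i) / (s i * s j)" using nzs by (simp add: t_def field_simps)
      hence "v (t i - t j) = v (s i - s j) / (v (s i) * v (s j))"
        by (simp add: absval_divide[OF v] absval_mult[OF v] absval_diff_commute[OF v, of "s i"])
      also have "\<dots> \<le> v (s i - s j) / (c * c)"
        using c that absval_nonneg[OF v] p by (intro divide_left_mono mult_mono) auto
      also have "\<dots> < e" using M[of i j] that c by (simp add: field_simps)
      finally show ?thesis .
    qed
    thus "\<exists>N. \<forall>i\<ge>N. \<forall>j\<ge>N. v (t i - t j) < e" by blast
  qed
  have tQ: "t \<in> QS" using t s by (auto simp: t_def)
  have "(\<lambda>i. v (s i * t i - 1)) \<longlonglongrightarrow> 0"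
  proof (rule tendsto_eventually)
    show "\<forall>\<^sub>F i in sequentially. v (s i * t i - 1) = 0"
      unfolding eventually_sequentially using nz by (intro exI[of _ N]) (auto simp: t_def absval_0[OF v])
  qed
  hence "h (\<lambda>i. s i * t i) = h (\<lambda>i. 1)"
    using s tQ by (subst h_eq_iff) (auto intro: cauchy_seqs_mult[OF v] cauchy_seqs_const[OF v] simp: null_seqs_def)
  hence "h s \<otimes>\<^bsub>Kv\<^esub> h t = \<one>\<^bsub>Kv\<^esub>"
    using h.hom_mult[of s t] h.hom_one s tQ by (simp add: cauchy_ring_simps)
  thus ?thesis using tQ by blast
qed

lemma one_neq_zero_Kv: "\<one>\<^bsub>Kv\<^esub> \<noteq> \<zero>\<^bsub>Kv\<^esub>"
proof -
  have "(\<lambda>i::nat. 1::'a) \<notin> null_seqs v" by (simp add: null_seqs_def absval_1[OF v] LIMSEQ_const_iff)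
  thus ?thesis using h_eq_zero_iff[OF cauchy_seqs_const[OF v], of 1] h.hom_one by (simp add: cauchy_ring_simps)
qed

lemma rat_completion_subfield: "subfield (rat_completion v) Kv"
proof (rule Kv.subfieldI)
  have sr: "subring (rat_completion v) Kv"
    unfolding rat_completion_eq by (rule h.img_is_subring[OF QS_subring])
  thus "subcring (rat_completion v) Kv" by (rule Kv.subcringI')
  show "Units (Kv\<lparr>carrier := rat_completion v\<rparr>) = rat_completion v - {\<zero>\<^bsub>Kv\<^esub>}"
  proof (intro equalityI subsetI)
    fix x assume x: "x \<in> Units (Kv\<lparr>carrier := rat_completion v\<rparr>)"
    then obtain y where y: "y \<in> rat_completion v" "x \<otimes>\<^bsub>Kv\<^esub> y = \<one>\<^bsub>Kv\<^esub>" "x \<in> rat_completion v"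
      unfolding Units_def by auto
    have "x \<noteq> \<zero>\<^bsub>Kv\<^esub>"
    proof
      assume "x = \<zero>\<^bsub>Kv\<^esub>"
      hence "x \<otimes>\<^bsub>Kv\<^esub> y = \<zero>\<^bsub>Kv\<^esub>" using y subringE(1)[OF sr] by (auto intro: Kv.l_null)
      thus False using y one_neq_zero_Kv by simp
    qed
    thus "x \<in> rat_completion v - {\<zero>\<^bsub>Kv\<^esub>}" using y by simp
  next
    fix x assume x: "x \<in> rat_completion v - {\<zero>\<^bsub>Kv\<^esub>}"
    then obtain s where s: "s \<in> QS" "x = h s" by (auto simp: rat_completion_eq)
    hence "s \<notin> null_seqs v" using x h_eq_zero_iff by auto
    then obtain t where t: "t \<in> QS" "h s \<otimes>\<^bsub>Kv\<^esub> h t = \<one>\<^bsub>Kv\<^esub>" using rational_inverse s by blast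
    have ht: "h t \<in> rat_completion v" using t by (auto simp: rat_completion_eq)
    have "h t \<otimes>\<^bsub>Kv\<^esub> h s = \<one>\<^bsub>Kv\<^esub>"
      using t(2) Kv.m_comm[of "h s" "h t"] s(1) t(1) by (auto simp: carrier_Kv)
    thus "x \<in> Units (Kv\<lparr>carrier := rat_completion v\<rparr>)"
      using x s t ht unfolding Units_def by auto
  qed
qed

lemma combine_h:
  assumes "\<And>j. j \<in> set js \<Longrightarrow> s j \<in> cauchy_seqs v" "\<And>j. j \<in> set js \<Longrightarrow> c j \<in> cauchy_seqs v"
  shows "Kv.combine (map (\<lambda>j. h (s j)) js) (map (\<lambda>j. h (c j)) js) = h (\<lambda>i. \<Sum>j\<leftarrow>js. s j i * c j i)
     \<and> (\<lambda>i. \<Sum>j\<leftarrow>js. s j i * c j i) \<in> cauchy_seqs v"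
  using assms
proof (induction js)
  case Nil
  show ?case using cauchy_seqs_const[OF v, of 0] by (simp add: zero_Kv)
next
  case (Cons j js)
  have sj: "s j \<in> cauchy_seqs v" and cj: "c j \<in> cauchy_seqs v" using Cons.prems by auto
  let ?t = "\<lambda>i. \<Sum>j\<leftarrow>js. s j i * c j i"
  have IH: "Kv.combine (map (\<lambda>j. h (s j)) js) (map (\<lambda>j. h (c j)) js) = h ?t" "?t \<in> cauchy_seqs v"
    using Cons by auto
  have m: "(\<lambda>i. s j i * c j i) \<in> cauchy_seqs v" by (rule cauchy_seqs_mult[OF v sj cj])
  have "h (s j) \<otimes>\<^bsub>Kv\<^esub> h (c j) = h (\<lambda>i. s j i * c j i)"
    using h.hom_mult[of "s j" "c j"] sj cj by (simp add: cauchy_ring_simps)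
  moreover have "h (\<lambda>i. s j i * c j i) \<oplus>\<^bsub>Kv\<^esub> h ?t = h (\<lambda>i. s j i * c j i + ?t i)"
    using h.hom_add[of "\<lambda>i. s j i * c j i" ?t] m IH(2) by (simp add: cauchy_ring_simps)
  ultimately show ?case using IH cauchy_seqs_add[OF v m IH(2)] by simp
qed

lemma combine_basis:
  fixes b :: "nat \<Rightarrow> 'a"
  assumes "\<And>j. j < n \<Longrightarrow> s j \<in> cauchy_seqs v"
  shows "Kv.combine (map (\<lambda>j. h (s j)) [0..<n]) (map (\<lambda>j. h (\<lambda>i. b j)) [0..<n]) = h (\<lambda>i. \<Sum>j<n. s j i * b j)"
  using combine_h[of "[0..<n]" s "\<lambda>j i. b j"] assms cauchy_seqs_const[OF v]
  by (simp add: interv_sum_list_conv_sum_set_nat lessThan_atLeast0)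

text \<open>The classes of the constant sequences \<open>b j\<close> are a basis of the completion
  over the completion of the rationals. The control of the coefficients shows that the coefficient
  sequences of a null sequence of combinations are null, which is independence, and that those of a
  Cauchy sequence of combinations are Cauchy, so that density gives spanning.\<close>

lemma local_degree_eq:
  assumes w: "absolute_value w" and ve: "v \<in> extensions w" and tb: "top_basis w v n b"
  shows "local_degree v = n"
proof -
  obtain C where C: "C > 0" "\<And>q j. j < n \<Longrightarrow> C * w (q j) \<le> v (\<Sum>i<n. of_rat (q i) * b i)"
    using tb unfolding top_basis_def top_indep_def by blast
  define Us where "Us = map (\<lambda>j. h (\<lambda>i. b j)) [0..<n]"
  have lU: "length Us = n" by (simp add: Us_def)
  have Uc: "set Us \<subseteq> carrier Kv" using cauchy_seqs_const[OF v] by (auto simp: Us_def carrier_Kv)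
  have rep: "\<exists>s. (\<forall>j<n. s j \<in> QS) \<and> Ks = map (\<lambda>j. h (s j)) [0..<n]"
    if "set Ks \<subseteq> rat_completion v" "length Ks = n" for Ks
  proof -
    have ex: "\<exists>t. t \<in> QS \<and> Ks ! j = h t" if "j < n" for j
    proof -
      have "Ks ! j \<in> set Ks" using \<open>length Ks = n\<close> that by simp
      hence "Ks ! j \<in> h ` QS" using \<open>set Ks \<subseteq> rat_completion v\<close> unfolding rat_completion_eq by (rule rev_subsetD)
      then obtain t where "Ks ! j = h t" "t \<in> QS" by (rule imageE)
      thus ?thesis by (intro exI[of _ t] conjI)
    qed
    define s where "s = (\<lambda>j. SOME t. t \<in> QS \<and> Ks ! j = h t)"
    have s: "s j \<in> QS \<and> Ks ! j = h (s j)" if "j < n" for j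
      unfolding s_def by (rule someI_ex[OF ex[OF that]])
    have "Ks = map (\<lambda>j. h (s j)) [0..<n]"
      by (rule nth_equalityI) (simp_all add: \<open>length Ks = n\<close> s)
    thus ?thesis using s by blast
  qed
  have triv: "set Ks \<subseteq> {\<zero>\<^bsub>Kv\<^esub>}"
    if K: "set Ks \<subseteq> rat_completion v" "length Ks = n" and z: "Kv.combine Ks Us = \<zero>\<^bsub>Kv\<^esub>" for Ks
  proof -
    obtain s where s: "\<And>j. j < n \<Longrightarrow> s j \<in> QS" "Ks = map (\<lambda>j. h (s j)) [0..<n]" using rep[OF K] by blast
    define q where "q = (\<lambda>i j. SOME q. s j i = of_rat q)"
    have q: "s j i = of_rat (q i j)" if "j < n" for i j
    proof -
      have "\<exists>q. s j i = of_rat q" using s(1)[OF that] by (auto elim: Rats_cases)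
      thus ?thesis unfolding q_def by (rule someI_ex)
    qed
    let ?t = "\<lambda>i. \<Sum>j<n. s j i * b j"
    have tc: "?t \<in> cauchy_seqs v"
      using s(1) by (intro cauchy_seqs_sum[OF v] cauchy_seqs_mult[OF v] cauchy_seqs_const[OF v]) auto
    have "h ?t = \<zero>\<^bsub>Kv\<^esub>" using z combine_basis[of n s b] s by (simp add: Us_def)
    hence lim: "(\<lambda>i. v (?t i)) \<longlonglongrightarrow> 0" using h_eq_zero_iff[OF tc] by (simp add: null_seqs_def)
    have "s j \<in> null_seqs v" if j: "j < n" for j
    proof -
      have le: "v (s j i) \<le> v (?t i) / C" for i
      proof -
        have "C * w (q i j) \<le> v (\<Sum>k<n. of_rat (q i k) * b k)" by (rule C(2)[OF j])
        also have "(\<Sum>k<n. of_rat (q i k) * b k) = ?t i" by (rule sum.cong) (simp_all add: q)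
        finally show ?thesis using C(1) j by (simp add: q extensions_of_rat[OF ve] field_simps)
      qed
      have "(\<lambda>i. v (?t i) / C) \<longlonglongrightarrow> 0 / C" by (intro tendsto_intros lim) (use C in auto)
      hence "(\<lambda>i. v (?t i) / C) \<longlonglongrightarrow> 0" by simp
      thus ?thesis unfolding null_seqs_def mem_Collect_eq
        by (rule tendsto_sandwich[rotated -2, OF tendsto_const]) (auto simp: absval_nonneg[OF v] le)
    qed
    hence "h (s j) = \<zero>\<^bsub>Kv\<^esub>" if "j < n" for j
      using s(1)[OF that] that h_eq_zero_iff by simp
    thus ?thesis unfolding s(2) by (simp add: image_subset_iff)
  qed
  have "Kv.independent (rat_completion v) Us"
  proof (rule Kv.trivial_combine_imp_independent[OF rat_completion_subfield Uc])
    fix Ks assume K: "set Ks \<subseteq> rat_completion v" and z: "Kv.combine Ks Us = \<zero>\<^bsub>Kv\<^esub>"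
    \<comment> \<open>coefficient lists of any length occur; padding with zeros and cutting off
      gives length \<open>n\<close>\<close>
    define Ks' where "Ks' = take n (Ks @ replicate n \<zero>\<^bsub>Kv\<^esub>)"
    have zero: "\<zero>\<^bsub>Kv\<^esub> \<in> rat_completion v"
      using subfieldE(1)[OF rat_completion_subfield] subringE(2) by blast
    have "Kv.combine Ks' Us = Kv.combine Ks Us"
      unfolding Ks'_def lU[symmetric] Kv.combine_take by (rule Kv.combine_append_replicate[OF Uc])
    moreover have "set Ks' \<subseteq> rat_completion v"
      unfolding Ks'_def using K zero set_take_subset[of n "Ks @ replicate n \<zero>\<^bsub>Kv\<^esub>"] by auto
    moreover have "length Ks' = n" by (simp add: Ks'_def)
    ultimately have "set Ks' \<subseteq> {\<zero>\<^bsub>Kv\<^esub>}" using triv z by simp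
    moreover have "set (take (length Us) Ks) \<subseteq> set Ks'" by (auto simp: Ks'_def lU)
    ultimately show "set (take (length Us) Ks) \<subseteq> {\<zero>\<^bsub>Kv\<^esub>}" by blast
  qed
  hence "Kv.dimension (length Us) (rat_completion v) (Kv.Span (rat_completion v) Us)"
    by (rule Kv.dimension_independent)
  moreover have "Kv.Span (rat_completion v) Us = carrier Kv"
  proof
    show "Kv.Span (rat_completion v) Us \<subseteq> carrier Kv"
      by (rule Kv.Span_in_carrier[OF _ Uc]) (rule subfieldE(3)[OF rat_completion_subfield])
    show "carrier Kv \<subseteq> Kv.Span (rat_completion v) Us"
    proof
      fix x assume "x \<in> carrier Kv"
      then obtain t where t: "t \<in> cauchy_seqs v" "x = h t" by (auto simp: carrier_Kv)
      have "\<exists>q. v (t i - (\<Sum>j<n. of_rat (q j) * b j)) < inverse (real (Suc i))" for i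
        using tb unfolding top_basis_def by simp
      then obtain q where q: "\<And>i. v (t i - (\<Sum>j<n. of_rat (q i j) * b j)) < inverse (real (Suc i))" by metis
      let ?y = "\<lambda>i. \<Sum>j<n. of_rat (q i j) * b j"
      have null: "(\<lambda>i. t i - ?y i) \<in> null_seqs v"
        unfolding null_seqs_def mem_Collect_eq
        by (rule tendsto_sandwich[rotated -2, OF tendsto_const LIMSEQ_inverse_real_of_nat])
          (rule always_eventually, rule allI, rule absval_nonneg[OF v],
            rule always_eventually, rule allI, rule less_imp_le, rule q)
      have "(\<lambda>i. t i - (t i - ?y i)) \<in> cauchy_seqs v"
        by (rule cauchy_seqs_diff[OF v t(1) null_seqs_cauchy[OF v null]])
      hence yc: "?y \<in> cauchy_seqs v" by simp
      \<comment> \<open>the coefficients of the approximations to \<open>x\<close> are Cauchy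
        sequences, because the approximations are\<close>
      have sc: "(\<lambda>i. of_rat (q i j)) \<in> cauchy_seqs v" if j: "j < n" for j
        unfolding cauchy_seqs_def
      proof (clarify)
        fix e :: real assume e: "e > 0"
        have Ce: "0 < C * e" using C e by simp
        obtain N where N0: "\<forall>i\<ge>N. \<forall>k\<ge>N. v (?y i - ?y k) < C * e"
          using cauchy_seqsD[OF yc Ce] by blast
        have N: "v (?y i - ?y k) < C * e" if "i \<ge> N" "k \<ge> N" for i k
          using N0 that by blast
        have "v (of_rat (q i j) - of_rat (q k j)) < e" if "i \<ge> N" "k \<ge> N" for i k
        proof -
          have "C * w (q i j - q k j) \<le> v (\<Sum>l<n. of_rat (q i l - q k l) * b l)"
            using C(2)[OF j, of "\<lambda>l. q i l - q k l"] .
          also have "(\<Sum>l<n. of_rat (q i l - q k l) * b l) = ?y i - ?y k"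
            by (simp add: of_rat_diff left_diff_distrib sum_subtractf)
          also have "v \<dots> < C * e" by (rule N[OF that])
          finally have "w (q i j - q k j) < e" using C(1) by simp
          thus ?thesis by (simp add: of_rat_diff[symmetric] extensions_of_rat[OF ve])
        qed
        thus "\<exists>N. \<forall>i\<ge>N. \<forall>k\<ge>N. v (of_rat (q i j) - of_rat (q k j)) < e" by blast
      qed
      have "x = h ?y" unfolding t(2) using h_eq_iff[OF t(1) yc] null by simp
      also have "\<dots> = Kv.combine (map (\<lambda>j. h (\<lambda>i. of_rat (q i j))) [0..<n]) Us"
        unfolding Us_def using combine_basis[of n "\<lambda>j i. of_rat (q i j)" b] sc by simp
      finally have x: "x = Kv.combine (map (\<lambda>j. h (\<lambda>i. of_rat (q i j))) [0..<n]) Us" .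
      have sub: "set (map (\<lambda>j. h (\<lambda>i. of_rat (q i j))) [0..<n]) \<subseteq> rat_completion v"
        using sc by (auto simp: rat_completion_eq)
      have "length (map (\<lambda>j. h (\<lambda>i. of_rat (q i j))) [0..<n]) = length Us" using lU by simp
      thus "x \<in> Kv.Span (rat_completion v) Us"
        unfolding Kv.Span_mem_iff_length_version[OF rat_completion_subfield Uc]
        by (intro exI[of _ "map (\<lambda>j. h (\<lambda>i. of_rat (q i j))) [0..<n]"] conjI sub x)
    qed
  qed
  ultimately have "Kv.dimension n (rat_completion v) (carrier Kv)" using lU by simp
  thus ?thesis
    using Kv.dimI[OF rat_completion_subfield] unfolding local_degree_def over_def by blast
qed

end

section \<open>The p-adic absolute values of the rationals\<close>

lemma padic_abs_quotient:
  assumes p: "prime p" and a: "a \<noteq> 0" and b: "b \<noteq> 0"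
  shows "padic_abs p (of_int a / of_int b) = real p powi (int (multiplicity (int p) b) - int (multiplicity (int p) a))"
proof -
  have pe: "prime_elem (int p)" using p by (simp add: prime_imp_prime_elem)
  let ?q = "of_int a / of_int b :: rat"
  obtain n e where ne: "quotient_of ?q = (n, e)" by fastforce
  have e: "e > 0" using quotient_of_denom_pos[OF ne] .
  have q: "?q = of_int n / of_int e" by (rule quotient_of_div[OF ne])
  have n: "n \<noteq> 0" using q a b by auto
  have "of_int (a * e) = (of_int (n * b) :: rat)" using q b e by (simp add: field_simps)
  hence eq: "a * e = n * b" by (simp only: of_int_eq_iff)
  have "multiplicity (int p) a + multiplicity (int p) e = multiplicity (int p) n + multiplicity (int p) b"
    using arg_cong[OF eq, of "multiplicity (int p)"] a b n e
    by (simp add: prime_elem_multiplicity_mult_distrib[OF pe])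
  hence "int (multiplicity (int p) e) - int (multiplicity (int p) n) = int (multiplicity (int p) b) - int (multiplicity (int p) a)"
    by linarith
  thus ?thesis using a b by (simp add: padic_abs_def ne)
qed

lemma rat_obtain_quotient:
  obtains a b where "(q::rat) = of_int a / of_int b" "b \<noteq> 0"
proof -
  obtain n e where ne: "quotient_of q = (n, e)" by fastforce
  show ?thesis using that[of n e] quotient_of_div[OF ne] quotient_of_denom_pos[OF ne] by simp
qed

lemma padic_abs_0: "padic_abs p 0 = 0"
  by (simp add: padic_abs_def)

lemma padic_abs_mult:
  assumes p: "prime p"
  shows "padic_abs p (x * y) = padic_abs p x * padic_abs p y"
proof (cases "x = 0 \<or> y = 0")
  case False
  have pe: "prime_elem (int p)" using p by (simp add: prime_imp_prime_elem)
  have p0: "real p \<noteq> 0" using p by (simp add: prime_gt_0_nat)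
  obtain a b where x: "x = of_int a / of_int b" "b \<noteq> 0" by (rule rat_obtain_quotient)
  obtain c d where y: "y = of_int c / of_int d" "d \<noteq> 0" by (rule rat_obtain_quotient)
  have ac: "a \<noteq> 0" "c \<noteq> 0" using x y False by auto
  have "x * y = of_int (a * c) / of_int (b * d)" using x y by simp
  hence "padic_abs p (x * y) = real p powi (int (multiplicity (int p) (b * d)) - int (multiplicity (int p) (a * c)))"
    using padic_abs_quotient[OF p, of "a * c" "b * d"] ac x y by simp
  also have "\<dots> = real p powi ((int (multiplicity (int p) b) - int (multiplicity (int p) a)) +
      (int (multiplicity (int p) d) - int (multiplicity (int p) c)))"
    using ac x y by (simp add: prime_elem_multiplicity_mult_distrib[OF pe] algebra_simps)
  also have "\<dots> = padic_abs p x * padic_abs p y"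
    unfolding x(1) y(1) padic_abs_quotient[OF p ac(1) x(2)] padic_abs_quotient[OF p ac(2) y(2)]
    by (rule power_int_add) (use p0 in simp)
  finally show ?thesis .
qed (auto simp: padic_abs_0)

lemma padic_abs_pos:
  assumes p: "prime p" and "x \<noteq> 0" shows "padic_abs p x > 0"
  using assms by (simp add: padic_abs_def prime_gt_0_nat zero_less_power_int)

lemma padic_abs_nonneg: "prime p \<Longrightarrow> 0 \<le> padic_abs p x"
  using padic_abs_pos[of p x] padic_abs_0[of p] by (cases "x = 0") auto

lemma padic_abs_of_int_le_1:
  assumes p: "prime p" shows "padic_abs p (of_int a) \<le> 1"
proof (cases "a = 0")
  case False
  have p1: "real p \<ge> 1" using prime_ge_1_nat[OF p] by simp
  have "padic_abs p (of_int a) = real p powi (- int (multiplicity (int p) a))"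
    using padic_abs_quotient[OF p False, of 1] by simp
  also have "\<dots> \<le> 1" using p1 by (simp add: power_int_minus field_simps)
  finally show ?thesis .
qed (simp add: padic_abs_0)

lemma padic_abs_of_int_unit:
  assumes p: "prime p" and a: "\<not> int p dvd a" shows "padic_abs p (of_int a) = 1"
proof -
  have "a \<noteq> 0" using a by auto
  thus ?thesis using padic_abs_quotient[OF p, of a 1] a by (simp add: not_dvd_imp_multiplicity_0)
qed

lemma padic_abs_p: "prime p \<Longrightarrow> padic_abs p (of_nat p) = 1 / real p"
proof -
  assume p: "prime p"
  have "multiplicity (int p) (int p) = 1"
    using p by (intro multiplicity_self) (auto simp: prime_gt_0_nat prime_gt_1_nat zdvd1_eq)
  thus ?thesis using padic_abs_quotient[OF p, of "int p" 1] p
    by (simp add: power_int_minus divide_inverse prime_gt_0_nat)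
qed

lemma padic_abs_le_1_denominator:
  assumes p: "prime p" and le: "padic_abs p q \<le> 1"
  shows "\<exists>N a. \<not> int p dvd N \<and> of_int N * q = of_int a"
proof -
  obtain n e where ne: "quotient_of q = (n, e)" by fastforce
  have e: "e > 0" using quotient_of_denom_pos[OF ne] .
  have q: "q = of_int n / of_int e" by (rule quotient_of_div[OF ne])
  have cop: "coprime n e" by (rule quotient_of_coprime[OF ne])
  have "\<not> int p dvd e"
  proof
    assume pe: "int p dvd e"
    hence pn: "\<not> int p dvd n" using cop p by (meson coprime_common_divisor not_prime_unit prime_int_nat_transfer prime_nat_int_transfer)
    have n0: "n \<noteq> 0" using pn by auto
    have nu: "\<not> is_unit (int p)" using p by (auto simp: prime_gt_1_nat zdvd1_eq)
    have "multiplicity (int p) e > 0"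
      using multiplicity_gt_zero_iff[OF _ nu, of e] pe e by simp
    hence "1 \<le> int (multiplicity (int p) e)" by simp
    moreover have "padic_abs p q = real p powi (int (multiplicity (int p) e))"
      using padic_abs_quotient[OF p n0, of e] e q pn by (simp add: not_dvd_imp_multiplicity_0)
    moreover have "real p > 1" using prime_gt_1_nat[OF p] by simp
    ultimately have "1 < padic_abs p q" using one_less_power[of "real p" "multiplicity (int p) e"] by simp
    thus False using le by simp
  qed
  moreover have "of_int e * q = of_int n" using q e by simp
  ultimately show ?thesis by blast
qed

text \<open>Fractions with denominators prime to \<open>p\<close> have a sum with denominator prime
  to \<open>p\<close>.\<close>

lemma padic_abs_add_le_1:
  assumes p: "prime p" and "padic_abs p x \<le> 1" "padic_abs p y \<le> 1"
  shows "padic_abs p (x + y) \<le> 1"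
proof -
  obtain N a where N: "\<not> int p dvd N" "of_int N * x = of_int a" using padic_abs_le_1_denominator[OF p assms(2)] by blast
  obtain M b where M: "\<not> int p dvd M" "of_int M * y = of_int b" using padic_abs_le_1_denominator[OF p assms(3)] by blast
  have "of_int N * of_int M * (x + y) = (of_int (M * a + N * b) :: rat)"
    using N(2) M(2) by (simp add: algebra_simps)
  hence "padic_abs p (of_int N) * padic_abs p (of_int M) * padic_abs p (x + y) \<le> 1"
    using padic_abs_of_int_le_1[OF p, of "M * a + N * b"] by (simp only: padic_abs_mult[OF p, symmetric])
  thus ?thesis by (simp add: padic_abs_of_int_unit[OF p] N M)
qed

lemma padic_abs_1: "prime p \<Longrightarrow> padic_abs p 1 = 1"
  using padic_abs_mult[of p 1 1] padic_abs_pos[of p 1] by simp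

lemma padic_abs_inverse: "prime p \<Longrightarrow> padic_abs p (inverse x) = inverse (padic_abs p x)"
proof (cases "x = 0")
  case False
  assume p: "prime p"
  have "padic_abs p x * padic_abs p (inverse x) = 1"
    using padic_abs_mult[OF p, of x "inverse x"] False padic_abs_1[OF p] by simp
  thus ?thesis by (metis inverse_unique)
qed (simp add: padic_abs_0)

lemma padic_abs_add_le_max:
  assumes p: "prime p"
  shows "padic_abs p (x + y) \<le> max (padic_abs p x) (padic_abs p y)"
proof -
  have *: "padic_abs p (x + y) \<le> padic_abs p y" if le: "padic_abs p x \<le> padic_abs p y" for x y
  proof (cases "y = 0")
    case True
    hence "x = 0" using le padic_abs_pos[OF p, of x] by (auto simp: padic_abs_0)
    thus ?thesis using True by simp
  next
    case False
    have "padic_abs p (x * inverse y) \<le> 1"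
      unfolding padic_abs_mult[OF p] padic_abs_inverse[OF p]
      using le padic_abs_pos[OF p False] by (simp add: field_simps)
    hence "padic_abs p (x * inverse y + 1) \<le> 1"
      by (rule padic_abs_add_le_1[OF p]) (simp add: padic_abs_1[OF p])
    hence "padic_abs p (x * inverse y + 1) * padic_abs p y \<le> 1 * padic_abs p y"
      using padic_abs_nonneg[OF p] by (intro mult_right_mono)
    moreover have "(x * inverse y + 1) * y = x + y" using False by (simp add: field_simps)
    ultimately show ?thesis by (simp add: padic_abs_mult[OF p, symmetric])
  qed
  show ?thesis
    using *[of x y] *[of y x] by (cases "padic_abs p x \<le> padic_abs p y") (auto simp: add.commute)
qed

lemma nontrivial_padic_abs:
  assumes p: "prime p" shows "nontrivial (padic_abs p)"
proof -
  have "absolute_value (padic_abs p)"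
    unfolding absolute_value_def
  proof (intro conjI allI)
    fix x y
    show "0 \<le> padic_abs p x" by (rule padic_abs_nonneg[OF p])
    show "padic_abs p x = 0 \<longleftrightarrow> x = 0" using padic_abs_pos[OF p, of x] padic_abs_0[of p] by (metis less_irrefl)
    show "padic_abs p (x * y) = padic_abs p x * padic_abs p y" by (rule padic_abs_mult[OF p])
    show "padic_abs p (x + y) \<le> padic_abs p x + padic_abs p y"
      using padic_abs_add_le_max[OF p, of x y] padic_abs_nonneg[OF p, of x] padic_abs_nonneg[OF p, of y] by linarith
  qed
  moreover have "0 < padic_abs p (of_nat p) \<and> padic_abs p (of_nat p) < 1"
    using prime_gt_1_nat[OF p] by (simp add: padic_abs_p[OF p])
  ultimately show ?thesis unfolding nontrivial_def by blast
qed

lemma padic_abs_discrete: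
  assumes p: "prime p" and x: "x \<noteq> 0"
  shows "\<exists>k::int. padic_abs p x = real p powi k"
  using x by (auto simp: padic_abs_def)

section \<open>Valuation rings\<close>

text \<open>A subring that contains the p-integral rationals and \<open>1 / x\<close> and is maximal
  among the subrings without \<open>x\<close>. It will turn out to be the unit ball of an extension
  of the p-adic absolute value, for which \<open>x\<close> is larger than \<open>1\<close>.\<close>

locale maximal_subring =
  fixes p :: nat and R :: "'a::field_char_0 set" and x :: 'a
  assumes p: "prime p"
    and ratR: "padic_abs p q \<le> 1 \<Longrightarrow> of_rat q \<in> R"
    and addR: "a \<in> R \<Longrightarrow> b \<in> R \<Longrightarrow> a + b \<in> R"
    and multR: "a \<in> R \<Longrightarrow> b \<in> R \<Longrightarrow> a * b \<in> R"
    and xR: "x \<notin> R" and invxR: "inverse x \<in> R"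
    and maxR: "R \<subseteq> S \<Longrightarrow> (\<And>a b. a \<in> S \<Longrightarrow> b \<in> S \<Longrightarrow> a + b \<in> S) \<Longrightarrow>
        (\<And>a b. a \<in> S \<Longrightarrow> b \<in> S \<Longrightarrow> a * b \<in> S) \<Longrightarrow> x \<notin> S \<Longrightarrow> S = R"
    and alg: "\<exists>n>0. \<exists>r. (y::'a) ^ n = (\<Sum>i<n. of_rat (r i) * y ^ i)"
begin

lemma intR: "of_int k \<in> R"
  using ratR[of "of_int k"] padic_abs_of_int_le_1[OF p] by simp

lemma oneR: "1 \<in> R" and zeroR: "0 \<in> R"
  using intR[of 1] intR[of 0] by simp_all

lemma minusR: "a \<in> R \<Longrightarrow> - a \<in> R"
  using multR[OF intR[of "-1"]] by simp

lemma diffR: "a \<in> R \<Longrightarrow> b \<in> R \<Longrightarrow> a - b \<in> R"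
  using addR[of a "-b"] minusR[of b] by simp

lemma powerR: "a \<in> R \<Longrightarrow> a ^ n \<in> R"
  by (induction n) (auto intro: oneR multR)

lemma sumR: "(\<And>i. i \<in> I \<Longrightarrow> f i \<in> R) \<Longrightarrow> sum f I \<in> R"
  by (induction I rule: infinite_finite_induct) (auto intro: zeroR addR)

lemma x_nonzero: "x \<noteq> 0" using xR zeroR by auto

text \<open>Let \<open>u = 1 - b / x\<close>. By maximality it suffices that \<open>x\<close> does
  not lie in the ring of all \<open>a / u\<^sup>k\<close>, that is, that no \<open>x
  u\<^sup>k\<close> lies in \<open>R\<close>. This follows by induction from \<open>x
  u\<^sup>k\<^sup>+\<^sup>1 = x u\<^sup>k - b u\<^sup>k\<close>.\<close>

lemma unit_1_minus:
  assumes b: "b \<in> R"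
  shows "1 - inverse x * b \<noteq> 0" "inverse (1 - inverse x * b) \<in> R"
proof -
  let ?u = "1 - inverse x * b"
  show u0: "?u \<noteq> 0"
  proof
    assume "?u = 0"
    hence "b = x" using x_nonzero by (simp add: field_simps)
    thus False using b xR by simp
  qed
  have uR: "?u \<in> R" by (intro diffR oneR multR invxR b)
  have uu: "?u ^ k * inverse ?u ^ k = 1" for k
    unfolding power_mult_distrib[symmetric] using u0 by simp
  define S where "S = {a * inverse ?u ^ k | a k. a \<in> R}"
  have SI: "a * inverse ?u ^ k \<in> S" if "a \<in> R" for a k unfolding S_def using that by blast
  have RS: "R \<subseteq> S"
  proof
    fix a assume "a \<in> R"
    thus "a \<in> S" using SI[of a 0] by simp
  qed
  have nx: "x * ?u ^ k \<notin> R" for k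
  proof (induction k)
    case 0
    show ?case using xR by simp
  next
    case (Suc k)
    show ?case
    proof
      assume H: "x * ?u ^ Suc k \<in> R"
      have "x * ?u ^ k = x * ?u ^ Suc k + b * ?u ^ k" using x_nonzero by (simp add: field_simps)
      also have "\<dots> \<in> R" by (intro addR H multR b powerR uR)
      finally show False using Suc by simp
    qed
  qed
  have "S = R"
  proof (rule maxR[OF RS])
    fix c e assume "c \<in> S" "e \<in> S"
    then obtain c' k e' l where ce: "c = c' * inverse ?u ^ k" "e = e' * inverse ?u ^ l" "c' \<in> R" "e' \<in> R"
      unfolding S_def by blast
    have "(c' * ?u ^ l + e' * ?u ^ k) * inverse ?u ^ (k + l)
        = c' * inverse ?u ^ k * (?u ^ l * inverse ?u ^ l) + e' * inverse ?u ^ l * (?u ^ k * inverse ?u ^ k)"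
      unfolding power_add distrib_right by (simp only: ac_simps)
    hence ce1: "c + e = (c' * ?u ^ l + e' * ?u ^ k) * inverse ?u ^ (k + l)"
      unfolding uu ce by simp
    show "c + e \<in> S" unfolding ce1 by (intro SI addR multR powerR uR ce)
    have ce2: "c * e = (c' * e') * inverse ?u ^ (k + l)" unfolding ce power_add by (simp only: ac_simps)
    show "c * e \<in> S" unfolding ce2 by (intro SI multR ce)
  next
    show "x \<notin> S"
    proof
      assume "x \<in> S"
      then obtain a k where xa: "x = a * inverse ?u ^ k" and "a \<in> R" unfolding S_def by blast
      have "a * inverse ?u ^ k * ?u ^ k = a * (?u ^ k * inverse ?u ^ k)" by (simp only: ac_simps)
      hence "x * ?u ^ k = a" unfolding uu xa[symmetric] by simp
      thus False using nx[of k] \<open>a \<in> R\<close> by simp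
    qed
  qed
  moreover have "inverse ?u \<in> S" using SI[OF oneR, of 1] by simp
  ultimately show "inverse ?u \<in> R" by simp
qed

text \<open>By maximality the ring generated by \<open>R\<close> and \<open>y\<close> contains
  \<open>x\<close>.\<close>

lemma poly_in_adjoin:
  assumes y: "y \<notin> R"
  shows "\<exists>P. (\<forall>i. poly.coeff P i \<in> R) \<and> poly P y = x"
proof -
  define S where "S = {poly P y | P. \<forall>i. poly.coeff P i \<in> R}"
  have RS: "R \<subseteq> S"
  proof
    fix a assume "a \<in> R"
    thus "a \<in> S" unfolding S_def
      by (intro CollectI exI[of _ "[:a:]"]) (auto simp: coeff_pCons zeroR split: nat.splits)
  qed
  have yS: "y \<in> S" unfolding S_def
    by (intro CollectI exI[of _ "[:0, 1:]"]) (auto simp: coeff_pCons zeroR oneR split: nat.splits)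
  have "x \<in> S"
  proof (rule ccontr)
    assume "x \<notin> S"
    have "S = R"
    proof (rule maxR[OF RS _ _ \<open>x \<notin> S\<close>])
      fix c e assume "c \<in> S" "e \<in> S"
      then obtain P Q where PQ: "c = poly P y" "e = poly Q y" "\<forall>i. poly.coeff P i \<in> R" "\<forall>i. poly.coeff Q i \<in> R"
        unfolding S_def by blast
      show "c + e \<in> S" unfolding S_def
        by (intro CollectI exI[of _ "P + Q"]) (use PQ in \<open>auto intro: addR\<close>)
      show "c * e \<in> S" unfolding S_def
        by (intro CollectI exI[of _ "P * Q"]) (use PQ in \<open>auto simp: coeff_mult intro!: sumR multR\<close>)
    qed
    thus False using y yS by simp
  qed
  thus ?thesis unfolding S_def by blast
qed

text \<open>Divided by \<open>x\<close> and a unit, the relation \<open>Q (1 / y) = x\<close>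
  becomes an expression of \<open>1\<close> by negative powers of \<open>y\<close> up to the degree
  of \<open>Q\<close>. Multiplied by \<open>y\<^sup>n\<close> it rewrites the leading term of
  \<open>P\<close> by lower ones.\<close>

lemma reduce_degree:
  assumes y: "y \<noteq> 0" and P: "\<forall>i. poly.coeff P i \<in> R" "poly P y = x"
    and Q: "\<forall>i. poly.coeff Q i \<in> R" "poly Q (inverse y) = x"
    and le: "degree Q \<le> degree P"
  shows "\<exists>P'. degree P' < degree P \<and> (\<forall>i. poly.coeff P' i \<in> R) \<and> poly P' y = x"
proof -
  define n m where "n = degree P" and "m = degree Q"
  have mn: "m \<le> n" using le by (simp add: n_def m_def)
  have n0: "n > 0"
  proof (rule ccontr)
    assume "\<not> n > 0"
    then obtain a where "P = [:a:]" using degree_eq_zeroE[of P] by (auto simp: n_def)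
    hence "x = poly.coeff P 0" using P(2) by simp
    thus False using P(1) xR by metis
  qed
  define u where "u = inverse (1 - inverse x * poly.coeff Q 0)"
  have uR: "u \<in> R" and u0: "1 - inverse x * poly.coeff Q 0 \<noteq> 0"
    using unit_1_minus[of "poly.coeff Q 0"] Q(1) by (auto simp: u_def)
  define c where "c = (\<lambda>j. u * inverse x * poly.coeff Q j)"
  have cR: "c j \<in> R" for j unfolding c_def by (intro multR uR invxR) (use Q in auto)
  have "x = (\<Sum>j\<le>m. poly.coeff Q j * inverse y ^ j)" using Q(2) by (simp add: poly_altdef m_def)
  also have "\<dots> = poly.coeff Q 0 + (\<Sum>j=1..m. poly.coeff Q j * inverse y ^ j)"
    by (subst atMost_atLeast0, subst sum.atLeast_Suc_atMost) auto
  finally have "x - poly.coeff Q 0 = (\<Sum>j=1..m. poly.coeff Q j * inverse y ^ j)" by simp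
  hence "1 - inverse x * poly.coeff Q 0 = inverse x * (\<Sum>j=1..m. poly.coeff Q j * inverse y ^ j)"
    using x_nonzero by (simp add: field_simps)
  moreover have "1 = u * (1 - inverse x * poly.coeff Q 0)" using u0 by (simp add: u_def)
  ultimately have "1 = u * (inverse x * (\<Sum>j=1..m. poly.coeff Q j * inverse y ^ j))" by metis
  hence one: "1 = (\<Sum>j=1..m. c j * inverse y ^ j)" by (simp add: c_def sum_distrib_left mult.assoc)
  define S where "S = (\<Sum>j=1..m. monom (c j) (n - j))"
  have "poly S y = (\<Sum>j=1..m. c j * y ^ (n - j))" by (simp add: S_def poly_sum poly_monom)
  also have "\<dots> = (\<Sum>j=1..m. y ^ n * (c j * inverse y ^ j))"
    by (rule sum.cong) (use mn y in \<open>auto simp: power_diff field_simps\<close>)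
  also have "\<dots> = y ^ n" unfolding sum_distrib_left[symmetric] one[symmetric] by simp
  finally have S: "poly S y = y ^ n" .
  have SR: "poly.coeff S i \<in> R" for i
    unfolding S_def coeff_sum by (intro sumR) (auto simp: cR zeroR)
  have Sn: "poly.coeff S i = 0" if "i \<ge> n" for i
    unfolding S_def coeff_sum using that mn by (intro sum.neutral) auto
  \<comment> \<open>the leading term of \<open>P\<close> is replaced by a combination of lower
    powers with the same value at \<open>y\<close>\<close>
  define P' where "P' = P - monom (poly.coeff P n) n + smult (poly.coeff P n) S"
  have "degree P' < n"
    by (rule degree_lessI) (use n0 Sn in \<open>auto simp: P'_def n_def coeff_eq_0\<close>)
  moreover have "poly.coeff P' i \<in> R" for i
    unfolding P'_def using P(1) SR by (auto intro!: addR diffR multR zeroR)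
  moreover have "poly P' y = x" using P(2) by (simp add: P'_def poly_monom S)
  ultimately show ?thesis unfolding n_def by blast
qed

text \<open>If neither \<open>y\<close> nor \<open>1 / y\<close> lies in \<open>R\<close>, then
  \<open>x\<close> is a polynomial in each of them over \<open>R\<close>. For polynomials of minimal
  degree, the one of larger degree could still be reduced.\<close>

lemma valuation_ring:
  assumes y: "y \<noteq> 0" shows "y \<in> R \<or> inverse y \<in> R"
proof (rule ccontr)
  assume H: "\<not> ?thesis"
  let ?A = "\<lambda>y P. (\<forall>i. poly.coeff P i \<in> R) \<and> poly P y = x"
  have ex: "\<exists>P. ?A y P" "\<exists>Q. ?A (inverse y) Q" using H poly_in_adjoin by auto
  obtain P where P: "?A y P" "\<And>P'. ?A y P' \<Longrightarrow> degree P \<le> degree P'"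
    using ex_has_least_nat[of "?A y" _ degree] ex(1) by blast
  obtain Q where Q: "?A (inverse y) Q" "\<And>Q'. ?A (inverse y) Q' \<Longrightarrow> degree Q \<le> degree Q'"
    using ex_has_least_nat[of "?A (inverse y)" _ degree] ex(2) by blast
  show False
  proof (cases "degree Q \<le> degree P")
    case True
    thus False using reduce_degree[OF y, of P Q] P Q by (meson not_le)
  next
    case False
    thus False using reduce_degree[of "inverse y" Q P] y P Q by (metis inverse_inverse_eq inverse_nonzero_iff_nonzero nat_le_linear not_le)
  qed
qed

text \<open>Otherwise \<open>1 / z\<close> lies in \<open>R\<close>, and the equation divided by
  \<open>z\<^sup>n\<^sup>-\<^sup>1\<close> expresses \<open>z\<close> by powers of \<open>1 /
  z\<close>.\<close>

lemma integrally_closed: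
  assumes n: "n > 0" and eq: "z ^ n = (\<Sum>i<n. c i * z ^ i)" and c: "\<And>i. i < n \<Longrightarrow> c i \<in> R"
  shows "z \<in> R"
proof (rule ccontr)
  assume H: "z \<notin> R"
  hence z0: "z \<noteq> 0" using zeroR by auto
  let ?t = "inverse z"
  have t: "?t \<in> R" using valuation_ring[OF z0] H by blast
  have "z = z ^ n * ?t ^ (n - 1)" using n z0
    by (cases n) (simp_all add: power_inverse)
  also have "\<dots> = (\<Sum>i<n. c i * (z ^ i * ?t ^ (n - 1)))"
    unfolding eq by (simp add: sum_distrib_right mult.assoc)
  also have "\<dots> = (\<Sum>i<n. c i * ?t ^ (n - 1 - i))"
  proof (rule sum.cong[OF refl])
    fix i assume "i \<in> {..<n}"
    hence "n - 1 = i + (n - 1 - i)" by simp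
    hence "?t ^ (n - 1) = ?t ^ i * ?t ^ (n - 1 - i)" by (metis power_add)
    thus "c i * (z ^ i * ?t ^ (n - 1)) = c i * ?t ^ (n - 1 - i)"
      using z0 by (simp add: power_inverse)
  qed
  also have "\<dots> \<in> R" by (intro sumR multR powerR t c) auto
  finally show False using H by simp
qed

lemma not_all_rational: "\<exists>q. of_rat q \<notin> R"
proof (rule ccontr)
  assume H: "\<nexists>q. of_rat q \<notin> R"
  obtain n r where n: "n > 0" "x ^ n = (\<Sum>i<n. of_rat (r i) * x ^ i)" using alg[of x] by blast
  have "x \<in> R" by (rule integrally_closed[OF n]) (use H in blast)
  thus False using xR by simp
qed

lemma p_pos: "real p > 1" using prime_gt_1_nat[OF p] by simp

lemma padic_abs_p_power: "padic_abs p (of_nat p ^ N) = 1 / real p ^ N"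
  using absval_power[of "padic_abs p" "of_nat p" N] nontrivial_padic_abs[OF p]
  by (simp add: nontrivial_def padic_abs_p[OF p] power_divide)

lemma pR: "of_nat p ^ N \<in> R"
  using intR[of "int p ^ N"] by simp

text \<open>If \<open>1 / p\<close> lay in \<open>R\<close>, so would all rational numbers, and then
  \<open>x\<close>, which is algebraic, by integral closedness.\<close>

lemma inverse_p_notin: "inverse (of_nat p) \<notin> R"
proof
  assume H: "inverse (of_nat p) \<in> R"
  have "of_rat q \<in> R" for q
  proof -
    obtain N where N: "padic_abs p q < real p ^ N" using real_arch_pow[OF p_pos] by blast
    have "padic_abs p (q * of_nat p ^ N) \<le> 1"
      using N p_pos by (simp add: padic_abs_mult[OF p] padic_abs_p_power field_simps)
    hence "of_rat (q * of_nat p ^ N) * inverse (of_nat p) ^ N \<in> R" by (intro multR powerR H ratR)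
    moreover have "of_rat (q * of_nat p ^ N) * inverse (of_nat p) ^ N = (of_rat q :: 'a)"
      using p_pos by (simp add: of_rat_mult of_rat_power power_inverse)
    ultimately show ?thesis by simp
  qed
  thus False using not_all_rational by blast
qed

text \<open>A power of \<open>p\<close> that clears the coefficients of a monic equation of
  \<open>y\<close> makes \<open>y\<close> integral over \<open>R\<close>.\<close>

lemma p_power_mult_mem: "\<exists>N. of_nat p ^ N * y \<in> R"
proof -
  obtain n r where n: "n > 0" "y ^ n = (\<Sum>i<n. of_rat (r i) * y ^ i)" using alg[of y] by blast
  define K where "K = (\<Sum>i<n. padic_abs p (r i))"
  obtain N where N: "K < real p ^ N" using real_arch_pow[OF p_pos] by blast
  have rN: "padic_abs p (of_nat p ^ (N * (n - i)) * r i) \<le> 1" if i: "i < n" for i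
  proof -
    have "padic_abs p (r i) \<le> K" unfolding K_def using i padic_abs_nonneg[OF p] by (intro member_le_sum) auto
    also have "\<dots> \<le> real p ^ N" using N by simp
    also have "\<dots> \<le> real p ^ (N * (n - i))" using p_pos i by (intro power_increasing) auto
    finally show ?thesis using p_pos
      by (simp add: padic_abs_mult[OF p] padic_abs_p_power field_simps)
  qed
  have "of_nat p ^ N * y \<in> R"
  proof (rule integrally_closed[OF n(1)])
    show "(of_nat p ^ N * y) ^ n = (\<Sum>i<n. of_rat (of_nat p ^ (N * (n - i)) * r i) * (of_nat p ^ N * y) ^ i)"
    proof -
      have "(of_nat p ^ N * y) ^ n = (\<Sum>i<n. of_nat p ^ (N * n) * (of_rat (r i) * y ^ i))"
        by (simp add: power_mult_distrib power_mult[symmetric] n(2) sum_distrib_left)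
      also have "\<dots> = (\<Sum>i<n. of_rat (of_nat p ^ (N * (n - i)) * r i) * (of_nat p ^ N * y) ^ i)"
      proof (rule sum.cong[OF refl])
        fix i assume "i \<in> {..<n}"
        hence "N * n = N * (n - i) + N * i" by (simp add: diff_mult_distrib2)
        thus "of_nat p ^ (N * n) * (of_rat (r i) * y ^ i)
          = of_rat (of_nat p ^ (N * (n - i)) * r i) * (of_nat p ^ N * y) ^ i"
          by (simp add: of_rat_mult of_rat_power power_mult_distrib power_mult[symmetric] power_add)
      qed
      finally show ?thesis .
    qed
  qed (use ratR rN in auto)
  thus ?thesis by blast
qed

lemma p_powi_mem_iff: "of_nat p powi a \<in> R \<longleftrightarrow> a \<ge> 0"
proof
  assume H: "of_nat p powi a \<in> R"
  show "a \<ge> 0"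
  proof (rule ccontr)
    assume "\<not> a \<ge> 0"
    then obtain k where k: "a = - int (Suc k)" by (metis add.commute int_Suc linorder_not_le negD)
    have "of_nat p ^ k * of_nat p powi a \<in> R" by (intro multR pR H)
    moreover have "of_nat p ^ k * of_nat p powi a = inverse (of_nat p :: 'a)"
      using p_pos by (simp add: k power_int_minus power_int_of_nat del: of_nat_Suc)
    ultimately show False using inverse_p_notin by simp
  qed
next
  assume "a \<ge> 0"
  thus "of_nat p powi a \<in> R" using pR[of "nat a"] by (simp add: power_int_def)
qed

section \<open>The absolute value of a valuation ring\<close>

text \<open>The absolute value with unit ball \<open>R\<close> that is \<open>1 / p\<close> at
  \<open>p\<close> has to satisfy \<open>|y| \<le> p\<^sup>r\<close>, with \<open>r = a / b\<close>,
  if and only if \<open>p\<^sup>a y\<^sup>b \<in> R\<close>. So these \<open>r\<close> are the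
  rational upper bounds of the logarithm of \<open>|y|\<close> to the base \<open>p\<close>.\<close>

definition exponents :: "'a \<Rightarrow> real set" where
  "exponents y = {real_of_int a / real b | a b. b > 0 \<and> of_nat p powi a * y ^ b \<in> R}"

definition log_val :: "'a \<Rightarrow> real" where
  "log_val y = Inf (exponents y)"

definition val :: "'a \<Rightarrow> real" where
  "val y = (if y = 0 then 0 else real p powr log_val y)"

lemma p_nonzero: "of_nat p \<noteq> (0::'a)"
  using p_pos by auto

lemma exponentsI: "b > 0 \<Longrightarrow> of_nat p powi a * y ^ b \<in> R \<Longrightarrow> real_of_int a / real b \<in> exponents y"
  unfolding exponents_def by blast

lemma exponents_nonempty: "exponents y \<noteq> {}"
proof -
  obtain N where "of_nat p ^ N * y \<in> R" using p_power_mult_mem by blast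
  hence "real_of_int (int N) / real 1 \<in> exponents y" by (intro exponentsI) auto
  thus ?thesis by blast
qed

lemma exponents_bdd_below:
  assumes y: "y \<noteq> 0" shows "bdd_below (exponents y)"
proof -
  obtain N where N: "of_nat p ^ N * inverse y \<in> R" using p_power_mult_mem by blast
  have "- real N \<le> r" if r: "r \<in> exponents y" for r
  proof -
    obtain a b where ab: "r = real_of_int a / real b" "b > 0" "of_nat p powi a * y ^ b \<in> R"
      using r unfolding exponents_def by blast
    have "of_nat p powi a * y ^ b * (of_nat p ^ N * inverse y) ^ b \<in> R" by (intro multR ab powerR N)
    moreover have "of_nat p powi a * y ^ b * (of_nat p ^ N * inverse y) ^ b = of_nat p powi a * of_nat p ^ (N * b) * (y ^ b * inverse y ^ b)"
      by (simp only: power_mult_distrib power_mult[symmetric] ac_simps)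
    moreover have "y ^ b * inverse y ^ b = 1" using y by (simp add: power_mult_distrib[symmetric])
    moreover have "of_nat p powi a * of_nat p ^ (N * b) = (of_nat p powi (a + int (N * b)) :: 'a)"
      using p_nonzero by (simp add: power_int_add power_int_of_nat del: of_nat_mult)
    ultimately have "of_nat p powi (a + int (N * b)) \<in> R" by simp
    hence "0 \<le> a + int (N * b)" by (simp only: p_powi_mem_iff)
    hence "0 \<le> real_of_int (a + int (N * b))" by (simp only: of_int_0_le_iff)
    hence "- real N * real b \<le> real_of_int a" by simp
    thus ?thesis unfolding ab(1) using ab(2) by (subst pos_le_divide_eq) auto
  qed
  thus ?thesis by (intro bdd_belowI)
qed

lemma log_val_le: "y \<noteq> 0 \<Longrightarrow> r \<in> exponents y \<Longrightarrow> log_val y \<le> r"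
  unfolding log_val_def by (intro cInf_lower exponents_bdd_below)

lemma log_val_greatest: "(\<And>r. r \<in> exponents y \<Longrightarrow> c \<le> r) \<Longrightarrow> c \<le> log_val y"
  unfolding log_val_def by (intro cInf_greatest exponents_nonempty)

lemma exponents_mult:
  assumes "r \<in> exponents y" "s \<in> exponents z" shows "r + s \<in> exponents (y * z)"
proof -
  obtain a b where ab: "r = real_of_int a / real b" "b > 0" "of_nat p powi a * y ^ b \<in> R"
    using assms(1) unfolding exponents_def by blast
  obtain c e where ce: "s = real_of_int c / real e" "e > 0" "of_nat p powi c * z ^ e \<in> R"
    using assms(2) unfolding exponents_def by blast
  have "(of_nat p powi a * y ^ b) ^ e * (of_nat p powi c * z ^ e) ^ b \<in> R" by (intro multR powerR ab ce)
  moreover have "(of_nat p powi a) ^ e * (of_nat p powi c) ^ b = (of_nat p powi (a * int e + c * int b) :: 'a)"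
    using p_nonzero by (simp add: power_int_add power_int_mult power_int_of_nat)
  hence "of_nat p powi (a * int e + c * int b) * (y * z) ^ (b * e) = (of_nat p powi a * y ^ b) ^ e * (of_nat p powi c * z ^ e) ^ b"
    by (simp add: power_mult_distrib power_mult[symmetric] mult.commute[of e b] ac_simps)
  ultimately have "real_of_int (a * int e + c * int b) / real (b * e) \<in> exponents (y * z)"
    using ab ce by (intro exponentsI) auto
  moreover have "real_of_int (a * int e + c * int b) / real (b * e) = r + s"
    using ab ce by (simp add: field_simps)
  ultimately show ?thesis by simp
qed

lemma log_val_mult_le:
  assumes "y \<noteq> 0" "z \<noteq> 0" shows "log_val (y * z) \<le> log_val y + log_val z"
proof -
  have yz: "y * z \<noteq> 0" using assms by simp
  have "log_val (y * z) - s \<le> log_val y" if s: "s \<in> exponents z" for s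
  proof (rule log_val_greatest)
    fix r assume "r \<in> exponents y"
    hence "log_val (y * z) \<le> r + s" by (intro log_val_le[OF yz] exponents_mult s)
    thus "log_val (y * z) - s \<le> r" by simp
  qed
  hence "log_val (y * z) - log_val y \<le> log_val z"
    by (intro log_val_greatest) (simp add: algebra_simps)
  thus ?thesis by simp
qed

lemma log_val_R: "y \<in> R \<Longrightarrow> y \<noteq> 0 \<Longrightarrow> log_val y \<le> 0"
  using log_val_le[of y 0] exponentsI[of 1 0 y] by simp

text \<open>For every fraction \<open>a / b\<close>, one of \<open>p\<^sup>-\<^sup>a
  y\<^sup>b\<close> and its inverse lies in the valuation ring \<open>R\<close>; so every rational
  number is an exponent of \<open>1 / y\<close> or the negative of an exponent of
  \<open>y\<close>.\<close>

lemma log_val_inverse: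
  assumes y: "y \<noteq> 0" shows "log_val (inverse y) = - log_val y"
proof (rule antisym)
  show "log_val (inverse y) \<le> - log_val y"
  proof (rule ccontr)
    assume "\<not> ?thesis"
    hence "- log_val y < log_val (inverse y)" by simp
    then obtain q where q: "- log_val y < real_of_rat q" "real_of_rat q < log_val (inverse y)"
      using of_rat_dense by blast
    obtain a b where ab: "quotient_of q = (a, b)" by fastforce
    have b: "b > 0" by (rule quotient_of_denom_pos[OF ab])
    have rq: "real_of_rat q = real_of_int a / real (nat b)"
      using quotient_of_div[OF ab] b by (simp add: of_rat_divide)
    have "real_of_int (- a) / real (nat b) \<notin> exponents y"
      using log_val_le[OF y, of "real_of_int (- a) / real (nat b)"] q rq by auto
    hence "of_nat p powi (- a) * y ^ nat b \<notin> R" using exponentsI[of "nat b" "-a" y] b by auto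
    hence "inverse (of_nat p powi (- a) * y ^ nat b) \<in> R"
      using valuation_ring[of "of_nat p powi (- a) * y ^ nat b"] y p_nonzero by auto
    moreover have "inverse (of_nat p powi (- a) * y ^ nat b) = of_nat p powi a * inverse y ^ nat b"
      by (simp add: power_int_minus power_inverse)
    ultimately have "real_of_int a / real (nat b) \<in> exponents (inverse y)"
      using b by (intro exponentsI) auto
    hence "log_val (inverse y) \<le> real_of_rat q" using log_val_le[of "inverse y"] y rq by simp
    thus False using q by simp
  qed
  have "0 \<le> log_val 1"
  proof (rule log_val_greatest)
    fix r assume "r \<in> exponents 1"
    then obtain a b where "r = real_of_int a / real b" "b > 0" "of_nat p powi a \<in> R"
      unfolding exponents_def by auto
    thus "0 \<le> r" by (simp add: p_powi_mem_iff)
  qed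
  also have "log_val 1 \<le> log_val y + log_val (inverse y)"
    using log_val_mult_le[of y "inverse y"] y by simp
  finally show "- log_val y \<le> log_val (inverse y)" by simp
qed

lemma log_val_mult:
  assumes y: "y \<noteq> 0" and z: "z \<noteq> 0" shows "log_val (y * z) = log_val y + log_val z"
proof -
  have "log_val y \<le> log_val (y * z) + log_val (inverse z)"
    using log_val_mult_le[of "y * z" "inverse z"] y z by (simp add: mult.assoc)
  thus ?thesis using log_val_mult_le[OF y z] log_val_inverse[OF z] by simp
qed

lemma val_pos: "y \<noteq> 0 \<Longrightarrow> val y > 0"
  using p_pos by (simp add: val_def)

lemma val_mult: "val (y * z) = val y * val z"
  by (simp add: val_def log_val_mult powr_add)

lemma val_R: "y \<in> R \<Longrightarrow> val y \<le> 1"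
  using log_val_R[of y] p_pos powr_mono[of "log_val y" 0 "real p"] by (auto simp: val_def)

lemma val_1_plus: "val (1 + z) \<le> max 1 (val z)"
proof (cases "z \<in> R")
  case True
  thus ?thesis using val_R[OF addR[OF oneR True]] by simp
next
  case False
  hence z: "z \<noteq> 0" using zeroR by auto
  hence "inverse z \<in> R" using valuation_ring[OF z] False by blast
  hence "val (1 + inverse z) \<le> 1" by (intro val_R addR oneR)
  hence "val z * val (1 + inverse z) \<le> val z * 1" using val_pos[OF z] by (intro mult_left_mono) auto
  moreover have "z * (1 + inverse z) = 1 + z" using z by (simp add: field_simps)
  ultimately show ?thesis by (simp add: val_mult[symmetric])
qed

lemma val_absolute_value: "absolute_value val"
proof -
  have nn: "val y \<ge> 0" for y using val_pos[of y] by (cases "y = 0") (auto simp: val_def)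
  have "val (y + z) \<le> val y + val z" for y z
  proof (cases "y = 0")
    case True
    thus ?thesis by (simp add: val_def)
  next
    case False
    have "val (y + z) = val y * val (1 + z / y)"
      unfolding val_mult[symmetric] using False by (simp add: distrib_left)
    also have "\<dots> \<le> val y * max 1 (val (z / y))" using nn val_1_plus by (intro mult_left_mono)
    also have "\<dots> \<le> val y * (1 + val (z / y))" using nn by (intro mult_left_mono) (auto simp: max_def)
    also have "\<dots> = val y + val (y * (z / y))" by (simp only: val_mult distrib_left mult_1_right)
    finally show ?thesis using False by simp
  qed
  moreover have "val y = 0 \<longleftrightarrow> y = 0" for y using val_pos[of y] by (auto simp: val_def)
  ultimately show ?thesis unfolding absolute_value_def using nn val_mult by blast
qed

lemma val_p: "val (of_nat p) = 1 / real p"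
proof -
  have "log_val (of_nat p) = -1"
  proof (rule antisym)
    have "of_nat p powi (-1) * of_nat p ^ 1 \<in> R" using oneR p_nonzero by (simp add: power_int_minus)
    hence "real_of_int (-1) / real 1 \<in> exponents (of_nat p)" by (intro exponentsI) auto
    thus "log_val (of_nat p) \<le> -1" using log_val_le[OF p_nonzero] by auto
    show "-1 \<le> log_val (of_nat p)"
    proof (rule log_val_greatest)
      fix r assume "r \<in> exponents (of_nat p)"
      then obtain a b where ab: "r = real_of_int a / real b" "b > 0" "of_nat p powi a * of_nat p ^ b \<in> R"
        unfolding exponents_def by blast
      have "of_nat p powi a * of_nat p ^ b = (of_nat p powi (a + int b) :: 'a)"
        using p_nonzero by (simp add: power_int_add power_int_of_nat)
      hence "0 \<le> a + int b" using ab(3) p_powi_mem_iff by simp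
      hence "- 1 * real b \<le> real_of_int a" by linarith
      thus "-1 \<le> r" unfolding ab(1) using ab(2) by (subst pos_le_divide_eq) auto
    qed
  qed
  thus ?thesis using p_pos p_nonzero by (simp add: val_def powr_minus divide_inverse)
qed

text \<open>A rational number is a power of \<open>p\<close> times a unit of
  \<open>R\<close>.\<close>

lemma val_of_rat: "val (of_rat q) = padic_abs p q"
proof (cases "q = 0")
  case False
  obtain k :: int where k: "padic_abs p q = real p powi k" using padic_abs_discrete[OF p False] by blast
  have aw: "absolute_value (padic_abs p)" using nontrivial_padic_abs[OF p] by (simp add: nontrivial_def)
  define r where "r = q * of_nat p powi k"
  have pw: "padic_abs p (of_nat p powi k) = real p powi (- k)"
    using p_pos by (simp add: absval_powi[OF aw] padic_abs_p[OF p] power_int_minus power_int_inverse divide_inverse)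
  have w: "padic_abs p r = 1"
    using p_pos by (simp add: r_def padic_abs_mult[OF p] k pw power_int_minus)
  have r0: "r \<noteq> 0" using w padic_abs_0 by auto
  have "of_rat r \<in> R" using w by (intro ratR) simp
  moreover have "of_rat (inverse r) \<in> R" using w by (intro ratR) (simp add: padic_abs_inverse[OF p])
  ultimately have "val (of_rat r) \<le> 1" "val (inverse (of_rat r)) \<le> 1" by (auto simp: val_R of_rat_inverse)
  moreover have pr: "0 < val (of_rat r)" using r0 by (intro val_pos) simp
  ultimately have vr: "val (of_rat r) = 1"
    by (simp add: absval_inverse[OF val_absolute_value] inverse_le_1_iff)
  have "(of_rat r :: 'a) = of_rat q * of_nat p powi k"
    by (simp add: r_def of_rat_mult power_int_def of_rat_power of_rat_inverse)
  hence "1 = val (of_rat q) * val (of_nat p powi k)" using vr by (simp add: val_mult)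
  hence "1 = val (of_rat q) * real p powi (- k)"
    by (simp add: absval_powi[OF val_absolute_value] val_p power_int_inverse power_int_minus divide_inverse)
  hence "val (of_rat q) = real p powi k" using p_pos by (simp add: power_int_minus field_simps)
  thus ?thesis using k by simp
qed (simp add: val_def padic_abs_0)

lemma val_extension: "val \<in> extensions (padic_abs p)"
  unfolding extensions_def using val_absolute_value val_of_rat by simp

lemma x_primitive_relation:
  "\<exists>n q. (\<Sum>i\<le>n. of_rat (q i) * x ^ i) = 0 \<and> (\<forall>i\<le>n. padic_abs p (q i) \<le> 1) \<and> (\<exists>i\<le>n. padic_abs p (q i) = 1)"
proof -
  have aw: "absolute_value (padic_abs p)" using nontrivial_padic_abs[OF p] by (simp add: nontrivial_def)
  obtain n r where n: "n > 0" "x ^ n = (\<Sum>i<n. of_rat (r i) * x ^ i)" using alg[of x] by blast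
  define q where "q = (\<lambda>i. if i = n then - 1 else r i)"
  have s: "(\<Sum>i\<le>n. of_rat (q i) * x ^ i) = 0"
    by (simp add: lessThan_Suc_atMost[symmetric] q_def n(2) of_rat_minus)
  define m where "m = Max ((\<lambda>i. padic_abs p (q i)) ` {..n})"
  have le: "padic_abs p (q i) \<le> m" if "i \<le> n" for i unfolding m_def using that by (intro Max_ge) auto
  have "m \<in> (\<lambda>i. padic_abs p (q i)) ` {..n}" unfolding m_def by (rule Max_in) auto
  then obtain j where j: "j \<le> n" "padic_abs p (q j) = m" by auto
  have "padic_abs p (q n) = 1" by (simp add: q_def absval_minus[OF aw] absval_1[OF aw])
  hence "m \<ge> 1" using le[of n] by simp
  hence qj: "q j \<noteq> 0" using j padic_abs_0[of p] by auto
  define q' where "q' = (\<lambda>i. q i / q j)"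
  have "(\<Sum>i\<le>n. of_rat (q' i) * x ^ i) = inverse (of_rat (q j)) * (\<Sum>i\<le>n. of_rat (q i) * x ^ i)"
    by (simp add: q'_def sum_distrib_left divide_inverse of_rat_mult of_rat_inverse ac_simps)
  moreover have "\<forall>i\<le>n. padic_abs p (q' i) \<le> 1"
    using le j \<open>m \<ge> 1\<close> by (auto simp: q'_def absval_divide[OF aw])
  moreover have "padic_abs p (q' j) = 1" using qj by (simp add: q'_def padic_abs_1[OF p])
  ultimately show ?thesis using s j(1) by (intro exI[of _ n] exI[of _ q']) auto
qed

lemma padic_abs_less_1:
  assumes "padic_abs p q < 1" shows "padic_abs p (q / of_nat p) \<le> 1"
proof (cases "q = 0")
  case False
  obtain k :: int where k: "padic_abs p q = real p powi k" using padic_abs_discrete[OF p False] by blast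
  have aw: "absolute_value (padic_abs p)" using nontrivial_padic_abs[OF p] by (simp add: nontrivial_def)
  have "k < 0"
  proof (rule ccontr)
    assume "\<not> k < 0"
    hence "1 \<le> real p powi k" using p_pos by (simp add: power_int_def)
    thus False using k assms by simp
  qed
  have "padic_abs p (q / of_nat p) = real p powi (k + 1)"
    using p_pos by (simp add: absval_divide[OF aw] padic_abs_p[OF p] k power_int_add)
  also have "\<dots> \<le> real p powi 0" using p_pos \<open>k < 0\<close> by (intro power_int_increasing) auto
  finally show ?thesis by simp
qed (simp add: padic_abs_0)

text \<open>It suffices that \<open>p\<^sup>-\<^sup>1 x\<^sup>-\<^sup>b\<close> lies in
  \<open>R\<close> for some \<open>b\<close>. Otherwise all \<open>p x\<^sup>b\<close> lie in
  \<open>R\<close>. A relation of \<open>x\<close> with p-integral coefficients is then multiplied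
  by \<open>x\<^sup>1\<^sup>-\<^sup>m\<close>, where \<open>m\<close> is the last index of a
  coefficient prime to \<open>p\<close>. The terms below \<open>m\<close> contain powers of \<open>1
  / x\<close>, those above \<open>m\<close> have coefficients divisible by \<open>p\<close>, and so
  the remaining term shows \<open>x \<in> R\<close>.\<close>

lemma val_x: "1 < val x"
proof -
  let ?t = "inverse x"
  have "\<exists>b. inverse (of_nat p) * ?t ^ b \<in> R"
  proof (rule ccontr)
    assume H: "\<not> ?thesis"
    have px: "of_nat p * x ^ b \<in> R" for b
    proof -
      have "inverse (inverse (of_nat p) * ?t ^ b) \<in> R"
        using H valuation_ring[of "inverse (of_nat p) * ?t ^ b"] p_nonzero x_nonzero by auto
      thus ?thesis by (simp add: power_inverse)
    qed
    obtain n q where nq: "(\<Sum>i\<le>n. of_rat (q i) * x ^ i) = 0" "\<And>i. i \<le> n \<Longrightarrow> padic_abs p (q i) \<le> 1"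
      "\<exists>i\<le>n. padic_abs p (q i) = 1" using x_primitive_relation by blast
    define m where "m = (GREATEST i. i \<le> n \<and> padic_abs p (q i) = 1)"
    have m: "m \<le> n \<and> padic_abs p (q m) = 1"
      unfolding m_def by (rule GreatestI_ex_nat[where b = n]) (use nq(3) in auto)
    have mg: "padic_abs p (q i) < 1" if "i \<le> n" "m < i" for i
    proof -
      have "padic_abs p (q i) \<noteq> 1"
      proof
        assume "padic_abs p (q i) = 1"
        hence "i \<le> m" unfolding m_def using that by (intro Greatest_le_nat[where b = n]) auto
        thus False using that by simp
      qed
      thus ?thesis using nq(2)[OF that(1)] by simp
    qed
    have tm: "of_rat (q i) * (x ^ i * (x * ?t ^ m)) \<in> R" if i: "i \<in> {..n} - {m}" for i
    proof (cases "i < m")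
      case True
      hence "m = i + (Suc (m - i - 1))" by simp
      hence "?t ^ m = ?t ^ i * (?t * ?t ^ (m - i - 1))" by (metis power_add power_Suc)
      hence "x ^ i * (x * ?t ^ m) = (x ^ i * ?t ^ i) * (x * ?t) * ?t ^ (m - i - 1)"
        by (simp only: ac_simps)
      also have "\<dots> = ?t ^ (m - i - 1)" using x_nonzero by (simp add: power_mult_distrib[symmetric])
      finally have "x ^ i * (x * ?t ^ m) = ?t ^ (m - i - 1)" .
      thus ?thesis using i nq(2)[of i] by (auto intro!: multR powerR invxR ratR)
    next
      case False
      hence mi: "m < i" "i \<le> n" using i by auto
      hence "i = m + (i - m)" by simp
      hence "x ^ i = x ^ m * x ^ (i - m)" by (metis power_add)
      hence "x ^ i * (x * ?t ^ m) = x ^ Suc (i - m)" using x_nonzero by (simp add: power_inverse)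
      hence "of_rat (q i) * (x ^ i * (x * ?t ^ m)) = of_rat (q i / of_nat p) * (of_nat p * x ^ Suc (i - m))"
        using p_nonzero by (simp add: of_rat_divide)
      also have "\<dots> \<in> R" by (rule multR[OF ratR px]) (rule padic_abs_less_1[OF mg[OF mi(2,1)]])
      finally show ?thesis .
    qed
    have "0 = (\<Sum>i\<le>n. of_rat (q i) * (x ^ i * (x * ?t ^ m)))"
      unfolding mult.assoc[symmetric] sum_distrib_right[symmetric] nq(1) by simp
    also have "\<dots> = of_rat (q m) * (x ^ m * (x * ?t ^ m)) + (\<Sum>i\<in>{..n} - {m}. of_rat (q i) * (x ^ i * (x * ?t ^ m)))"
      using m by (subst sum.remove[of _ m]) auto
    also have "x ^ m * (x * ?t ^ m) = x" using x_nonzero by (simp add: power_inverse)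
    finally have e: "of_rat (q m) * x = - (\<Sum>i\<in>{..n} - {m}. of_rat (q i) * (x ^ i * (x * ?t ^ m)))"
      by (simp add: eq_neg_iff_add_eq_0)
    have "of_rat (q m) * x \<in> R" unfolding e by (intro minusR sumR tm)
    moreover have "of_rat (inverse (q m)) \<in> R" using m by (intro ratR) (simp add: padic_abs_inverse[OF p])
    ultimately have "of_rat (inverse (q m)) * (of_rat (q m) * x) \<in> R" by (rule multR[rotated])
    moreover have "q m \<noteq> 0" using m padic_abs_0[of p] by auto
    hence "of_rat (inverse (q m)) * (of_rat (q m) * x) = x"
      unfolding mult.assoc[symmetric] of_rat_mult[symmetric] by simp
    ultimately have "x \<in> R" by (simp only:)
    thus False using xR by simp
  qed
  then obtain b where b: "inverse (of_nat p) * ?t ^ b \<in> R" by blast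
  have b0: "b > 0" using b inverse_p_notin by (cases b) auto
  have "real_of_int (-1) / real b \<in> exponents ?t"
    using b b0 by (intro exponentsI) (auto simp: power_int_minus)
  hence "log_val ?t \<le> - 1 / real b" using log_val_le[of ?t] x_nonzero by simp
  also have "\<dots> < 0" using b0 by simp
  finally have "0 < log_val x" using log_val_inverse[OF x_nonzero] by simp
  thus ?thesis using p_pos x_nonzero by (simp add: val_def)
qed

end

section \<open>Non-integral elements have a large absolute value\<close>

text \<open>The last assumption says that \<open>x\<close> is not a polynomial in \<open>1 /
  x\<close> with p-integral coefficients. These polynomials form a ring, which Zorn's lemma enlarges
  to a maximal subring without \<open>x\<close>.\<close>

lemma exists_extension_gt_1:
  fixes x :: "'a::field_char_0"
  assumes p: "prime p" and x: "x \<noteq> 0"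
    and alg: "\<And>y::'a. \<exists>n>0. \<exists>r. y ^ n = (\<Sum>i<n. of_rat (r i) * y ^ i)"
    and nx: "\<And>n c. x = (\<Sum>i\<le>n. of_rat (c i) * inverse x ^ i) \<Longrightarrow> \<exists>i\<le>n. padic_abs p (c i) > 1"
  shows "\<exists>v\<in>extensions (padic_abs p). 1 < v x"
proof -
  let ?t = "inverse x"
  let ?cl = "\<lambda>S::'a set. (\<forall>a b. a \<in> S \<longrightarrow> b \<in> S \<longrightarrow> a + b \<in> S) \<and> (\<forall>a b. a \<in> S \<longrightarrow> b \<in> S \<longrightarrow> a * b \<in> S)"
  define R0 where "R0 = {poly (map_poly of_rat P) ?t | P. \<forall>i. padic_abs p (poly.coeff P i) \<le> 1}"
  define F where "F = {S. R0 \<subseteq> S \<and> ?cl S \<and> x \<notin> S}"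
  have aw: "absolute_value (padic_abs p)" using nontrivial_padic_abs[OF p] by (simp add: nontrivial_def)
  have sum_le: "padic_abs p (\<Sum>i\<in>I. f i) \<le> 1" if "\<And>i. i \<in> I \<Longrightarrow> padic_abs p (f i) \<le> 1" for I and f :: "nat \<Rightarrow> rat"
    using that by (induction I rule: infinite_finite_induct) (auto simp: padic_abs_0 intro: padic_abs_add_le_1[OF p])
  interpret mp: map_poly_comm_ring_hom "of_rat :: rat \<Rightarrow> 'a" ..
  have cl0: "?cl R0"
  proof (intro conjI allI impI)
    fix a b assume "a \<in> R0" "b \<in> R0"
    then obtain P Q where PQ: "a = poly (map_poly of_rat P) ?t" "b = poly (map_poly of_rat Q) ?t"
      "\<forall>i. padic_abs p (poly.coeff P i) \<le> 1" "\<forall>i. padic_abs p (poly.coeff Q i) \<le> 1"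
      unfolding R0_def by blast
    have "a + b = poly (map_poly of_rat (P + Q)) ?t" using PQ by (simp add: mp.hom_add)
    moreover have "\<forall>i. padic_abs p (poly.coeff (P + Q) i) \<le> 1" using PQ by (auto intro: padic_abs_add_le_1[OF p])
    ultimately show "a + b \<in> R0" unfolding R0_def by blast
    have "a * b = poly (map_poly of_rat (P * Q)) ?t" using PQ by (simp add: mp.hom_mult)
    moreover have "\<forall>i. padic_abs p (poly.coeff (P * Q) i) \<le> 1"
      unfolding coeff_mult using PQ
      by (auto intro!: sum_le mult_le_one simp: padic_abs_mult[OF p] padic_abs_nonneg[OF p])
    ultimately show "a * b \<in> R0" unfolding R0_def by blast
  qed
  have "x \<notin> R0"
  proof
    assume "x \<in> R0"
    then obtain P where P: "x = poly (map_poly of_rat P) ?t" "\<forall>i. padic_abs p (poly.coeff P i) \<le> 1"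
      unfolding R0_def by blast
    have "x = (\<Sum>i\<le>degree P. of_rat (poly.coeff P i) * ?t ^ i)"
      using P(1) by (simp add: poly_altdef)
    hence "\<exists>i\<le>degree P. padic_abs p (poly.coeff P i) > 1" by (rule nx)
    thus False using P(2) by (meson not_le)
  qed
  hence R0F: "R0 \<in> F" unfolding F_def using cl0 by simp
  have "\<exists>M\<in>F. \<forall>X\<in>F. M \<subseteq> X \<longrightarrow> X = M"
  proof (rule subset_Zorn_nonempty)
    show "F \<noteq> {}" using R0F by blast
    fix C assume C: "C \<noteq> {}" "subset.chain F C"
    have CF: "S \<in> F" if "S \<in> C" for S using C that by (auto simp: subset.chain_def)
    have tot: "S \<subseteq> S' \<or> S' \<subseteq> S" if "S \<in> C" "S' \<in> C" for S S' using C that by (auto simp: subset.chain_def)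
    have two: "\<exists>S\<in>C. a \<in> S \<and> b \<in> S" if ab: "a \<in> \<Union>C" "b \<in> \<Union>C" for a b
    proof -
      obtain S S' where "S \<in> C" "a \<in> S" "S' \<in> C" "b \<in> S'" using ab by blast
      thus ?thesis using tot[of S S'] by blast
    qed
    have "?cl (\<Union>C)"
    proof (intro conjI allI impI)
      fix a b assume "a \<in> \<Union>C" "b \<in> \<Union>C"
      then obtain S where S: "S \<in> C" "a \<in> S" "b \<in> S" using two by blast
      hence "a + b \<in> S" "a * b \<in> S" using CF[OF S(1)] by (auto simp: F_def)
      thus "a + b \<in> \<Union>C" "a * b \<in> \<Union>C" using S by auto
    qed
    moreover have "R0 \<subseteq> \<Union>C"
    proof -
      obtain S where S: "S \<in> C" using C(1) by blast
      hence "R0 \<subseteq> S" using CF[OF S] by (simp add: F_def)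
      thus ?thesis using S by blast
    qed
    moreover have "x \<notin> \<Union>C" using CF by (auto simp: F_def)
    ultimately show "\<Union>C \<in> F" unfolding F_def by simp
  qed
  then obtain R where R: "R \<in> F" "\<And>X. X \<in> F \<Longrightarrow> R \<subseteq> X \<Longrightarrow> X = R" by blast
  have RF: "R0 \<subseteq> R" "?cl R" "x \<notin> R" using R(1) by (auto simp: F_def)
  interpret maximal_subring p R x
  proof
    show "of_rat q \<in> R" if "padic_abs p q \<le> 1" for q
    proof -
      have "of_rat q \<in> R0" unfolding R0_def
        by (intro CollectI exI[of _ "[:q:]"])
          (use that in \<open>auto simp: coeff_pCons padic_abs_0 of_rat_hom.map_poly_pCons_hom split: nat.splits\<close>)
      thus ?thesis using RF(1) by blast
    qed
    have "?t \<in> R0" unfolding R0_def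
      by (intro CollectI exI[of _ "[:0, 1:]"])
        (auto simp: coeff_pCons padic_abs_0 padic_abs_1[OF p] of_rat_hom.map_poly_pCons_hom split: nat.splits)
    thus "?t \<in> R" using RF(1) by blast
    show "S = R" if "R \<subseteq> S" "\<And>a b. a \<in> S \<Longrightarrow> b \<in> S \<Longrightarrow> a + b \<in> S" "\<And>a b. a \<in> S \<Longrightarrow> b \<in> S \<Longrightarrow> a * b \<in> S" "x \<notin> S" for S
      by (rule R(2)) (use that RF(1) in \<open>auto simp: F_def\<close>)
  qed (use RF p alg in auto)
  show ?thesis using val_extension val_x by blast
qed

section \<open>The archimedean absolute value of the rationals\<close>

definition abs_inf :: "rat \<Rightarrow> real" where
  "abs_inf q = \<bar>real_of_rat q\<bar>"

lemma nontrivial_abs_inf: "nontrivial abs_inf"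
proof -
  have "absolute_value abs_inf" unfolding absolute_value_def abs_inf_def
  proof (intro conjI allI)
    show "\<bar>real_of_rat (x + y)\<bar> \<le> \<bar>real_of_rat x\<bar> + \<bar>real_of_rat y\<bar>" for x y
    unfolding of_rat_add by (rule abs_triangle_ineq)
    show "\<bar>real_of_rat (x * y)\<bar> = \<bar>real_of_rat x\<bar> * \<bar>real_of_rat y\<bar>" for x y
      unfolding of_rat_mult by (rule abs_mult)
  qed simp_all
  moreover have "0 < abs_inf (1/2) \<and> abs_inf (1/2) < 1" by (simp add: abs_inf_def of_rat_divide)
  ultimately show ?thesis unfolding nontrivial_def by blast
qed

lemma cmod_of_rat: "cmod (of_rat q) = \<bar>real_of_rat q\<bar>"
proof -
  obtain a b where "q = of_int a / of_int b" "b \<noteq> 0" by (rule rat_obtain_quotient)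
  thus ?thesis by (simp add: of_rat_divide norm_divide abs_divide)
qed

context number_field_type
begin

section \<open>Trace bounds\<close>

text \<open>Multiplication by powers of a rational number \<open>r\<close> reduces every positive
  bound, up to the factor \<open>1 / w r\<close>, to the bound \<open>1\<close>. An element with a
  bound \<open>M \<le> 0\<close> satisfies all positive bounds, hence has trace
  \<open>0\<close>.\<close>

lemma trace_boundedI:
  assumes w: "nontrivial w"
    and k: "\<And>x. (\<forall>v\<in>extensions w. v x \<le> 1) \<Longrightarrow> w (nf_trace (x::'a)) \<le> k"
  shows "trace_bounded w"
proof -
  have aw: "absolute_value w" using w by (simp add: nontrivial_def)
  obtain r where r: "0 < w r" "w r < 1" using w by (auto simp: nontrivial_def)
  have "w (nf_trace x) \<le> k / w r * M" if M: "\<forall>v\<in>extensions w. v x \<le> M" for x :: 'a and M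
  proof -
    have scaled: "w (nf_trace x) \<le> k * w r powi a" if a: "\<forall>v\<in>extensions w. v (x::'a) \<le> w r powi a" for x a
    proof -
      define x' where "x' = of_rat (inverse (r powi a)) * x"
      have pa: "0 < w r powi a" using r by (simp add: zero_less_power_int)
      have "\<forall>v\<in>extensions w. v x' \<le> 1"
      proof
        fix v :: "'a \<Rightarrow> real" assume v: "v \<in> extensions w"
        have "v x' = v x / w r powi a"
          unfolding x'_def absval_mult[OF extensions_absval[OF v]] extensions_of_rat[OF v]
          by (simp add: absval_inverse[OF aw] absval_powi[OF aw] divide_inverse mult.commute)
        thus "v x' \<le> 1" using a v pa by simp
      qed
      hence "w (nf_trace x') \<le> k" by (rule k)
      moreover have "w (nf_trace x') = w (nf_trace x) / w r powi a"
        unfolding x'_def nf_trace_scale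
        by (simp add: absval_mult[OF aw] absval_inverse[OF aw] absval_powi[OF aw] divide_inverse mult.commute)
      ultimately show ?thesis using pa by (simp add: field_simps)
    qed
    have "\<forall>v\<in>extensions w. v (0::'a) \<le> w r powi 0" by (simp add: absval_0[OF extensions_absval])
    from scaled[OF this] have k0: "0 \<le> k" by (simp add: nf_trace_0 absval_0[OF aw])
    have nonpos: "nf_trace y = 0" if y: "\<forall>v\<in>extensions w. v (y::'a) \<le> 0" for y
    proof -
      have "w (nf_trace y) \<le> k * w r ^ n" for n
      proof -
        have "0 \<le> w r powi (int n)" using r by simp
        hence "\<forall>v\<in>extensions w. v y \<le> w r powi (int n)" using y by (meson order_trans)
        thus ?thesis using scaled[of y "int n"] by simp
      qed
      moreover have "(\<lambda>n. k * w r ^ n) \<longlonglongrightarrow> k * 0"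
        using r by (intro tendsto_intros LIMSEQ_power_zero) simp
      ultimately have "w (nf_trace y) \<le> 0" by (intro LIMSEQ_le_const[of "\<lambda>n. k * w r ^ n"]) auto
      thus ?thesis using absval_pos[OF aw, of "nf_trace y"] by (cases "nf_trace y = 0") auto
    qed
    consider "M > 0" | "M = 0" | "M < 0" by linarith
    thus ?thesis
    proof cases
      case 1
      obtain a where a: "w r powi a \<le> M" "M < w r powi (a - 1)" using geometric_bracket[OF r 1] by blast
      have "\<forall>v\<in>extensions w. v x \<le> w r powi (a - 1)" using M a(2) by (meson less_imp_le order_trans)
      hence "w (nf_trace x) \<le> k * w r powi (a - 1)" by (rule scaled)
      also have "\<dots> = k / w r * w r powi a" using r by (simp add: power_int_diff)
      also have "\<dots> \<le> k / w r * M" using a k0 r by (intro mult_left_mono) auto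
      finally show ?thesis .
    next
      case 2
      thus ?thesis using nonpos[of x] M by (simp add: absval_0[OF aw])
    next
      case 3
      have "(extensions w :: ('a \<Rightarrow> real) set) = {}"
      proof (rule ccontr)
        assume "(extensions w :: ('a \<Rightarrow> real) set) \<noteq> {}"
        then obtain v :: "'a \<Rightarrow> real" where v: "v \<in> extensions w" by blast
        hence "v x \<le> M" using M by blast
        thus False using 3 absval_nonneg[OF extensions_absval[OF v], of x] by linarith
      qed
      hence "nf_trace (1::'a) = 0" by (intro nonpos) auto
      thus ?thesis using nf_trace_1 d_pos by simp
    qed
  qed
  thus ?thesis unfolding trace_bounded_def by blast
qed

lemma monic_relation: "\<exists>n>0. \<exists>r. (y::'a) ^ n = (\<Sum>i<n. of_rat (r i) * y ^ i)"
proof -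
  have "\<exists>q i. (\<Sum>i\<in>{..d}. of_rat (q i) * y ^ i) = 0 \<and> i \<in> {..d} \<and> q i \<noteq> 0"
  proof (rule ccontr)
    assume "\<not> ?thesis"
    hence "card {..d} \<le> d" by (intro card_le_degree[where b = "\<lambda>i. y ^ i"]) auto
    thus False by simp
  qed
  then obtain q i where qi: "(\<Sum>i\<le>d. of_rat (q i) * y ^ i) = 0" "i \<le> d" "q i \<noteq> 0" by auto
  define n where "n = (GREATEST i. i \<le> d \<and> q i \<noteq> 0)"
  have n: "n \<le> d \<and> q n \<noteq> 0"
    unfolding n_def by (rule GreatestI_nat[where k = i and b = d]) (use qi in auto)
  have gt: "q j = 0" if "j \<le> d" "n < j" for j
  proof (rule ccontr)
    assume "q j \<noteq> 0"
    hence "j \<le> n" unfolding n_def using that by (intro Greatest_le_nat[where b = d]) auto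
    thus False using that by simp
  qed
  have "(\<Sum>i\<le>d. of_rat (q i) * y ^ i) = (\<Sum>i\<le>n. of_rat (q i) * y ^ i)"
    by (rule sum.mono_neutral_right) (use n gt in auto)
  hence s: "of_rat (q n) * y ^ n = - (\<Sum>i<n. of_rat (q i) * y ^ i)"
    using qi(1) by (simp add: lessThan_Suc_atMost[symmetric] eq_neg_iff_add_eq_0 add.commute)
  have n0: "n > 0"
  proof (rule ccontr)
    assume "\<not> n > 0"
    thus False using s n by simp
  qed
  have "y ^ n = of_rat (inverse (q n)) * (of_rat (q n) * y ^ n)"
    unfolding mult.assoc[symmetric] of_rat_mult[symmetric] using n by simp
  also have "\<dots> = - (\<Sum>i<n. of_rat (inverse (q n)) * (of_rat (q i) * y ^ i))"
    unfolding s mult_minus_right sum_distrib_left ..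
  also have "\<dots> = (\<Sum>i<n. of_rat (- inverse (q n) * q i) * y ^ i)"
    unfolding sum_negf[symmetric]
  proof (rule sum.cong[OF refl])
    fix i
    have "of_rat (- inverse (q n) * q i) = - (of_rat (inverse (q n)) * of_rat (q i) :: 'a)"
      unfolding mult_minus_left of_rat_minus of_rat_mult ..
    thus "- (of_rat (inverse (q n)) * (of_rat (q i) * y ^ i)) = of_rat (- inverse (q n) * q i) * y ^ i"
      by (simp only: mult_minus_left mult.assoc)
  qed
  finally have e: "y ^ n = (\<Sum>i<n. of_rat (- inverse (q n) * q i) * y ^ i)" .
  show ?thesis by (intro exI[of _ n] conjI n0 exI[of _ "\<lambda>i. - inverse (q n) * q i"] e)
qed

text \<open>If \<open>x\<close> is at most \<open>1\<close> at every extension, it is a polynomial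
  in \<open>1 / x\<close> with p-integral coefficients. Multiplied by a power of \<open>x\<close>
  this is a monic equation; with \<open>M\<close> prime to \<open>p\<close> a common denominator of
  the coefficients, \<open>M x\<close> is an algebraic integer and has an integral trace.\<close>

lemma trace_bounded_padic:
  assumes p: "prime p" shows "trace_bounded (padic_abs p)"
proof (rule trace_boundedI[OF nontrivial_padic_abs[OF p]])
  fix x :: 'a assume le: "\<forall>v\<in>extensions (padic_abs p). v x \<le> 1"
  show "padic_abs p (nf_trace x) \<le> 1"
  proof (cases "x = 0")
    case False
    have "\<exists>n c. x = (\<Sum>i\<le>n. of_rat (c i) * inverse x ^ i) \<and> (\<forall>i\<le>n. padic_abs p (c i) \<le> 1)"
    proof (rule ccontr)
      assume H: "\<not> ?thesis"
      have "\<exists>i\<le>n. padic_abs p (c i) > 1" if "x = (\<Sum>i\<le>n. of_rat (c i) * inverse x ^ i)" for n c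
        using H that by (auto simp: not_le)
      hence "\<exists>v\<in>extensions (padic_abs p). 1 < v x"
        by (rule exists_extension_gt_1[OF p False monic_relation])
      thus False using le by (meson not_le)
    qed
    then obtain n c where c: "x = (\<Sum>i\<le>n. of_rat (c i) * inverse x ^ i)" "\<And>i. i \<le> n \<Longrightarrow> padic_abs p (c i) \<le> 1"
      by blast
    obtain N a where Na: "\<And>i. i \<le> n \<Longrightarrow> \<not> int p dvd N i \<and> of_int (N i) * c i = of_int (a i)"
      using padic_abs_le_1_denominator[OF p c(2)] by metis
    define M where "M = (\<Prod>i\<le>n. N i)"
    have pM: "\<not> int p dvd M"
      unfolding M_def using Na p by (subst prime_dvd_prod_iff) auto
    \<comment> \<open>the integer \<open>M\<^sup>i\<^sup>+\<^sup>1 c i\<close>: the coefficients of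
      the monic equation of \<open>x\<close> turn into those of \<open>M x\<close>\<close>
    define b where "b = (\<lambda>i. M ^ i * ((\<Prod>j\<in>{..n} - {i}. N j) * a i))"
    have b: "of_int (b i) = (of_int M ^ Suc i * c i :: rat)" if i: "i \<le> n" for i
    proof -
      have "M = N i * (\<Prod>j\<in>{..n} - {i}. N j)" unfolding M_def using i by (subst prod.remove[of _ i]) auto
      hence "of_int M * c i = of_int (\<Prod>j\<in>{..n} - {i}. N j) * (of_int (N i) * c i)" by simp
      also have "\<dots> = of_int ((\<Prod>j\<in>{..n} - {i}. N j) * a i)" using Na[OF i] by simp
      finally show ?thesis by (simp add: b_def mult.assoc mult.left_commute)
    qed
    define z where "z = of_int M * x"
    have "algebraic_int z"
    proof (rule algebraic_int_if_monic_relation)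
      have "x * x ^ n = (\<Sum>i\<le>n. of_rat (c i) * (inverse x ^ i * x ^ n))"
        by (subst c(1)) (simp add: sum_distrib_right mult.assoc)
      also have "\<dots> = (\<Sum>i\<le>n. of_rat (c i) * x ^ (n - i))"
      proof (rule sum.cong[OF refl])
        fix i assume "i \<in> {..n}"
        hence "x ^ n = x ^ i * x ^ (n - i)" by (simp add: power_add[symmetric])
        thus "of_rat (c i) * (inverse x ^ i * x ^ n) = of_rat (c i) * x ^ (n - i)"
          using False by (simp add: power_inverse)
      qed
      finally have "z ^ Suc n = (\<Sum>i\<le>n. of_int M ^ Suc n * (of_rat (c i) * x ^ (n - i)))"
        by (simp only: z_def power_mult_distrib power_Suc[of x] sum_distrib_left)
      also have "\<dots> = (\<Sum>i\<le>n. of_int (b i) * z ^ (n - i))"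
      proof (rule sum.cong[OF refl])
        fix i assume i: "i \<in> {..n}"
        have "of_rat (of_int (b i)) = (of_rat (of_int M ^ Suc i * c i) :: 'a)" using b i by simp
        hence "(of_int (b i) :: 'a) = of_int M ^ Suc i * of_rat (c i)" by (simp add: of_rat_mult of_rat_power)
        moreover have "Suc n = Suc i + (n - i)" using i by simp
        hence "(of_int M :: 'a) ^ Suc n = of_int M ^ Suc i * of_int M ^ (n - i)" by (metis power_add)
        ultimately show "of_int M ^ Suc n * (of_rat (c i) * x ^ (n - i)) = of_int (b i) * z ^ (n - i)"
          unfolding z_def power_mult_distrib by (simp only: ac_simps)
      qed
      finally show "z ^ Suc n = (\<Sum>i\<le>n. of_int (b i) * z ^ (n - i))" .
    qed
    hence "nf_trace z \<in> \<int>" by (rule nf_trace_Ints)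
    then obtain k where k: "nf_trace z = of_int k" by (rule Ints_cases)
    have "z = of_rat (of_int M) * x" by (simp add: z_def)
    hence "of_int M * nf_trace x = of_int k" using k nf_trace_scale[of "of_int M" x] by simp
    hence "padic_abs p (of_int M) * padic_abs p (nf_trace x) \<le> 1"
      unfolding padic_abs_mult[OF p, symmetric] using padic_abs_of_int_le_1[OF p] by simp
    thus ?thesis using padic_abs_of_int_unit[OF p pM] by simp
  qed (simp add: nf_trace_0 padic_abs_0)
qed

section \<open>Complex embeddings\<close>

text \<open>Among the nonzero polynomials \<open>Q\<close> with \<open>Q(y)\<close> acting on
  \<open>f\<close> as zero, take one of least degree, with a root \<open>l\<close> and \<open>Q = (X
  - l) Q'\<close>. Then \<open>Q'(y)\<close> takes \<open>f\<close> to a nonzero eigenfunctional for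
  \<open>y\<close>. Since multiplications commute, eigenvalue equations of \<open>f\<close> remain
  valid.\<close>

lemma eigen_functional_refine:
  assumes f: "eigen_functional x e f"
  shows "\<exists>g e'. eigen_functional y e' g \<and> (\<forall>z c. (\<forall>t. f (z * t) = c * f t) \<longrightarrow> (\<forall>t. g (z * t) = c * g t))"
proof -
  have fadd: "f (s + t) = f s + f t" and fsc: "f (of_rat q * t) = of_rat q * f t" for s t q
    using f unfolding eigen_functional_def by auto
  have f0: "f 0 = 0" using fsc[of 0 0] by simp
  \<comment> \<open>\<open>A Q\<close> is the functional \<open>f\<close> after multiplication by
    \<open>Q(y)\<close>, where the complex coefficients of \<open>Q\<close> act on the values of
    \<open>f\<close>\<close>
  define A where "A = (\<lambda>(Q :: complex poly) t. \<Sum>j\<le>degree Q. poly.coeff Q j * f (y ^ j * t))"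
  have A_alt: "A Q t = (\<Sum>j\<le>n. poly.coeff Q j * f (y ^ j * t))" if "degree Q \<le> n" for Q n t
    unfolding A_def by (rule sum.mono_neutral_left) (use that in \<open>auto simp: coeff_eq_0\<close>)
  obtain n r where nr: "n > 0" "y ^ n = (\<Sum>i<n. of_rat (r i) * y ^ i)" using monic_relation by blast
  define P :: "complex poly" where "P = monom 1 n - (\<Sum>i<n. monom (of_rat (r i)) i)"
  have fsum: "f (sum h I) = (\<Sum>i\<in>I. f (h i))" for h and I :: "nat set"
    by (induction I rule: infinite_finite_induct) (simp_all add: f0 fadd)
  have coefP: "poly.coeff P i = (if i = n then 1 else if i < n then - of_rat (r i) else 0)" for i
    by (auto simp: P_def coeff_sum)
  have degP: "degree P \<le> n" by (rule degree_le) (simp add: coefP)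
  have P0: "P \<noteq> 0"
  proof
    assume "P = 0"
    thus False using coefP[of n] by simp
  qed
  have AP: "A P t = 0" for t
  proof -
    have "A P t = f (y ^ n * t) - (\<Sum>i<n. of_rat (r i) * f (y ^ i * t))"
      unfolding A_alt[OF degP] by (simp add: lessThan_Suc_atMost[symmetric] coefP sum_negf)
    also have "y ^ n * t = (\<Sum>i<n. of_rat (r i) * (y ^ i * t))"
      unfolding nr(2) by (simp add: sum_distrib_right mult.assoc)
    finally show ?thesis by (simp add: fsum fsc)
  qed
  obtain Q where Q: "Q \<noteq> 0 \<and> (\<forall>t. A Q t = 0)" "\<And>Q'. Q' \<noteq> 0 \<and> (\<forall>t. A Q' t = 0) \<Longrightarrow> degree Q \<le> degree Q'"
    using ex_has_least_nat[of "\<lambda>Q. Q \<noteq> 0 \<and> (\<forall>t. A Q t = 0)" P degree] P0 AP by blast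
  have "degree Q \<noteq> 0"
  proof
    assume d0: "degree Q = 0"
    obtain t where "f t \<noteq> 0" using f unfolding eigen_functional_def by blast
    moreover have "A Q t = 0" using Q(1) by blast
    hence "poly.coeff Q 0 * f t = 0" using d0 by (simp add: A_def)
    ultimately have "poly.coeff Q 0 = 0" by simp
    thus False using Q(1) d0 by (metis leading_coeff_0_iff)
  qed
  hence "\<not> constant (poly Q)" by (simp add: constant_degree)
  then obtain l where "poly Q l = 0" using fundamental_theorem_of_algebra by blast
  then obtain Q' where Q': "Q = [:- l, 1:] * Q'" unfolding poly_eq_0_iff_dvd by (elim dvdE)
  have Q'0: "Q' \<noteq> 0" using Q(1) Q' by auto
  have degQ: "degree Q = Suc (degree Q')" unfolding Q' using Q'0 by (subst degree_mult_eq) auto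
  define g where "g = A Q'"
  have "\<not> (\<forall>t. A Q' t = 0)" using Q(2)[of Q'] Q'0 degQ by auto
  then obtain t0 where t0: "g t0 \<noteq> 0" unfolding g_def by blast
  have gy: "g (y * t) = l * g t" for t
  proof -
    let ?n = "degree Q'"
    have cQ: "poly.coeff Q j = (if j = 0 then 0 else poly.coeff Q' (j - 1)) - l * poly.coeff Q' j" for j
      unfolding Q' by (cases j) (simp_all add: algebra_simps)
    have "0 = A Q t" using Q(1) by simp
    also have "\<dots> = (\<Sum>j\<le>Suc ?n. (if j = 0 then 0 else poly.coeff Q' (j - 1)) * f (y ^ j * t))
        - l * (\<Sum>j\<le>Suc ?n. poly.coeff Q' j * f (y ^ j * t))"
      unfolding A_def degQ cQ left_diff_distrib sum_subtractf sum_distrib_left mult.assoc ..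
    also have "(\<Sum>j\<le>Suc ?n. poly.coeff Q' j * f (y ^ j * t)) = g t"
      unfolding g_def by (rule A_alt[symmetric]) simp
    also have "(\<Sum>j\<le>Suc ?n. (if j = 0 then 0 else poly.coeff Q' (j - 1)) * f (y ^ j * t)) = g (y * t)"
      unfolding g_def A_def by (subst sum.atMost_Suc_shift) (simp add: mult.assoc mult.left_commute)
    finally show ?thesis by simp
  qed
  have gadd: "g (s + t) = g s + g t" for s t
    unfolding g_def A_def by (simp add: distrib_left fadd sum.distrib)
  have gsc: "g (of_rat q * t) = of_rat q * g t" for q t
    unfolding g_def A_def mult.left_commute[of _ "of_rat q"] fsc sum_distrib_left ..
  have "eigen_functional y l g" unfolding eigen_functional_def using gadd gsc t0 gy by blast
  moreover have "g (z * t) = c * g t" if "\<And>t. f (z * t) = c * f t" for z c t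
    unfolding g_def A_def mult.left_commute[of _ z] that by (simp add: sum_distrib_left mult.left_commute)
  ultimately show ?thesis by blast
qed

text \<open>Refining the eigenfunctional for one basis element after the other gives a common
  eigenfunctional for all elements of the field. Its eigenvalue at \<open>y\<close> depends
  additively and multiplicatively on \<open>y\<close>.\<close>

lemma complex_embedding_through_eigenvalue:
  assumes f: "eigen_functional x e f"
  shows "\<exists>\<sigma>. (\<forall>y z. \<sigma> (y + z) = \<sigma> y + \<sigma> z) \<and> (\<forall>y z. \<sigma> (y * z) = \<sigma> y * \<sigma> z) \<and>
     (\<forall>q. \<sigma> (of_rat q) = of_rat q) \<and> \<sigma> x = (e :: complex)"
proof -
  have "\<exists>g. eigen_functional x e g \<and> (\<forall>y\<in>F. \<exists>c. \<forall>t. g (y * t) = c * g t)" if "finite F" for F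
    using that
  proof (induction F rule: finite_induct)
    case empty
    show ?case using f by blast
  next
    case (insert y F)
    then obtain g where g: "eigen_functional x e g" "\<forall>y\<in>F. \<exists>c. \<forall>t. g (y * t) = c * g t" by blast
    obtain h e' where h: "eigen_functional y e' h"
      "\<And>z c. (\<And>t. g (z * t) = c * g t) \<Longrightarrow> (\<forall>t. h (z * t) = c * h t)"
      using eigen_functional_refine[OF g(1), of y] by blast
    have "\<forall>t. g (x * t) = e * g t" using g(1) unfolding eigen_functional_def by blast
    hence "\<forall>t. h (x * t) = e * h t" using h(2) by blast
    hence "eigen_functional x e h" using h(1) unfolding eigen_functional_def by blast
    moreover have "\<forall>y\<in>insert y F. \<exists>c. \<forall>t. h (y * t) = c * h t"
      using h g(2) unfolding eigen_functional_def by blast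
    ultimately show ?case by blast
  qed
  from this[OF finite_B] obtain g where g: "eigen_functional x e g" "\<forall>y\<in>B. \<exists>c. \<forall>t. g (y * t) = c * g t" by blast
  have gadd: "g (s + t) = g s + g t" and gsc: "g (of_rat q * t) = of_rat q * g t" for s t q
    using g(1) unfolding eigen_functional_def by auto
  have g0: "g 0 = 0" using gsc[of 0 0] by simp
  have gsum: "g (sum h I) = (\<Sum>i\<in>I. g (h i))" for h and I :: "'a set"
    by (induction I rule: infinite_finite_induct) (simp_all add: g0 gadd)
  obtain c where c: "\<And>b t. b \<in> B \<Longrightarrow> g (b * t) = c b * g t" using g(2) by metis
  define \<sigma> where "\<sigma> = (\<lambda>y. \<Sum>b\<in>B. of_rat (coord y b) * c b)"
  have \<sigma>: "g (y * t) = \<sigma> y * g t" for y t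
  proof -
    have "y * t = (\<Sum>b\<in>B. of_rat (coord y b) * (b * t))"
      by (subst coord_sum[of y, symmetric]) (simp add: sum_distrib_right mult.assoc)
    hence "g (y * t) = (\<Sum>b\<in>B. of_rat (coord y b) * (c b * g t))" by (simp add: gsum gsc c)
    thus ?thesis by (simp add: \<sigma>_def sum_distrib_right mult.assoc)
  qed
  obtain t where t: "g t \<noteq> 0" using g(1) unfolding eigen_functional_def by blast
  have eqI: "u = u'" if "u * g t = u' * g t" for u u' using that t by simp
  have "\<sigma> (y + z) = \<sigma> y + \<sigma> z" for y z
    by (rule eqI) (simp add: \<sigma>[symmetric] distrib_right gadd)
  moreover have "\<sigma> (y * z) = \<sigma> y * \<sigma> z" for y z
    by (rule eqI) (simp add: \<sigma>[symmetric] mult.assoc)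
  moreover have "\<sigma> (of_rat q) = of_rat q" for q
    by (rule eqI) (simp add: \<sigma>[symmetric] gsc)
  moreover have "\<sigma> x = e"
    by (rule eqI) (use g(1) in \<open>simp add: \<sigma>[symmetric] eigen_functional_def\<close>)
  ultimately show ?thesis by blast
qed

text \<open>The trace is a sum of \<open>d\<close> images of \<open>x\<close> under complex
  embeddings, and the modulus of a complex embedding extends the usual absolute value.\<close>

lemma trace_bounded_abs_inf: "trace_bounded abs_inf"
proof (rule trace_boundedI[OF nontrivial_abs_inf])
  fix x :: 'a assume le: "\<forall>v\<in>extensions abs_inf. v x \<le> 1"
  obtain es where es: "length es = d" "of_rat (nf_trace x) = sum_list es" "\<forall>e\<in>set es. \<exists>f. eigen_functional x e f"
    using trace_eq_sum_eigenvalues by blast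
  have "cmod e \<le> 1" if e: "e \<in> set es" for e
  proof -
    obtain f where f: "eigen_functional x e f" using es(3) e by blast
    obtain \<sigma> where \<sigma>: "\<And>y z. \<sigma> (y + z) = \<sigma> y + \<sigma> z" "\<And>y z. \<sigma> (y * z) = \<sigma> y * \<sigma> z"
      "\<And>q. \<sigma> (of_rat q) = of_rat q" "\<sigma> x = e"
      using complex_embedding_through_eigenvalue[OF f] by blast
    have "\<sigma> y = 0 \<longleftrightarrow> y = 0" for y
    proof
      assume "\<sigma> y = 0"
      show "y = 0"
      proof (rule ccontr)
        assume "y \<noteq> 0"
        hence "\<sigma> y * \<sigma> (inverse y) = 1" using \<sigma>(2)[of y "inverse y"] \<sigma>(3)[of 1] by simp
        thus False using \<open>\<sigma> y = 0\<close> by simp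
      qed
    qed (use \<sigma>(3)[of 0] in simp)
    hence "(\<lambda>y. cmod (\<sigma> y)) \<in> extensions abs_inf"
      unfolding extensions_def absolute_value_def abs_inf_def
      by (auto simp: \<sigma> norm_mult cmod_of_rat intro: norm_triangle_ineq)
    thus ?thesis using le \<sigma>(4) by auto
  qed
  hence "cmod (sum_list es) \<le> real (length es)"
  proof (induction es)
    case (Cons e es)
    have "cmod (e + sum_list es) \<le> cmod e + cmod (sum_list es)" by (rule norm_triangle_ineq)
    also have "\<dots> \<le> 1 + real (length es)" using Cons by (intro add_mono) auto
    finally show ?case by simp
  qed simp
  moreover have "cmod (of_rat (nf_trace x)) = \<bar>real_of_rat (nf_trace x)\<bar>"
    by (rule cmod_of_rat)
  ultimately show "abs_inf (nf_trace x) \<le> real d" using es by (simp add: abs_inf_def)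
qed

section \<open>The local product formula\<close>

lemma local_product_formula:
  assumes w: "nontrivial w" and tb: "trace_bounded w" and c: "(c::'a) \<noteq> 0"
  shows "(\<Prod>v\<in>(extensions w :: ('a \<Rightarrow> real) set). v c ^ local_degree v) = w (nf_norm c)"
proof -
  have aw: "absolute_value w" using w by (simp add: nontrivial_def)
  \<comment> \<open>topologically independent families are bounded in length by the degree, so
    maximal ones exist\<close>
  have "\<exists>n b. top_basis w v n b" if v: "v \<in> extensions w" for v :: "'a \<Rightarrow> real"
    by (rule top_basis_exists[OF aw v]) (rule top_indep_le_degree[OF aw extensions_absval[OF v]])
  then obtain n b where nb: "\<And>v. v \<in> extensions w \<Longrightarrow> top_basis w v (n v) (b v :: nat \<Rightarrow> 'a)" by metis
  have "local_degree v = n v" if ve: "v \<in> extensions w" for v :: "'a \<Rightarrow> real"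
  proof -
    interpret completed_field v by unfold_locales (rule extensions_absval[OF ve])
    show ?thesis by (rule local_degree_eq[OF aw ve nb[OF ve]])
  qed
  hence "(\<Prod>v\<in>(extensions w :: ('a \<Rightarrow> real) set). v c ^ local_degree v) = (\<Prod>v\<in>(extensions w :: ('a \<Rightarrow> real) set). v c ^ n v)"
    by (intro prod.cong) auto
  also have "\<dots> = w (nf_norm c)" by (rule local_product_formula_top_basis[OF w tb nb c])
  finally show ?thesis .
qed

end

section \<open>The product formula\<close>

lemma arch_places_eq: "arch_places = extensions abs_inf"
  by (simp add: arch_places_def extensions_def abs_inf_def)

lemma finite_places_eq: "finite_places = (\<Union>p\<in>{p. prime p}. extensions (padic_abs p))"
  by (auto simp: finite_places_def extensions_def)

lemma extensions_padic_disjoint: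
  assumes p: "prime p" and q: "prime q" and "p \<noteq> q"
  shows "extensions (padic_abs p) \<inter> extensions (padic_abs q) = ({} :: ('a::field_char_0 \<Rightarrow> real) set)"
proof -
  have "v (of_rat (of_nat p)) = 1 / real p" if "v \<in> extensions (padic_abs p)" for v :: "'a \<Rightarrow> real"
    unfolding extensions_of_rat[OF that] by (rule padic_abs_p[OF p])
  moreover have "v (of_rat (of_nat p)) = 1" if "v \<in> extensions (padic_abs q)" for v :: "'a \<Rightarrow> real"
  proof -
    have "\<not> int q dvd int p" using primes_dvd_imp_eq[OF q p] \<open>p \<noteq> q\<close> by auto
    thus ?thesis unfolding extensions_of_rat[OF that] using padic_abs_of_int_unit[OF q, of "int p"] by simp
  qed
  moreover have "1 / real p \<noteq> 1" using prime_gt_1_nat[OF p] by simp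
  ultimately show ?thesis by fastforce
qed

lemma extensions_abs_inf_padic_disjoint:
  assumes p: "prime p"
  shows "extensions abs_inf \<inter> extensions (padic_abs p) = ({} :: ('a::field_char_0 \<Rightarrow> real) set)"
proof -
  have "v (of_rat (of_nat p)) = 1 / real p" if "v \<in> extensions (padic_abs p)" for v :: "'a \<Rightarrow> real"
    unfolding extensions_of_rat[OF that] by (rule padic_abs_p[OF p])
  moreover have "v (of_rat (of_nat p)) = real p" if "v \<in> extensions abs_inf" for v :: "'a \<Rightarrow> real"
    unfolding extensions_of_rat[OF that] by (simp add: abs_inf_def)
  moreover have "1 / real p < real p"
  proof -
    have "1 / real p < 1" "1 < real p" using prime_gt_1_nat[OF p] by simp_all
    thus ?thesis by linarith
  qed
  ultimately show ?thesis by fastforce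
qed

text \<open>All powers of \<open>z\<close> are combinations of the first \<open>n\<close> of them
  with coefficients of absolute value at most \<open>1\<close>, so the powers of \<open>v z\<close>
  are bounded. For a merely subadditive \<open>v\<close> this takes the place of the ultrametric
  inequality.\<close>

lemma integral_absval_le_1:
  fixes z :: "'a::field_char_0"
  assumes p: "prime p" and v: "v \<in> extensions (padic_abs p)" and n: "n > 0"
    and eq: "z ^ n = (\<Sum>i<n. of_rat (r i) * z ^ i)" and r: "\<And>i. i < n \<Longrightarrow> padic_abs p (r i) \<le> 1"
  shows "v z \<le> 1"
proof (rule ccontr)
  assume "\<not> v z \<le> 1"
  hence vz: "1 < v z" by simp
  note av = extensions_absval[OF v]
  obtain m where m: "n = Suc m" using n by (cases n) auto
  have red: "\<exists>s. (\<forall>i<n. padic_abs p (s i) \<le> 1) \<and> z ^ k = (\<Sum>i<n. of_rat (s i) * z ^ i)" for k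
  proof (induction k)
    case 0
    show ?case
    proof (intro exI[of _ "\<lambda>i. if i = 0 then 1 else 0"] conjI)
      show "z ^ 0 = (\<Sum>i<n. of_rat (if i = 0 then 1 else 0) * z ^ i)"
        unfolding m by (subst sum.lessThan_Suc_shift) simp
    qed (simp add: padic_abs_0 padic_abs_1[OF p])
  next
    case (Suc k)
    then obtain s where s: "\<And>i. i < n \<Longrightarrow> padic_abs p (s i) \<le> 1" "z ^ k = (\<Sum>i<n. of_rat (s i) * z ^ i)" by blast
    \<comment> \<open>\<open>z\<^sup>n\<close>, arising from the top term, is replaced by means of
      the monic equation\<close>
    define s' where "s' = (\<lambda>i. (if i = 0 then 0 else s (i - 1)) + s m * r i)"
    have "z ^ Suc k = (\<Sum>i<n. of_rat (s i) * z ^ Suc i)"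
      unfolding power_Suc s(2) sum_distrib_left by (rule sum.cong) (simp_all only: mult.left_commute)
    also have "\<dots> = (\<Sum>i<m. of_rat (s i) * z ^ Suc i) + of_rat (s m) * z ^ n" by (simp add: m)
    also have "(\<Sum>i<m. of_rat (s i) * z ^ Suc i) = (\<Sum>i<n. of_rat (if i = 0 then 0 else s (i - 1)) * z ^ i)"
      unfolding m by (subst sum.lessThan_Suc_shift) simp
    also have "of_rat (s m) * z ^ n = (\<Sum>i<n. of_rat (s m * r i) * z ^ i)"
      unfolding eq sum_distrib_left of_rat_mult mult.assoc ..
    also have "(\<Sum>i<n. of_rat (if i = 0 then 0 else s (i - 1)) * z ^ i) + (\<Sum>i<n. of_rat (s m * r i) * z ^ i)
        = (\<Sum>i<n. of_rat (s' i) * z ^ i)"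
      unfolding s'_def of_rat_add distrib_right sum.distrib ..
    finally have e: "z ^ Suc k = (\<Sum>i<n. of_rat (s' i) * z ^ i)" .
    have "padic_abs p (s' i) \<le> 1" if i: "i < n" for i
    proof -
      have "padic_abs p (s m * r i) \<le> 1"
        unfolding padic_abs_mult[OF p] using s(1)[of m] r[OF i] m padic_abs_nonneg[OF p] by (intro mult_le_one) auto
      moreover have "padic_abs p (if i = 0 then 0 else s (i - 1)) \<le> 1"
        using s(1)[of "i - 1"] i by (auto simp: padic_abs_0)
      ultimately show ?thesis unfolding s'_def by (intro padic_abs_add_le_1[OF p])
    qed
    thus ?case using e by blast
  qed
  define K where "K = (\<Sum>i<n. v z ^ i)"
  have le: "v z ^ k \<le> K" for k
  proof -
    obtain s where s: "\<And>i. i < n \<Longrightarrow> padic_abs p (s i) \<le> 1" "z ^ k = (\<Sum>i<n. of_rat (s i) * z ^ i)"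
      using red by blast
    have "v z ^ k = v (\<Sum>i<n. of_rat (s i) * z ^ i)" using s(2) absval_power[OF av, of z k] by simp
    also have "\<dots> \<le> (\<Sum>i<n. v (of_rat (s i) * z ^ i))" by (rule absval_sum[OF av])
    also have "\<dots> \<le> K" unfolding K_def
    proof (rule sum_mono)
      fix i assume "i \<in> {..<n}"
      hence "padic_abs p (s i) * v z ^ i \<le> 1 * v z ^ i"
        using s(1) absval_nonneg[OF av] by (intro mult_right_mono) auto
      thus "v (of_rat (s i) * z ^ i) \<le> v z ^ i"
        by (simp add: absval_mult[OF av] absval_power[OF av] extensions_of_rat[OF v])
    qed
    finally show ?thesis .
  qed
  obtain k where "K < v z ^ k" using real_arch_pow[OF vz] by blast
  thus False using le[of k] by simp
qed

lemma finite_int_prime_divisors: "b \<noteq> 0 \<Longrightarrow> finite {p. int p dvd b}"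
proof (rule finite_subset)
  assume b: "b \<noteq> 0"
  show "{p. int p dvd b} \<subseteq> {..nat \<bar>b\<bar>}"
  proof
    fix p assume "p \<in> {p. int p dvd b}"
    hence "int p \<le> \<bar>b\<bar>" using b zdvd_imp_le[of "int p" "\<bar>b\<bar>"] by simp
    thus "p \<in> {..nat \<bar>b\<bar>}" by auto
  qed
qed simp

lemma padic_abs_divide: "prime p \<Longrightarrow> padic_abs p (x / y) = padic_abs p x / padic_abs p y"
  by (simp add: divide_inverse padic_abs_mult padic_abs_inverse)

lemma finite_primes_padic_abs_gt_1: "finite {p. prime p \<and> padic_abs p q > 1}"
proof -
  obtain a b where q: "q = of_int a / of_int b" "b \<noteq> 0" by (rule rat_obtain_quotient)
  have "int p dvd b" if p: "prime p" "padic_abs p q > 1" for p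
  proof (rule ccontr)
    assume "\<not> int p dvd b"
    hence "padic_abs p q = padic_abs p (of_int a)"
      unfolding q padic_abs_divide[OF p(1)] using padic_abs_of_int_unit[OF p(1)] by simp
    thus False using padic_abs_of_int_le_1[OF p(1), of a] p(2) by simp
  qed
  hence "{p. prime p \<and> padic_abs p q > 1} \<subseteq> {p. int p dvd b}" by blast
  thus ?thesis using finite_int_prime_divisors[OF q(2)] by (rule finite_subset)
qed

lemma finite_primes_padic_abs_neq_1:
  assumes "q \<noteq> 0" shows "finite {p. prime p \<and> padic_abs p q \<noteq> 1}"
proof (rule finite_subset)
  show "finite ({p. prime p \<and> padic_abs p q > 1} \<union> {p. prime p \<and> padic_abs p (inverse q) > 1})"
    using finite_primes_padic_abs_gt_1 by blast
  show "{p. prime p \<and> padic_abs p q \<noteq> 1} \<subseteq> {p. prime p \<and> padic_abs p q > 1} \<union> {p. prime p \<and> padic_abs p (inverse q) > 1}"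
  proof
    fix p assume p: "p \<in> {p. prime p \<and> padic_abs p q \<noteq> 1}"
    hence pp: "prime p" by simp
    have "padic_abs p q > 0" by (rule padic_abs_pos[OF pp assms])
    hence "padic_abs p q > 1 \<or> inverse (padic_abs p q) > 1" using p by (auto simp: one_less_inverse_iff)
    thus "p \<in> {p. prime p \<and> padic_abs p q > 1} \<union> {p. prime p \<and> padic_abs p (inverse q) > 1}"
      using pp by (auto simp: padic_abs_inverse[OF pp])
  qed
qed

lemma int_product_formula:
  assumes a: "a \<noteq> 0" and T: "finite T" "\<And>p. p \<in> T \<Longrightarrow> prime p" "\<And>p. prime p \<Longrightarrow> int p dvd a \<Longrightarrow> p \<in> T"
  shows "\<bar>real_of_int a\<bar> * (\<Prod>p\<in>T. padic_abs p (of_int a)) = 1"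
proof -
  have "\<bar>a\<bar> = (\<Prod>P\<in>prime_factors a. P ^ multiplicity P a)"
    using prod_prime_factors[OF a] by simp
  also have "\<dots> = (\<Prod>P\<in>int ` T. P ^ multiplicity P a)"
  proof (rule prod.mono_neutral_left)
    show "prime_factors a \<subseteq> int ` T"
    proof
      fix P assume P: "P \<in> prime_factors a"
      hence "prime P" "P dvd a" by (auto simp: in_prime_factors_iff)
      moreover from this have "P = int (nat P)" by (simp add: prime_ge_0_int)
      ultimately show "P \<in> int ` T" using T(3)[of "nat P"] by (metis image_eqI prime_int_nat_transfer)
    qed
    show "\<forall>P\<in>int ` T - prime_factors a. P ^ multiplicity P a = 1"
    proof
      fix P assume P: "P \<in> int ` T - prime_factors a"
      then obtain p where "P = int p" "prime p" using T(2) by auto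
      hence "prime P" by simp
      hence "\<not> P dvd a" using P a by (auto simp: in_prime_factors_iff)
      thus "P ^ multiplicity P a = 1" by (simp add: not_dvd_imp_multiplicity_0)
    qed
  qed (use T in auto)
  also have "\<dots> = (\<Prod>p\<in>T. int p ^ multiplicity (int p) a)"
    by (subst prod.reindex) (auto simp: o_def)
  finally have "real_of_int \<bar>a\<bar> = real_of_int (\<Prod>p\<in>T. int p ^ multiplicity (int p) a)" by (rule arg_cong)
  hence 1: "\<bar>real_of_int a\<bar> = (\<Prod>p\<in>T. real p ^ multiplicity (int p) a)" by simp
  have "padic_abs p (of_int a) = inverse (real p ^ multiplicity (int p) a)" if "p \<in> T" for p
    using padic_abs_quotient[OF T(2)[OF that] a, of 1] by (simp add: power_int_minus)
  hence "(\<Prod>p\<in>T. padic_abs p (of_int a)) = (\<Prod>p\<in>T. inverse (real p ^ multiplicity (int p) a))"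
    by (intro prod.cong) auto
  hence 2: "(\<Prod>p\<in>T. padic_abs p (of_int a)) = inverse (\<Prod>p\<in>T. real p ^ multiplicity (int p) a)"
    using prod_inversef[of "\<lambda>p. real p ^ multiplicity (int p) a" T] by (simp add: o_def)
  have "(\<Prod>p\<in>T. real p ^ multiplicity (int p) a) \<noteq> 0"
    using 1 a by auto
  thus ?thesis unfolding 1 2 by simp
qed

lemma rat_product_formula:
  assumes q: "q \<noteq> 0" and T: "finite T" "\<And>p. p \<in> T \<Longrightarrow> prime p" "\<And>p. prime p \<Longrightarrow> p \<notin> T \<Longrightarrow> padic_abs p q = 1"
  shows "abs_inf q * (\<Prod>p\<in>T. padic_abs p q) = 1"
proof -
  obtain a b where ab: "q = of_int a / of_int b" "b \<noteq> 0" by (rule rat_obtain_quotient)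
  have a: "a \<noteq> 0" using q ab by auto
  define U where "U = T \<union> {p. prime p \<and> int p dvd a} \<union> {p. prime p \<and> int p dvd b}"
  have U1: "finite U"
    unfolding U_def using T(1) finite_int_prime_divisors[OF a] finite_int_prime_divisors[OF ab(2)]
    by (intro finite_UnI finite_Collect_conjI) simp_all
  have U2: "prime p" if "p \<in> U" for p using that T(2) unfolding U_def by blast
  note U = U1 U2
  have "(\<Prod>p\<in>T. padic_abs p q) = (\<Prod>p\<in>U. padic_abs p q)"
  proof (rule prod.mono_neutral_left[OF U1])
    show "T \<subseteq> U" unfolding U_def by blast
    show "\<forall>p\<in>U - T. padic_abs p q = 1" using U2 T(3) by blast
  qed
  also have "\<dots> = (\<Prod>p\<in>U. padic_abs p (of_int a) / padic_abs p (of_int b))"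
    by (rule prod.cong) (simp_all add: ab(1) padic_abs_divide U)
  also have "\<dots> = (\<Prod>p\<in>U. padic_abs p (of_int a)) / (\<Prod>p\<in>U. padic_abs p (of_int b))"
    by (rule prod_dividef)
  finally have 1: "(\<Prod>p\<in>T. padic_abs p q) = (\<Prod>p\<in>U. padic_abs p (of_int a)) / (\<Prod>p\<in>U. padic_abs p (of_int b))" .
  have ia: "\<bar>real_of_int a\<bar> * (\<Prod>p\<in>U. padic_abs p (of_int a)) = 1"
    by (rule int_product_formula[OF a U]) (auto simp: U_def)
  have ib: "\<bar>real_of_int b\<bar> * (\<Prod>p\<in>U. padic_abs p (of_int b)) = 1"
    by (rule int_product_formula[OF ab(2) U]) (auto simp: U_def)
  have "abs_inf q = \<bar>real_of_int a\<bar> / \<bar>real_of_int b\<bar>"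
    by (simp add: ab(1) abs_inf_def of_rat_divide abs_divide)
  hence "abs_inf q * (\<Prod>p\<in>T. padic_abs p q)
     = (\<bar>real_of_int a\<bar> * (\<Prod>p\<in>U. padic_abs p (of_int a))) / (\<bar>real_of_int b\<bar> * (\<Prod>p\<in>U. padic_abs p (of_int b)))"
    unfolding 1 by simp
  thus ?thesis unfolding ia ib by simp
qed

lemma places_prod_eq:
  assumes "finite A" "A \<subseteq> places" "\<And>v. v \<in> places \<Longrightarrow> v \<notin> A \<Longrightarrow> f v = 1"
  shows "places_prod f = prod f A"
  unfolding places_prod_def
  by (rule prod.mono_neutral_left) (use assms in auto)

context number_field_type
begin

text \<open>Both \<open>c\<close> and \<open>1 / c\<close> satisfy monic equations, and only
  finitely many primes occur in the denominators of their coefficients.\<close>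

lemma finite_bad_primes:
  assumes c: "(c::'a) \<noteq> 0"
  shows "finite {p. prime p \<and> (\<exists>v\<in>extensions (padic_abs p). v c \<noteq> 1)}"
proof -
  have gt: "finite {p. prime p \<and> (\<exists>v\<in>extensions (padic_abs p). v z > 1)}" for z :: 'a
  proof -
    obtain n r where n: "n > 0" "z ^ n = (\<Sum>i<n. of_rat (r i) * z ^ i)" using monic_relation by blast
    have "{p. prime p \<and> (\<exists>v\<in>extensions (padic_abs p). v z > 1)} \<subseteq> (\<Union>i<n. {p. prime p \<and> padic_abs p (r i) > 1})"
    proof
      fix p assume "p \<in> {p. prime p \<and> (\<exists>v\<in>extensions (padic_abs p). v z > 1)}"
      then obtain v where v: "prime p" "v \<in> extensions (padic_abs p)" "v z > 1" by blast
      have "\<exists>i<n. padic_abs p (r i) > 1"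
      proof (rule ccontr)
        assume "\<not> ?thesis"
        hence "\<And>i. i < n \<Longrightarrow> padic_abs p (r i) \<le> 1" by (meson not_le)
        hence "v z \<le> 1" using integral_absval_le_1[OF v(1,2) n] by blast
        thus False using v(3) by simp
      qed
      thus "p \<in> (\<Union>i<n. {p. prime p \<and> padic_abs p (r i) > 1})" using v(1) by blast
    qed
    thus ?thesis by (rule finite_subset) (use finite_primes_padic_abs_gt_1 in blast)
  qed
  have "{p. prime p \<and> (\<exists>v\<in>extensions (padic_abs p). v c \<noteq> 1)}
     \<subseteq> {p. prime p \<and> (\<exists>v\<in>extensions (padic_abs p). v c > 1)} \<union> {p. prime p \<and> (\<exists>v\<in>extensions (padic_abs p). v (inverse c) > 1)}"
  proof
    fix p assume "p \<in> {p. prime p \<and> (\<exists>v\<in>extensions (padic_abs p). v c \<noteq> 1)}"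
    then obtain v where v: "prime p" "v \<in> extensions (padic_abs p)" "v c \<noteq> 1" by blast
    note av = extensions_absval[OF v(2)]
    have "v c > 1 \<or> v (inverse c) > 1"
      using absval_pos[OF av c] v(3) by (auto simp: absval_inverse[OF av] one_less_inverse_iff)
    thus "p \<in> {p. prime p \<and> (\<exists>v\<in>extensions (padic_abs p). v c > 1)} \<union> {p. prime p \<and> (\<exists>v\<in>extensions (padic_abs p). v (inverse c) > 1)}"
      using v(1,2) by blast
  qed
  thus ?thesis by (rule finite_subset) (use gt in blast)
qed

lemma finite_places_support:
  assumes c: "(c::'a) \<noteq> 0"
  shows "finite {v \<in> places. v c \<noteq> 1}"
proof (rule finite_subset)
  let ?T = "{p. prime p \<and> (\<exists>v\<in>extensions (padic_abs p). v c \<noteq> 1)}"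
  show "finite (extensions abs_inf \<union> (\<Union>p\<in>?T. extensions (padic_abs p)) :: ('a \<Rightarrow> real) set)"
    using finite_bad_primes[OF c] finite_extensions[OF nontrivial_abs_inf] finite_extensions nontrivial_padic_abs by auto
  show "{v \<in> places. v c \<noteq> 1} \<subseteq> extensions abs_inf \<union> (\<Union>p\<in>?T. extensions (padic_abs p))"
    unfolding places_def arch_places_eq finite_places_eq by blast
qed

text \<open>The places are grouped by the place of the rationals below them. The local product
  formulas leave the product formula of the rationals for the norm of \<open>c\<close>.\<close>

lemma product_formula:
  assumes c: "(c::'a) \<noteq> 0"
  shows "places_prod (\<lambda>v. v c ^ local_degree v) = 1"
proof -
  let ?E = "\<lambda>p. extensions (padic_abs p) :: ('a \<Rightarrow> real) set"
  define T where "T = {p. prime p \<and> (\<exists>v\<in>?E p. v c \<noteq> 1)} \<union> {p. prime p \<and> padic_abs p (nf_norm c) \<noteq> 1}"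
  have finT: "finite T" unfolding T_def
    using finite_bad_primes[OF c] finite_primes_padic_abs_neq_1[OF nf_norm_nonzero[OF c]] by blast
  have pT: "prime p" if "p \<in> T" for p using that by (auto simp: T_def)
  define A where "A = (\<Union>p\<in>T. ?E p)"
  have finE: "finite (?E p)" if "p \<in> T" for p using that pT finite_extensions nontrivial_padic_abs by blast
  have finI: "finite (extensions abs_inf :: ('a \<Rightarrow> real) set)" by (rule finite_extensions[OF nontrivial_abs_inf])
  have disj: "extensions abs_inf \<inter> A = {}"
    unfolding A_def using extensions_abs_inf_padic_disjoint[where ?'a = 'a] pT by blast
  have "places_prod (\<lambda>v. v c ^ local_degree v) = (\<Prod>v\<in>extensions abs_inf \<union> A. v c ^ local_degree v)"
  proof (rule places_prod_eq)
    show "finite (extensions abs_inf \<union> A)" using finT finE finI by (simp add: A_def)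
    show "extensions abs_inf \<union> A \<subseteq> places"
      unfolding places_def arch_places_eq finite_places_eq A_def using pT by blast
    fix v :: "'a \<Rightarrow> real" assume "v \<in> places" "v \<notin> extensions abs_inf \<union> A"
    then obtain p where "prime p" "v \<in> ?E p" "p \<notin> T"
      unfolding places_def arch_places_eq finite_places_eq A_def by blast
    hence "v c = 1" unfolding T_def by blast
    thus "v c ^ local_degree v = 1" by simp
  qed
  also have "\<dots> = (\<Prod>v\<in>extensions abs_inf. v c ^ local_degree v) * (\<Prod>v\<in>A. v c ^ local_degree v)"
    using disj finT finE finI by (intro prod.union_disjoint) (auto simp: A_def)
  also have "(\<Prod>v\<in>extensions abs_inf. v c ^ local_degree v) = abs_inf (nf_norm c)"
    by (rule local_product_formula[OF nontrivial_abs_inf trace_bounded_abs_inf c])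
  also have "(\<Prod>v\<in>A. v c ^ local_degree v) = (\<Prod>p\<in>T. \<Prod>v\<in>?E p. v c ^ local_degree v)"
    unfolding A_def
  proof (rule prod.UNION_disjoint[OF finT])
    show "\<forall>p\<in>T. finite (?E p)" using finE by blast
    show "\<forall>p\<in>T. \<forall>q\<in>T. p \<noteq> q \<longrightarrow> ?E p \<inter> ?E q = {}"
      using extensions_padic_disjoint[where ?'a = 'a] pT by blast
  qed
  also have "\<dots> = (\<Prod>p\<in>T. padic_abs p (nf_norm c))"
    using pT by (intro prod.cong local_product_formula c nontrivial_padic_abs trace_bounded_padic) auto
  also have "abs_inf (nf_norm c) * \<dots> = 1"
    by (rule rat_product_formula[OF nf_norm_nonzero[OF c] finT pT]) (auto simp: T_def)
  finally show ?thesis .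
qed

end

section \<open>The discriminant\<close>

lemma det_replaced_row:
  fixes q :: "nat \<Rightarrow> 'a::comm_ring_1"
  assumes k: "k < n"
  shows "det (mat n n (\<lambda>(i, j). if i = k then q j else if i = j then 1 else 0)) = q k"
proof -
  let ?P = "mat n n (\<lambda>(i, j). if i = k then q j else if i = j then 1 else 0)"
  have P: "?P \<in> carrier_mat n n" by simp
  have "det ?P = (\<Sum>i<n. ?P $$ (i, k) * cofactor ?P i k)"
    by (rule laplace_expansion_column[OF P k])
  also have "\<dots> = (\<Sum>i<n. if i = k then q k * cofactor ?P k k else 0)"
    by (rule sum.cong) (use k in auto)
  also have "\<dots> = q k * cofactor ?P k k" using k by simp
  also have "mat_delete ?P k k = 1\<^sub>m (n - 1)"
    by (rule eq_matI) (use k in \<open>auto simp: mat_delete_def\<close>)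
  hence "cofactor ?P k k = 1" by (simp add: cofactor_def)
  finally show ?thesis by simp
qed

context number_field_type
begin

text \<open>The matrix of the trace form; its determinant is the discriminant of the family.\<close>

definition gram :: "nat \<Rightarrow> (nat \<Rightarrow> 'a) \<Rightarrow> rat mat" where
  "gram n f = mat n n (\<lambda>(i, j). nf_trace (f i * f j))"

lemma gram_carrier: "gram n f \<in> carrier_mat n n"
  by (simp add: gram_def)

lemma gram_mult_vec:
  assumes "u \<in> carrier_vec n" "i < n"
  shows "(gram n f *\<^sub>v u) $ i = nf_trace (f i * (\<Sum>j<n. of_rat (u $ j) * f j))"
proof -
  have "(gram n f *\<^sub>v u) $ i = (\<Sum>j<n. nf_trace (f i * f j) * u $ j)"
    using assms by (simp add: gram_def scalar_prod_def lessThan_atLeast0)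
  also have "\<dots> = (\<Sum>j<n. nf_trace (of_rat (u $ j) * (f i * f j)))"
    unfolding nf_trace_scale by (rule sum.cong) (simp_all add: mult.commute)
  also have "\<dots> = nf_trace (f i * (\<Sum>j<n. of_rat (u $ j) * f j))"
    unfolding nf_trace_sum[symmetric] sum_distrib_left by (simp only: mult.left_commute)
  finally show ?thesis .
qed

lemma gram_det_nonzero:
  assumes span: "\<And>x. \<exists>q. x = (\<Sum>i<n. of_rat (q i) * f i)"
    and ind: "\<And>q i. (\<Sum>i<n. of_rat (q i) * f i) = 0 \<Longrightarrow> i < n \<Longrightarrow> q i = 0"
  shows "det (gram n f) \<noteq> 0"
proof
  assume "det (gram n f) = 0"
  then obtain u where u: "u \<in> carrier_vec n" "u \<noteq> 0\<^sub>v n" "gram n f *\<^sub>v u = 0\<^sub>v n"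
    using det_0_iff_vec_prod_zero_field[OF gram_carrier[of n f]] by blast
  let ?y = "\<Sum>j<n. of_rat (u $ j) * f j"
  have z: "nf_trace (f i * ?y) = 0" if "i < n" for i
    using gram_mult_vec[OF u(1) that, of f] u(3) that by simp
  have "?y = 0"
  proof (rule trace_form_nondegenerate)
    fix x
    obtain q where q: "x = (\<Sum>i<n. of_rat (q i) * f i)" using span by blast
    have "x * z = (\<Sum>i<n. of_rat (q i) * (f i * z))" for z
      unfolding q sum_distrib_right mult.assoc ..
    hence "?y * x = (\<Sum>i<n. of_rat (q i) * (f i * ?y))"
      by (simp only: mult.commute[of ?y x])
    hence "nf_trace (?y * x) = (\<Sum>i<n. q i * nf_trace (f i * ?y))"
      by (simp only: nf_trace_sum nf_trace_scale)
    also have "\<dots> = 0" by (rule sum.neutral) (use z in auto)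
    finally show "nf_trace (?y * x) = 0" .
  qed
  hence "u $ i = 0" if "i < n" for i using ind[of "\<lambda>j. u $ j"] that by blast
  hence "u = 0\<^sub>v n" using u(1) by (intro eq_vecI) auto
  thus False using u(2) by simp
qed

lemma gram_det_independent:
  assumes det: "det (gram n f) \<noteq> 0" and z: "(\<Sum>i<n. of_rat (q i) * f i) = 0" and i: "i < n"
  shows "q i = 0"
proof (rule ccontr)
  assume qi: "q i \<noteq> 0"
  define u where "u = vec n q"
  have u: "u \<in> carrier_vec n" by (simp add: u_def)
  have "u $ i \<noteq> 0" using qi i by (simp add: u_def)
  hence "u \<noteq> 0\<^sub>v n" using i by auto
  moreover have "gram n f *\<^sub>v u = 0\<^sub>v n"
  proof (rule eq_vecI)
    fix k assume "k < dim_vec (0\<^sub>v n :: rat vec)"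
    hence k: "k < n" by simp
    have "(\<Sum>j<n. of_rat (u $ j) * f j) = (\<Sum>j<n. of_rat (q j) * f j)"
      by (rule sum.cong) (simp_all add: u_def)
    hence "(gram n f *\<^sub>v u) $ k = nf_trace (f k * 0)" using gram_mult_vec[OF u k, of f] z by simp
    thus "(gram n f *\<^sub>v u) $ k = 0\<^sub>v n $ k" using k by (simp add: nf_trace_0)
  qed (simp add: gram_def)
  ultimately have "det (gram n f) = 0"
    using det_0_iff_vec_prod_zero_field[OF gram_carrier[of n f]] u by blast
  thus False using det by simp
qed

lemma gram_det_Ints:
  assumes "\<And>i. i < n \<Longrightarrow> algebraic_int (f i)"
  shows "det (gram n f) \<in> \<int>"
proof -
  have tr: "nf_trace (f i * f j) \<in> \<int>" if "i < n" "j < n" for i j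
    using assms that by (intro nf_trace_Ints algebraic_int_plus_times)
  have sgn: "(signof p :: rat) \<in> \<int>" for p :: "nat \<Rightarrow> nat" by (simp add: sign_def)
  show ?thesis
    unfolding det_def'[OF gram_carrier]
  proof (intro Ints_sum Ints_mult sgn Ints_prod)
    fix p i assume p: "p \<in> {p. p permutes {0..<n}}" and i: "i \<in> {0..<n}"
    hence "p i < n" using permutes_in_image[of p "{0..<n}" i] by simp
    thus "gram n f $$ (i, p i) \<in> \<int>" using i tr by (simp add: gram_def)
  qed
qed

lemma independent_family_spans:
  assumes ind: "\<And>q i. (\<Sum>i<d. of_rat (q i) * f i) = 0 \<Longrightarrow> i < d \<Longrightarrow> q i = 0"
  shows "\<exists>q. (x::'a) = (\<Sum>i<d. of_rat (q i) * f i)"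
proof -
  define g where "g = (\<lambda>i. if i < d then f i else x)"
  have "\<exists>q i. (\<Sum>i\<in>{..d}. of_rat (q i) * g i) = 0 \<and> i \<in> {..d} \<and> q i \<noteq> 0"
  proof (rule ccontr)
    assume "\<not> ?thesis"
    hence "card {..d} \<le> d" by (intro card_le_degree[where b = g]) auto
    thus False by simp
  qed
  then obtain q i where q: "(\<Sum>i\<le>d. of_rat (q i) * g i) = 0" "i \<le> d" "q i \<noteq> 0" by auto
  have "(\<Sum>i\<le>d. of_rat (q i) * g i) = (\<Sum>i<d. of_rat (q i) * f i) + of_rat (q d) * x"
    unfolding lessThan_Suc_atMost[symmetric] by (simp add: g_def)
  hence s: "(\<Sum>i<d. of_rat (q i) * f i) + of_rat (q d) * x = 0" using q(1) by simp
  have qd: "q d \<noteq> 0"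
  proof
    assume "q d = 0"
    hence "(\<Sum>i<d. of_rat (q i) * f i) = 0" using s by simp
    hence "\<forall>i<d. q i = 0" using ind by blast
    thus False using q(2,3) \<open>q d = 0\<close> by (cases "i = d") auto
  qed
  have "x = of_rat (- inverse (q d)) * (- (of_rat (q d) * x))"
    using qd by (simp add: of_rat_minus of_rat_inverse)
  also have "- (of_rat (q d) * x) = (\<Sum>i<d. of_rat (q i) * f i)" using s by (simp add: neg_eq_iff_add_eq_0 add.commute)
  also have "of_rat (- inverse (q d)) * \<dots> = (\<Sum>i<d. of_rat (- inverse (q d) * q i) * f i)"
    unfolding sum_distrib_left of_rat_mult mult.assoc ..
  finally have e: "x = (\<Sum>i<d. of_rat (- inverse (q d) * q i) * f i)" .
  show ?thesis by (rule exI[of _ "\<lambda>i. - inverse (q d) * q i"]) (rule e)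
qed

lemma algebraic_int_multiple: "\<exists>N::int. N > 0 \<and> algebraic_int (of_int N * (x::'a))"
proof -
  obtain n r where n: "n > 0" "x ^ n = (\<Sum>i<n. of_rat (r i) * x ^ i)" using monic_relation by blast
  obtain m where m: "n = Suc m" using n(1) by (cases n) auto
  have "\<exists>a b. r i = of_int a / of_int b \<and> b > 0" for i
  proof -
    obtain a b where ab: "quotient_of (r i) = (a, b)" by fastforce
    show ?thesis using quotient_of_div[OF ab] quotient_of_denom_pos[OF ab] by blast
  qed
  then obtain a b where ab: "\<And>i. r i = of_int (a i) / of_int (b i)" "\<And>i. b i > 0" by metis
  define N where "N = (\<Prod>i<n. b i)"
  have N: "N > 0" unfolding N_def using ab(2) by (intro prod_pos) auto
  define c where "c = (\<lambda>i. (\<Prod>j\<in>{..<n} - {i}. b j) * a i)"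
  have c: "of_int N * r i = of_int (c i)" if i: "i < n" for i
  proof -
    have "N = b i * (\<Prod>j\<in>{..<n} - {i}. b j)" unfolding N_def using i by (subst prod.remove[of _ i]) auto
    hence "of_int N * r i = of_int (\<Prod>j\<in>{..<n} - {i}. b j) * (of_int (b i) * r i)" by simp
    also have "of_int (b i) * r i = of_int (a i)" using ab(1)[of i] ab(2)[of i] by simp
    finally show ?thesis by (simp add: c_def)
  qed
  have "algebraic_int (of_int N * x)"
  proof (rule algebraic_int_if_monic_relation)
    show "(of_int N * x) ^ Suc m = (\<Sum>i\<le>m. of_int (N ^ i * c (m - i)) * (of_int N * x) ^ (m - i))"
    proof -
      have "(of_int N * x) ^ Suc m = (\<Sum>k<n. of_int N ^ n * (of_rat (r k) * x ^ k))"
        using n(2) m by (simp only: power_mult_distrib sum_distrib_left)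
      also have "\<dots> = (\<Sum>k\<le>m. of_int (N ^ (m - k) * c k) * (of_int N * x) ^ k)"
        unfolding m lessThan_Suc_atMost
      proof (rule sum.cong[OF refl])
        fix k assume k: "k \<in> {..m}"
        have "of_rat (of_int N * r k) = (of_rat (of_int (c k)) :: 'a)" using c[of k] k m by simp
        hence 1: "of_int (c k) = (of_int N * of_rat (r k) :: 'a)" by (simp add: of_rat_mult)
        have "Suc m = (m - k) + 1 + k" using k by simp
        hence 2: "(of_int N :: 'a) ^ Suc m = of_int N ^ (m - k) * of_int N * of_int N ^ k"
          by (metis power_add power_one_right)
        show "of_int N ^ Suc m * (of_rat (r k) * x ^ k) = of_int (N ^ (m - k) * c k) * (of_int N * x) ^ k"
          unfolding 2 of_int_mult of_int_power 1 power_mult_distrib by (simp only: ac_simps)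
      qed
      also have "\<dots> = (\<Sum>i\<le>m. of_int (N ^ i * c (m - i)) * (of_int N * x) ^ (m - i))"
        by (rule sum.reindex_bij_witness[of _ "\<lambda>i. m - i" "\<lambda>i. m - i"]) auto
      finally show ?thesis .
    qed
  qed
  thus ?thesis using N by blast
qed

lemma gram_change_basis:
  assumes P: "P \<in> carrier_mat n n" and g: "\<And>i. i < n \<Longrightarrow> g i = (\<Sum>j<n. of_rat (P $$ (i, j)) * f j)"
  shows "det (gram n g) = (det P)\<^sup>2 * det (gram n f)"
proof -
  have "gram n g = P * gram n f * transpose_mat P"
  proof (rule eq_matI)
    fix i k assume "i < dim_row (P * gram n f * transpose_mat P)" "k < dim_col (P * gram n f * transpose_mat P)"
    hence ik: "i < n" "k < n" using P by auto
    have Pg: "(P * gram n f) $$ (i, l) = (\<Sum>j<n. P $$ (i, j) * nf_trace (f j * f l))" if "l < n" for l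
      using that ik P by (simp add: gram_def scalar_prod_def lessThan_atLeast0)
    have "(P * gram n f * transpose_mat P) $$ (i, k) = (\<Sum>l<n. (P * gram n f) $$ (i, l) * P $$ (k, l))"
      using ik P by (simp add: scalar_prod_def lessThan_atLeast0 gram_def)
    also have "\<dots> = (\<Sum>l<n. \<Sum>j<n. P $$ (k, l) * (P $$ (i, j) * nf_trace (f j * f l)))"
      by (rule sum.cong) (simp_all add: Pg sum_distrib_left mult.commute)
    also have "\<dots> = nf_trace (\<Sum>l<n. \<Sum>j<n. of_rat (P $$ (k, l)) * (of_rat (P $$ (i, j)) * (f j * f l)))"
      by (simp only: nf_trace_sum nf_trace_scale)
    also have "(\<Sum>l<n. \<Sum>j<n. of_rat (P $$ (k, l)) * (of_rat (P $$ (i, j)) * (f j * f l))) = g i * g k"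
      unfolding g[OF ik(1)] g[OF ik(2)] sum_product
      by (subst sum.swap) (intro sum.cong refl, simp only: ac_simps)
    finally show "gram n g $$ (i, k) = (P * gram n f * transpose_mat P) $$ (i, k)"
      using ik by (simp add: gram_def)
  qed (use P in \<open>auto simp: gram_def\<close>)
  moreover have "det (P * gram n f * transpose_mat P) = det P * det (gram n f) * det P"
    using P gram_carrier[of n f] by (simp add: det_mult[where n = n] det_transpose)
  ultimately show ?thesis by (simp add: power2_eq_square mult.commute mult.left_commute)
qed

text \<open>Among the rational bases that consist of algebraic integers, take one whose discriminant
  is least in absolute value. If an algebraic integer \<open>x\<close> had a coordinate
  \<open>q\<close> that is not an integer at some basis element \<open>b\<close>, the exchange of
  \<open>b\<close> for \<open>x - \<lfloor>q\<rfloor> b\<close> would multiply the discriminant by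
  the square of the fractional part of \<open>q\<close>.\<close>

lemma integral_basis_exists: "\<exists>bs::'a list. integral_basis bs"
proof -
  let ?P = "\<lambda>bs :: 'a list. length bs = d \<and> (\<forall>b\<in>set bs. algebraic_int b) \<and> det (gram d ((!) bs)) \<noteq> 0"
  \<comment> \<open>for such a basis \<open>?m\<close> is the absolute value of an integral
    discriminant, as a natural number\<close>
  let ?m = "\<lambda>bs :: 'a list. nat \<lfloor>\<bar>det (gram d ((!) bs))\<bar>\<rfloor>"
  obtain N where N: "\<And>x::'a. N x > (0::int)" "\<And>x::'a. algebraic_int (of_int (N x) * x)"
    using algebraic_int_multiple by metis
  \<comment> \<open>multiples of a rational basis show that there is a basis of algebraic
    integers\<close>
  define bs0 where "bs0 = map (\<lambda>i. of_int (N (enum i)) * enum i) [0..<d]"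
  have bs0: "bs0 ! i = of_int (N (enum i)) * enum i" if "i < d" for i using that by (simp add: bs0_def)
  have "det (gram d ((!) bs0)) \<noteq> 0"
  proof (rule gram_det_nonzero)
    fix x :: 'a
    have "x = (\<Sum>i<d. of_rat (coord x (enum i) / of_int (N (enum i))) * bs0 ! i)"
    proof -
      have "(\<Sum>i<d. of_rat (coord x (enum i) / of_int (N (enum i))) * bs0 ! i) = (\<Sum>i<d. of_rat (coord x (enum i)) * enum i)"
      proof (rule sum.cong[OF refl])
        fix i assume "i \<in> {..<d}"
        moreover have "(of_int (N (enum i)) :: 'a) \<noteq> 0" using N(1)[of "enum i"] by simp
        ultimately show "of_rat (coord x (enum i) / of_int (N (enum i))) * bs0 ! i = of_rat (coord x (enum i)) * enum i"
          by (simp add: bs0 of_rat_divide)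
      qed
      thus ?thesis by (simp add: coord_enum_sum)
    qed
    thus "\<exists>q. x = (\<Sum>i<d. of_rat (q i) * bs0 ! i)" by (rule exI[of _ "\<lambda>i. coord x (enum i) / of_int (N (enum i))"])
  next
    fix q i assume z: "(\<Sum>i<d. of_rat (q i) * bs0 ! i) = 0" and i: "i < d"
    have "(\<Sum>i<d. of_rat (q i * of_int (N (enum i))) * enum i) = 0"
      using z by (simp add: bs0 of_rat_mult mult.assoc)
    hence "coord (\<Sum>j<d. of_rat (q j * of_int (N (enum j))) * enum j) (enum i) = 0"
      using coord_scale[of 0 0 "enum i"] by simp
    moreover have "coord (\<Sum>j<d. of_rat (q j * of_int (N (enum j))) * enum j) (enum i)
        = (\<Sum>j<d. if j = i then q i * of_int (N (enum i)) else 0)"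
      unfolding coord_sum_distrib coord_scale
    proof (rule sum.cong[OF refl])
      fix j assume j: "j \<in> {..<d}"
      have "enum i = enum j \<longleftrightarrow> j = i" using bij_enum i j by (auto simp: bij_betw_def inj_on_def)
      thus "q j * of_int (N (enum j)) * coord (enum j) (enum i) = (if j = i then q i * of_int (N (enum i)) else 0)"
        using coord_basis[OF enum_mem, of j "enum i"] j by auto
    qed
    ultimately have "q i * of_int (N (enum i)) = 0" using i by simp
    thus "q i = 0" using N(1)[of "enum i"] by simp
  qed
  hence "?P bs0" using N(2) by (auto simp: bs0_def)
  then obtain bs where bs: "?P bs" "\<And>cs. ?P cs \<Longrightarrow> ?m bs \<le> ?m cs"
    using ex_has_least_nat[of ?P bs0 ?m] by blast
  have len: "length bs = d" and alg: "\<And>i. i < d \<Longrightarrow> algebraic_int (bs ! i)" and det0: "det (gram d ((!) bs)) \<noteq> 0"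
    using bs(1) by auto
  note ind = gram_det_independent[OF det0]
  have detZ: "of_nat (?m cs) = \<bar>det (gram d ((!) cs))\<bar>" if "?P cs" for cs :: "'a list"
  proof -
    have "det (gram d ((!) cs)) \<in> \<int>" by (rule gram_det_Ints) (use that in auto)
    then obtain z where "det (gram d ((!) cs)) = of_int z" by (rule Ints_cases)
    thus ?thesis by (simp add: of_int_abs[symmetric] del: of_int_abs)
  qed
  have integral: "q k \<in> \<int>" if x: "algebraic_int x" "x = (\<Sum>i<d. of_rat (q i) * bs ! i)" and k: "k < d" for x q k
  proof (rule ccontr)
    assume qk: "q k \<notin> \<int>"
    define r where "r = q k - of_int \<lfloor>q k\<rfloor>"
    have r: "0 < r" "r < 1"
    proof -
      have "r \<noteq> 0" using qk unfolding r_def by (metis Ints_of_int eq_iff_diff_eq_0)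
      moreover have "0 \<le> r" unfolding r_def by simp
      ultimately show "0 < r" by simp
      show "r < 1" unfolding r_def by linarith
    qed
    define q' where "q' = q(k := r)"
    define y where "y = x - of_int \<lfloor>q k\<rfloor> * bs ! k"
    have algy: "algebraic_int y"
    proof -
      have "algebraic_int (of_int (- \<lfloor>q k\<rfloor>) :: 'a)" by (rule int_imp_algebraic_int) simp
      hence "algebraic_int (x + of_int (- \<lfloor>q k\<rfloor>) * bs ! k)"
        by (intro algebraic_int_plus_times x alg k)
      thus ?thesis by (simp add: y_def)
    qed
    have y: "y = (\<Sum>i<d. of_rat (q' i) * bs ! i)"
    proof -
      have "of_int \<lfloor>q k\<rfloor> * bs ! k = (\<Sum>i<d. if i = k then of_int \<lfloor>q k\<rfloor> * bs ! k else 0)" using k by simp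
      hence "y = (\<Sum>i<d. of_rat (q i) * bs ! i - (if i = k then of_int \<lfloor>q k\<rfloor> * bs ! k else 0))"
        unfolding y_def sum_subtractf x(2)[symmetric] by simp
      also have "\<dots> = (\<Sum>i<d. of_rat (q' i) * bs ! i)"
        by (rule sum.cong) (auto simp: q'_def r_def of_rat_diff left_diff_distrib)
      finally show ?thesis .
    qed
    define cs where "cs = bs[k := y]"
    define P where "P = mat d d (\<lambda>(i, j). if i = k then q' j else if i = j then 1 else 0)"
    have P: "P \<in> carrier_mat d d" by (simp add: P_def)
    have "det (gram d ((!) cs)) = (det P)\<^sup>2 * det (gram d ((!) bs))"
    proof (rule gram_change_basis[OF P])
      fix i assume i: "i < d"
      show "cs ! i = (\<Sum>j<d. of_rat (P $$ (i, j)) * bs ! j)"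
      proof (cases "i = k")
        case True
        thus ?thesis using k len y by (simp add: cs_def P_def)
      next
        case False
        have "(\<Sum>j<d. of_rat (P $$ (i, j)) * bs ! j) = (\<Sum>j<d. if j = i then bs ! i else 0)"
          by (rule sum.cong) (use i False in \<open>auto simp: P_def\<close>)
        thus ?thesis using False i by (simp add: cs_def)
      qed
    qed
    also have "det P = r" unfolding P_def using det_replaced_row[OF k, of q'] by (simp add: q'_def)
    finally have D: "det (gram d ((!) cs)) = r\<^sup>2 * det (gram d ((!) bs))" .
    have Pc: "?P cs"
    proof (intro conjI ballI)
      show "det (gram d ((!) cs)) \<noteq> 0" using D r det0 by simp
      show "algebraic_int b" if "b \<in> set cs" for b
        using that algy bs(1) set_update_subset_insert[of bs k y] by (auto simp: cs_def)
    qed (simp add: cs_def len)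
    have "\<bar>det (gram d ((!) cs))\<bar> = r\<^sup>2 * \<bar>det (gram d ((!) bs))\<bar>" by (simp add: D abs_mult)
    also have "\<dots> < 1 * \<bar>det (gram d ((!) bs))\<bar>"
      using r det0 by (intro mult_strict_right_mono) (auto simp: power_less_one_iff)
    finally have "(of_nat (?m cs) :: rat) < of_nat (?m bs)"
      unfolding detZ[OF Pc] detZ[OF bs(1)] mult_1_left .
    hence lt: "?m cs < ?m bs" by (simp only: of_nat_less_iff)
    show False by (rule notE[OF leD[OF bs(2)[OF Pc]] lt])
  qed
  have "integral_basis bs"
    unfolding integral_basis_def
  proof (intro conjI allI impI)
    show "\<forall>b\<in>set bs. algebraic_int b" using bs(1) by blast
    fix x :: 'a assume x: "algebraic_int x"
    obtain q where q: "x = (\<Sum>i<d. of_rat (q i) * bs ! i)"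
      using independent_family_spans[of "(!) bs" x] ind by blast
    have fl: "of_int \<lfloor>q i\<rfloor> = q i" if "i < d" for i using integral[OF x q that] by (metis Ints_cases floor_of_int)
    define c where "c = map (\<lambda>i. \<lfloor>q i\<rfloor>) [0..<d]"
    have cx: "x = (\<Sum>i<d. of_int (c ! i) * bs ! i)"
    proof -
      have "of_int (c ! i) = (of_rat (q i) :: 'a)" if "i < d" for i
        using that fl[OF that] by (metis add.left_neutral c_def diff_zero length_upt nth_map nth_upt of_rat_of_int_eq)
      thus ?thesis unfolding q by (intro sum.cong) auto
    qed
    show "\<exists>!c. length c = length bs \<and> x = (\<Sum>i<length bs. of_int (c ! i) * bs ! i)"
      unfolding len
    proof (rule ex1I[of _ c])
      show "length c = d \<and> x = (\<Sum>i<d. of_int (c ! i) * bs ! i)" using cx by (simp add: c_def)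
      fix e assume e: "length e = d \<and> x = (\<Sum>i<d. of_int (e ! i) * bs ! i)"
      have "(\<Sum>i<d. of_rat (of_int (e ! i) - of_int (c ! i)) * bs ! i)
         = (\<Sum>i<d. of_int (e ! i) * bs ! i) - (\<Sum>i<d. of_int (c ! i) * bs ! i)"
        unfolding sum_subtractf[symmetric] by (rule sum.cong) (simp_all add: of_rat_diff left_diff_distrib)
      also have "\<dots> = 0" using e cx by simp
      finally have z: "(\<Sum>i<d. of_rat (of_int (e ! i) - of_int (c ! i)) * bs ! i) = 0" .
      have "e ! i = c ! i" if "i < d" for i using ind[OF z that] by simp
      thus "e = c" using e by (intro nth_equalityI) (auto simp: c_def)
    qed
  qed
  thus ?thesis by blast
qed

text \<open>The entries of the determinant are traces of algebraic integers, so it is an integer. It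
  is not zero since an integral basis is a basis over the rationals: every element of the field has
  a positive multiple that is an algebraic integer.\<close>

lemma abs_discriminant_ge_1: "1 \<le> \<bar>nf_discriminant TYPE('a)\<bar>"
proof -
  define bs where "bs = (SOME bs :: 'a list. integral_basis bs)"
  have ib: "integral_basis bs" unfolding bs_def by (rule someI_ex[OF integral_basis_exists])
  let ?n = "length bs"
  have alg: "algebraic_int (bs ! i)" if "i < ?n" for i using ib that by (simp add: integral_basis_def)
  have uniq: "\<exists>!c. length c = ?n \<and> x = (\<Sum>i<?n. of_int (c ! i) * bs ! i)" if "algebraic_int x" for x
    using ib that by (simp add: integral_basis_def)
  have "det (gram ?n ((!) bs)) \<noteq> 0"
  proof (rule gram_det_nonzero)
    fix x :: 'a
    obtain N where N: "N > (0::int)" "algebraic_int (of_int N * x)" using algebraic_int_multiple by blast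
    obtain c where c: "of_int N * x = (\<Sum>i<?n. of_int (c ! i) * bs ! i)" using uniq[OF N(2)] by blast
    have "x = of_rat (inverse (of_int N)) * (of_int N * x)" using N(1) by (simp add: of_rat_inverse)
    also have "\<dots> = (\<Sum>i<?n. of_rat (inverse (of_int N) * of_int (c ! i)) * bs ! i)"
      unfolding c sum_distrib_left of_rat_mult of_rat_of_int_eq mult.assoc ..
    finally have e: "x = (\<Sum>i<?n. of_rat (inverse (of_int N) * of_int (c ! i)) * bs ! i)" .
    show "\<exists>q. x = (\<Sum>i<?n. of_rat (q i) * bs ! i)"
      by (rule exI[of _ "\<lambda>i. inverse (of_int N) * of_int (c ! i)"]) (rule e)
  next
    fix q i assume z: "(\<Sum>i<?n. of_rat (q i) * bs ! i) = 0" and i: "i < ?n"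
    have "\<exists>a b. q i = of_int a / of_int b \<and> b \<noteq> 0" for i using rat_obtain_quotient by metis
    then obtain a b where ab: "\<And>i. q i = of_int (a i) / of_int (b i)" "\<And>i. b i \<noteq> 0" by metis
    \<comment> \<open>a rational relation is cleared of its denominators, and uniqueness of integral
      coordinates applies\<close>
    define N where "N = (\<Prod>i<?n. b i)"
    have N: "N \<noteq> 0" using ab(2) by (simp add: N_def)
    define c where "c = map (\<lambda>i. (\<Prod>j\<in>{..<?n} - {i}. b j) * a i) [0..<?n]"
    have c: "of_int (c ! i) = of_int N * q i" if i: "i < ?n" for i
    proof -
      have "N = b i * (\<Prod>j\<in>{..<?n} - {i}. b j)" unfolding N_def using i by (subst prod.remove[of _ i]) auto
      hence "of_int N * q i = of_int (\<Prod>j\<in>{..<?n} - {i}. b j) * (of_int (b i) * q i)" by simp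
      also have "of_int (b i) * q i = of_int (a i)" using ab(1)[of i] ab(2)[of i] by simp
      finally show ?thesis using i by (simp add: c_def)
    qed
    have "0 = of_int N * (\<Sum>i<?n. of_rat (q i) * bs ! i)" using z by simp
    also have "\<dots> = (\<Sum>i<?n. of_int (c ! i) * bs ! i)"
      unfolding sum_distrib_left
    proof (rule sum.cong[OF refl])
      fix i assume "i \<in> {..<?n}"
      hence "of_rat (of_int (c ! i)) = (of_rat (of_int N * q i) :: 'a)" using c by simp
      hence "(of_int (c ! i) :: 'a) = of_int N * of_rat (q i)" by (simp add: of_rat_mult)
      thus "of_int N * (of_rat (q i) * bs ! i) = of_int (c ! i) * bs ! i" by simp
    qed
    finally have c0: "length c = ?n \<and> (0::'a) = (\<Sum>i<?n. of_int (c ! i) * bs ! i)" by (simp add: c_def)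
    have r0: "length (replicate ?n (0::int)) = ?n \<and> (0::'a) = (\<Sum>i<?n. of_int (replicate ?n 0 ! i) * bs ! i)" by simp
    have "c = replicate ?n 0" using uniq[of 0] c0 r0 by (blast intro: algebraic_int_0)
    hence "c ! i = 0" using i by simp
    thus "q i = 0" using c[OF i] N by simp
  qed
  moreover have "det (gram ?n ((!) bs)) \<in> \<int>" by (rule gram_det_Ints[OF alg])
  ultimately have "1 \<le> \<bar>det (gram ?n ((!) bs))\<bar>" by (metis Ints_nonzero_abs_ge1)
  thus ?thesis unfolding nf_discriminant_def Let_def bs_def[symmetric] gram_def .
qed

end

section \<open>Bases of subspaces\<close>

context
  fixes n :: nat and V :: "'a::field vec set"
  assumes sub: "VectorSpace.subspace class_ring V (module_vec TYPE('a) n)"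
begin

interpretation K: vec_space "TYPE('a)" n .

interpretation W: vectorspace "class_ring :: 'a ring" "subvs n V"
  by (rule K.subspace_is_vs[OF sub])

lemma subspace_closed:
  "V \<subseteq> carrier_vec n"
  "x \<in> V \<Longrightarrow> y \<in> V \<Longrightarrow> x + y \<in> V"
  "x \<in> V \<Longrightarrow> c \<cdot>\<^sub>v x \<in> V"
proof -
  have s: "submodule class_ring V (module_vec TYPE('a) n)" using sub by (simp add: VectorSpace.subspace_def)
  interpret s: submodule "class_ring :: 'a ring" V "module_vec TYPE('a) n" by (rule s)
  show "V \<subseteq> carrier_vec n" using s.subset by (simp add: module_vec_simps)
  show "x \<in> V \<Longrightarrow> y \<in> V \<Longrightarrow> x + y \<in> V" using s.m_closed[of x y] by (simp add: module_vec_simps)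
  show "x \<in> V \<Longrightarrow> c \<cdot>\<^sub>v x \<in> V" using s.smult_closed[of c x] by (simp add: module_vec_simps class_ring_simps)
qed

lemma subspace_lin_indpt: "S \<subseteq> V \<Longrightarrow> W.lin_dep S = K.lin_dep S"
  using K.span_li_not_depend(2)[of S V] sub by (simp add: VectorSpace.subspace_def)

lemma subspace_fin_dim: "W.fin_dim"
proof -
  have "\<exists>A. finite A \<and> maximal A (\<lambda>S. S \<subseteq> carrier (subvs n V) \<and> W.lin_indpt S)"
  proof (rule maximal_exists[where N = "K.dim" and B = "{}"])
    fix A assume "A \<subseteq> carrier (subvs n V) \<and> W.lin_indpt A"
    hence A: "A \<subseteq> V" "K.lin_indpt A" using subspace_lin_indpt[of A] by auto
    have Ac: "A \<subseteq> carrier_vec n" using A(1) subspace_closed(1) by (rule subset_trans)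
    show "finite A \<and> card A \<le> K.dim"
      by (rule conjI) (rule K.li_le_dim[OF K.fin_dim Ac A(2)])+
  qed (simp add: W.lin_dep_def)
  then obtain A where A: "finite A" "maximal A (\<lambda>S. S \<subseteq> carrier (subvs n V) \<and> W.lin_indpt S)" by blast
  hence "W.basis A" by (intro W.max_li_is_basis)
  thus ?thesis using A(1) unfolding W.fin_dim_def W.basis_def by blast
qed

lemma basis_exists: "\<exists>bs. is_basis_of n V bs"
proof -
  obtain A where A: "finite A" "W.basis A" using W.finite_basis_exists[OF subspace_fin_dim] by blast
  obtain bs where "set bs = A" "distinct bs" using finite_distinct_list[OF A(1)] by blast
  thus ?thesis unfolding is_basis_of_def using A(2) by blast
qed

lemma basis_subset: "is_basis_of n V bs \<Longrightarrow> set bs \<subseteq> V"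
  unfolding is_basis_of_def W.basis_def by auto

lemma basis_length: "is_basis_of n V bs \<Longrightarrow> length bs = W.dim"
  using W.dim_basis[of "set bs"] by (simp add: is_basis_of_def distinct_card)

lemma basis_independent:
  assumes bs: "is_basis_of n V bs"
    and z: "\<And>i. i < n \<Longrightarrow> (\<Sum>j<length bs. u j * bs ! j $ i) = 0" and j: "j < length bs"
  shows "u j = 0"
proof (rule ccontr)
  assume uj: "u j \<noteq> 0"
  have bV: "set bs \<subseteq> V" and dist: "distinct bs" and li: "W.lin_indpt (set bs)"
    using bs unfolding is_basis_of_def W.basis_def by auto
  have bc: "set bs \<subseteq> carrier_vec n" using bV subspace_closed(1) by blast
  let ?A = "mat_of_cols n bs"
  have A: "?A \<in> carrier_mat n (length bs)" by simp
  define v where "v = vec (length bs) u"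
  have "v $ j \<noteq> 0" using uj j by (simp add: v_def)
  hence v0: "v \<noteq> 0\<^sub>v (length bs)" using j by auto
  have "?A *\<^sub>v v = 0\<^sub>v n"
  proof (rule eq_vecI)
    fix i assume "i < dim_vec (0\<^sub>v n :: 'a vec)"
    hence i: "i < n" by simp
    have "(?A *\<^sub>v v) $ i = (\<Sum>j<length bs. bs ! j $ i * u j)"
      using i by (simp add: v_def scalar_prod_def lessThan_atLeast0 mat_of_cols_def)
    thus "(?A *\<^sub>v v) $ i = 0\<^sub>v n $ i" using z[OF i] i by (simp add: mult.commute)
  qed simp
  moreover have "cols ?A = bs" using bc by (simp add: cols_mat_of_cols)
  ultimately have "K.lin_dep (set bs)"
    using K.lin_depI[OF A _ v0] dist by (simp add: v_def)
  thus False using li subspace_lin_indpt[OF bV] by simp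
qed

text \<open>On the coordinates \<open>r\<close> the vectors are unit vectors, so they are
  independent, and they are as many as the dimension.\<close>

lemma unit_coordinates_basis:
  assumes m: "W.dim = m" and len: "length xs = m" and V: "set xs \<subseteq> V"
    and unit: "\<And>i j. i < m \<Longrightarrow> j < m \<Longrightarrow> xs ! j $ r i = (if i = j then 1 else 0)"
    and r: "\<And>i. i < m \<Longrightarrow> r i < n"
  shows "is_basis_of n V xs"
proof -
  have dist: "distinct xs"
    unfolding distinct_conv_nth
  proof (intro allI impI)
    fix i j assume ij: "i < length xs" "j < length xs" "i \<noteq> j"
    have "xs ! i $ r i = 1" "xs ! j $ r i = 0" using unit[of i i] unit[of i j] ij len by auto
    thus "xs ! i \<noteq> xs ! j" by auto
  qed
  have xc: "set xs \<subseteq> carrier_vec n" using V subspace_closed(1) by blast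
  let ?A = "mat_of_cols n xs"
  have A: "?A \<in> carrier_mat n m" unfolding len[symmetric] by simp
  have cA: "cols ?A = xs" using xc by (simp add: cols_mat_of_cols)
  have "K.lin_indpt (set xs)"
  proof
    assume "K.lin_dep (set xs)"
    then obtain v where v: "v \<in> carrier_vec m" "v \<noteq> 0\<^sub>v m" "?A *\<^sub>v v = 0\<^sub>v n"
      using K.lin_depE[OF A] cA dist by auto
    have "v $ i = 0" if i: "i < m" for i
    proof -
      have "(?A *\<^sub>v v) $ r i = (\<Sum>j<m. xs ! j $ r i * v $ j)"
        using r[OF i] v(1) len by (simp add: scalar_prod_def lessThan_atLeast0 mat_of_cols_def)
      also have "\<dots> = (\<Sum>j<m. if j = i then v $ i else 0)"
        by (rule sum.cong) (use unit[OF i] in auto)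
      finally show ?thesis using v(3) r[OF i] i by simp
    qed
    hence "v = 0\<^sub>v m" using v(1) by (intro eq_vecI) auto
    thus False using v(2) by simp
  qed
  hence "W.lin_indpt (set xs)" using subspace_lin_indpt[OF V] by simp
  moreover have "card (set xs) = m" using dist len by (simp add: distinct_card)
  ultimately have "W.basis (set xs)"
    using W.dim_li_is_basis[OF subspace_fin_dim, of "set xs"] V m by simp
  thus ?thesis unfolding is_basis_of_def using dist by blast
qed

end

text \<open>Gauss-Jordan elimination. The k-th step scales the k-th vector to \<open>1\<close> at a
  coordinate at which it does not vanish, and subtracts multiples of it to clear that coordinate of
  the other vectors. Independence is carried along because it guarantees such a coordinate.\<close>

lemma reduced_echelon_exists:
  fixes W :: "'a::field vec set" and b :: "nat \<Rightarrow> 'a vec"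
  assumes W: "W \<subseteq> carrier_vec n" "\<And>x y. x \<in> W \<Longrightarrow> y \<in> W \<Longrightarrow> x + y \<in> W" "\<And>c x. x \<in> W \<Longrightarrow> c \<cdot>\<^sub>v x \<in> W"
    and b: "\<And>j. j < m \<Longrightarrow> b j \<in> W"
    and ind: "\<And>u j. (\<And>i. i < n \<Longrightarrow> (\<Sum>j<m. u j * b j $ i) = 0) \<Longrightarrow> j < m \<Longrightarrow> u j = 0"
  shows "\<exists>r x. (\<forall>j<m. x j \<in> W) \<and> (\<forall>i<m. r i < n) \<and>
     (\<forall>i<m. \<forall>j<m. x j $ r i = (if i = j then 1 else 0)) \<and>
     (\<forall>l<m. \<exists>c. \<forall>i<n. b l $ i = (\<Sum>j<m. c j * x j $ i))"
proof -
  let ?P = "\<lambda>k r x. (\<forall>j<m. x j \<in> W) \<and> (\<forall>i<k. r i < n) \<and>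
     (\<forall>i<k. \<forall>j<m. x j $ r i = (if i = j then 1 else 0)) \<and>
     (\<forall>l<m. \<exists>c. \<forall>i<n. b l $ i = (\<Sum>j<m. c j * x j $ i)) \<and>
     (\<forall>u. (\<forall>i<n. (\<Sum>j<m. u j * x j $ i) = 0) \<longrightarrow> (\<forall>j<m. u j = 0))"
  have "k \<le> m \<Longrightarrow> \<exists>r x. ?P k r x" for k
  proof (induction k)
    case 0
    have f1: "\<exists>c. \<forall>i<n. b l $ i = (\<Sum>j<m. c j * b j $ i)" if l: "l < m" for l
    proof (intro exI[of _ "\<lambda>j. if j = l then 1 else 0"] allI impI)
      fix i
      have "(\<Sum>j<m. (if j = l then 1 else 0) * b j $ i) = (\<Sum>j<m. if j = l then b l $ i else 0)"
        by (rule sum.cong) auto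
      thus "b l $ i = (\<Sum>j<m. (if j = l then 1 else 0) * b j $ i)" using l by simp
    qed
    have f2: "\<forall>u. (\<forall>i<n. (\<Sum>j<m. u j * b j $ i) = 0) \<longrightarrow> (\<forall>j<m. u j = 0)"
    proof (intro allI impI)
      fix u j assume "\<forall>i<n. (\<Sum>j<m. u j * b j $ i) = 0" "j < m"
      thus "u j = 0" by (intro ind[of u j]) simp_all
    qed
    have "?P 0 (\<lambda>_. 0) b"
    proof (intro conjI)
      show "\<forall>j<m. b j \<in> W" using b by blast
      show "\<forall>l<m. \<exists>c. \<forall>i<n. b l $ i = (\<Sum>j<m. c j * b j $ i)" by (intro allI impI) (rule f1)
      show "\<forall>u. (\<forall>i<n. (\<Sum>j<m. u j * b j $ i) = 0) \<longrightarrow> (\<forall>j<m. u j = 0)" by (rule f2)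
    qed (simp_all only: less_nat_zero_code simp_thms)
    thus ?case by (rule exI[of "\<lambda>r. \<exists>x. ?P 0 r x", OF exI[of "?P 0 (\<lambda>_. 0)"]])
  next
    case (Suc k)
    hence k: "k < m" by simp
    from Suc.IH[OF less_imp_le[OF k]] obtain r x where P: "?P k r x"
      by (elim exE) (rule that)
    note P1 = conjunct1[OF P] and P2 = conjunct1[OF conjunct2[OF P]]
      and P3 = conjunct1[OF conjunct2[OF conjunct2[OF P]]]
      and P4 = conjunct1[OF conjunct2[OF conjunct2[OF conjunct2[OF P]]]]
      and P5 = conjunct2[OF conjunct2[OF conjunct2[OF conjunct2[OF P]]]]
    have IH1: "x j \<in> W" if "j < m" for j using P1 that by simp
    have IH2: "r i < n" if "i < k" for i using P2 that by simp
    have IH3: "x j $ r i = (if i = j then 1 else 0)" if "i < k" "j < m" for i j using P3 that by simp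
    have IH4: "\<exists>c. \<forall>i<n. b l $ i = (\<Sum>j<m. c j * x j $ i)" if "l < m" for l
      by (rule P4[rule_format, OF that])
    have IH5: "u j = 0" if "\<forall>i<n. (\<Sum>j<m. u j * x j $ i) = 0" "j < m" for u j
      by (rule P5[rule_format, OF _ that(2)]) (use that(1) in simp)
    note IH = IH1 IH2 IH3 IH4 IH5
    have dimx: "dim_vec (x j) = n" if "j < m" for j using IH(1)[OF that] W(1) by auto
    have "\<exists>s<n. x k $ s \<noteq> 0"
    proof (rule ccontr)
      assume H: "\<not> ?thesis"
      have "(\<Sum>j<m. (if j = k then 1 else 0) * x j $ i) = 0" if "i < n" for i
        using H that by (intro sum.neutral) auto
      hence "(if k = k then 1 else 0 :: 'a) = 0" using IH(5)[of "\<lambda>j. if j = k then 1 else 0" k] k by blast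
      thus False by simp
    qed
    then obtain s where s: "s < n" "x k $ s \<noteq> 0" by blast
    define a where "a = x k $ s"
    define e where "e = (\<lambda>j. x j $ s)"
    define y where "y = inverse a \<cdot>\<^sub>v x k"
    define x' where "x' = (\<lambda>j. if j = k then y else x j + (- e j) \<cdot>\<^sub>v y)"
    have a: "a \<noteq> 0" using s by (simp add: a_def)
    have yW: "y \<in> W" unfolding y_def by (intro W IH k)
    have x'W: "x' j \<in> W" if "j < m" for j unfolding x'_def using that yW by (auto intro!: W IH)
    have yi: "y $ i = x k $ i / a" if "i < n" for i
      using that dimx[OF k] by (simp add: y_def divide_inverse mult.commute)
    have dy: "dim_vec y = n" using yW W(1) by auto
    have x'i: "x' j $ i = (if j = k then x k $ i / a else x j $ i - e j * (x k $ i / a))" if "i < n" "j < m" for i j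
      using that dy dimx by (simp add: x'_def yi)
    \<comment> \<open>a combination of the new vectors, rewritten in the old ones\<close>
    have comb: "(\<Sum>j<m. u j * x' j $ i) = (\<Sum>j<m. (if j = k then (u k - (\<Sum>j\<in>{..<m} - {k}. u j * e j)) / a else u j) * x j $ i)"
      if i: "i < n" for u i
    proof -
      have "(\<Sum>j<m. u j * x' j $ i) = u k * (x k $ i / a) + (\<Sum>j\<in>{..<m} - {k}. u j * (x j $ i - e j * (x k $ i / a)))"
        using k i by (subst sum.remove[of _ k]) (auto simp: x'i intro!: sum.cong)
      also have "\<dots> = (u k - (\<Sum>j\<in>{..<m} - {k}. u j * e j)) / a * x k $ i + (\<Sum>j\<in>{..<m} - {k}. u j * x j $ i)"
        by (simp add: right_diff_distrib sum_subtractf left_diff_distrib diff_divide_distrib sum_distrib_right sum_divide_distrib mult.assoc)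
      also have "\<dots> = (\<Sum>j<m. (if j = k then (u k - (\<Sum>j\<in>{..<m} - {k}. u j * e j)) / a else u j) * x j $ i)"
        using k by (subst (2) sum.remove[of _ k]) auto
      finally show ?thesis .
    qed
    define r' where "r' = r(k := s)"
    have unit: "x' j $ r' i = (if i = j then 1 else 0)" if ij: "i < Suc k" "j < m" for i j
    proof (cases "i = k")
      case True
      thus ?thesis using x'i[OF s(1) ij(2)] a by (auto simp: r'_def a_def e_def)
    next
      case False
      hence i: "i < k" using ij by simp
      have "x k $ r i = 0" using IH(3)[OF i k] i by simp
      thus ?thesis using x'i[OF IH(2)[OF i] ij(2)] IH(3)[OF i ij(2)] i by (auto simp: r'_def)
    qed
    have span: "\<exists>c. \<forall>i<n. b l $ i = (\<Sum>j<m. c j * x' j $ i)" if l: "l < m" for l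
    proof -
      obtain c where c: "\<forall>i<n. b l $ i = (\<Sum>j<m. c j * x j $ i)" using IH(4)[OF l] by blast
      define c' where "c' = (\<lambda>j. if j = k then a * c k + (\<Sum>j\<in>{..<m} - {k}. c j * e j) else c j)"
      have "(\<Sum>j\<in>{..<m} - {k}. c' j * e j) = (\<Sum>j\<in>{..<m} - {k}. c j * e j)"
        by (rule sum.cong) (auto simp: c'_def)
      hence ck: "(c' k - (\<Sum>j\<in>{..<m} - {k}. c' j * e j)) / a = c k" using a by (simp add: c'_def)
      have "b l $ i = (\<Sum>j<m. c' j * x' j $ i)" if i: "i < n" for i
        unfolding comb[OF i] ck using c i by (auto simp: c'_def intro!: sum.cong)
      thus ?thesis by blast
    qed
    have indep: "\<forall>j<m. u j = 0" if z: "\<forall>i<n. (\<Sum>j<m. u j * x' j $ i) = 0" for u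
    proof -
      define u' where "u' = (\<lambda>j. if j = k then (u k - (\<Sum>j\<in>{..<m} - {k}. u j * e j)) / a else u j)"
      have "\<forall>i<n. (\<Sum>j<m. u' j * x j $ i) = 0" using z comb by (simp add: u'_def)
      hence u': "u' j = 0" if "j < m" for j using IH(5) that by blast
      have u0: "u j = 0" if "j < m" "j \<noteq> k" for j using u'[OF that(1)] that by (simp add: u'_def)
      have "(\<Sum>j\<in>{..<m} - {k}. u j * e j) = 0" using u0 by (intro sum.neutral) auto
      hence "u k = 0" using u'[OF k] a by (simp add: u'_def)
      thus ?thesis using u0 by blast
    qed
    have rn: "\<forall>i<Suc k. r' i < n" using IH(2) s(1) by (auto simp: r'_def less_Suc_eq)
    have "?P (Suc k) r' x'"
    proof (intro conjI)
      show "\<forall>j<m. x' j \<in> W" using x'W by blast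
      show "\<forall>i<Suc k. \<forall>j<m. x' j $ r' i = (if i = j then 1 else 0)"
        by (intro allI impI) (rule unit)
      show "\<forall>l<m. \<exists>c. \<forall>i<n. b l $ i = (\<Sum>j<m. c j * x' j $ i)" by (intro allI impI) (rule span)
      show "\<forall>u. (\<forall>i<n. (\<Sum>j<m. u j * x' j $ i) = 0) \<longrightarrow> (\<forall>j<m. u j = 0)"
      proof (intro allI impI)
        fix u j assume z: "\<forall>i<n. (\<Sum>j<m. u j * x' j $ i) = 0" and j: "j < m"
        show "u j = 0" by (rule indep[OF z, rule_format, OF j])
      qed
    qed (rule rn)
    thus ?case by (rule exI[of "\<lambda>r. \<exists>x. ?P (Suc k) r x", OF exI[of "?P (Suc k) r'"]])
  qed
  from this[OF order_refl] obtain r x where "?P m r x" by (elim exE) (rule that)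
  hence "(\<forall>j<m. x j \<in> W) \<and> (\<forall>i<m. r i < n) \<and>
     (\<forall>i<m. \<forall>j<m. x j $ r i = (if i = j then 1 else 0)) \<and>
     (\<forall>l<m. \<exists>c. \<forall>i<n. b l $ i = (\<Sum>j<m. c j * x j $ i))" by blast
  thus ?thesis by (intro exI[of _ r] exI[of _ x])
qed

section \<open>Grassmann coordinates\<close>

text \<open>A submatrix lists the selected rows in increasing order, so the two matrices differ by a
  permutation of their rows.\<close>

lemma det_row_selection:
  fixes A :: "'a::field mat"
  assumes A: "A \<in> carrier_mat n m" and s: "inj_on s {..<m}" "\<And>i. i < m \<Longrightarrow> s i < n"
  shows "det (mat m m (\<lambda>(i, j). A $$ (s i, j))) = det (submatrix A (s ` {..<m}) UNIV) \<or>
    det (mat m m (\<lambda>(i, j). A $$ (s i, j))) = - det (submatrix A (s ` {..<m}) UNIV)"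
proof -
  define I where "I = s ` {..<m}"
  have cI: "card I = m" unfolding I_def using s(1) by (simp add: card_image)
  have finI: "finite I" by (simp add: I_def)
  define t where "t = (\<lambda>i. if i < m then card {a\<in>I. a < s i} else i)"
  have pick: "pick I (t i) = s i" if "i < m" for i
    using pick_card_in_set[of "s i" I] that by (simp add: t_def I_def)
  have tm: "t i < m" if "i < m" for i
  proof -
    have "{a\<in>I. a < s i} \<subset> I" using that by (auto simp: I_def)
    thus ?thesis using psubset_card_mono[OF finI] cI that by (simp add: t_def)
  qed
  have inj: "inj_on t {0..<m}"
  proof (rule inj_onI)
    fix i j assume ij: "i \<in> {0..<m}" "j \<in> {0..<m}" "t i = t j"
    hence "s i = s j" using pick[of i] pick[of j] by simp
    thus "i = j" using s(1) ij by (auto dest: inj_onD)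
  qed
  have perm: "t permutes {0..<m}"
  proof (rule bij_imp_permutes)
    have "t ` {0..<m} \<subseteq> {0..<m}" using tm by auto
    hence "t ` {0..<m} = {0..<m}" by (intro endo_inj_surj inj) simp_all
    thus "bij_betw t {0..<m} {0..<m}" unfolding bij_betw_def using inj by blast
  qed (simp add: t_def)
  define S where "S = submatrix A I UNIV"
  have In: "{i. i < n \<and> i \<in> I} = I" using s(2) by (auto simp: I_def)
  have dimS: "dim_row S = m" "dim_col S = m"
    unfolding S_def dim_submatrix using A In cI by auto
  have S: "S \<in> carrier_mat m m" using dimS by auto
  have Sij: "S $$ (i, j) = A $$ (pick I i, j)" if "i < m" "j < m" for i j
    unfolding S_def using that A In cI by (subst submatrix_index) (auto simp: pick_UNIV)
  have "mat m m (\<lambda>(i, j). A $$ (s i, j)) = mat m m (\<lambda>(i, j). S $$ (t i, j))"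
    by (rule eq_matI) (auto simp: Sij tm pick)
  hence "det (mat m m (\<lambda>(i, j). A $$ (s i, j))) = of_int (sign t) * det S"
    using det_permute_rows[OF S perm] by simp
  thus ?thesis unfolding S_def I_def by (cases "sign t = 1") (auto simp: sign_def)
qed

lemma grassmann_coordinate_mem:
  assumes I: "I \<subseteq> {..<n}" "card I = length bs"
  shows "\<exists>k<dim_vec (grassmann_coords n bs). grassmann_coords n bs $ k = det (submatrix (mat_of_cols n bs) I UNIV)"
proof -
  have "I \<in> set ` set (subseqs [0..<n])" by (rule subset_subseqs) (use I in auto)
  then obtain js where i: "js \<in> set (subseqs [0..<n])" "set js = I" by auto
  have "distinct js" using subseqs_distinctD[OF i(1)] by simp
  hence len: "length js = length bs" using distinct_card[of js] i(2) I(2) by simp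
  let ?L = "map (\<lambda>js. det (submatrix (mat_of_cols n bs) (set js) UNIV))
         (filter (\<lambda>js. length js = length bs) (subseqs [0..<n]))"
  have "det (submatrix (mat_of_cols n bs) I UNIV) \<in> set ?L"
    using i len by auto
  then obtain k where "k < length ?L" "?L ! k = det (submatrix (mat_of_cols n bs) I UNIV)"
    unfolding in_set_conv_nth by blast
  thus ?thesis unfolding grassmann_coords_def by (intro exI[of _ k]) (simp add: vec_of_list_index)
qed

lemma det_selection_le_max_norm:
  fixes v :: "'a::field_char_0 \<Rightarrow> real"
  assumes v: "absolute_value v" and s: "\<And>i. i < length bs \<Longrightarrow> s i < n" and n: "length bs \<le> n"
  shows "v (det (mat (length bs) (length bs) (\<lambda>(i, j). bs ! j $ s i))) \<le> max_norm v (grassmann_coords n bs)"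
proof -
  let ?m = "length bs"
  let ?G = "grassmann_coords n bs"
  let ?A = "mat_of_cols n bs"
  have A: "?A \<in> carrier_mat n ?m" by simp
  have le: "v (?G $ k) \<le> max_norm v ?G" if "k < dim_vec ?G" for k
    unfolding max_norm_def using that by (intro Max_ge) auto
  have mem: "v (det (submatrix ?A I UNIV)) \<le> max_norm v ?G" if "I \<subseteq> {..<n}" "card I = ?m" for I
    using grassmann_coordinate_mem[OF that] le by metis
  have M: "mat ?m ?m (\<lambda>(i, j). bs ! j $ s i) = mat ?m ?m (\<lambda>(i, j). ?A $$ (s i, j))"
    by (rule eq_matI) (auto simp: mat_of_cols_def s)
  show ?thesis
  proof (cases "inj_on s {..<?m}")
    case True
    have "s ` {..<?m} \<subseteq> {..<n}" "card (s ` {..<?m}) = ?m" using s True by (auto simp: card_image)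
    hence "v (det (submatrix ?A (s ` {..<?m}) UNIV)) \<le> max_norm v ?G" by (rule mem)
    thus ?thesis unfolding M using det_row_selection[OF A True] s absval_minus[OF v] by metis
  next
    case False
    \<comment> \<open>a repeated row makes the determinant vanish\<close>
    then obtain i j where ij: "i < ?m" "j < ?m" "i \<noteq> j" "s i = s j" by (auto simp: inj_on_def)
    have "det (mat ?m ?m (\<lambda>(i, j). bs ! j $ s i)) = 0"
      by (rule det_identical_rows[OF _ ij(3,1,2)]) (use ij in \<open>auto intro!: eq_vecI\<close>)
    moreover have "0 \<le> max_norm v ?G"
    proof -
      have "0 \<le> v (det (submatrix ?A {..<?m} UNIV))" by (rule absval_nonneg[OF v])
      also have "\<dots> \<le> max_norm v ?G" by (rule mem) (use n in auto)
      finally show ?thesis .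
    qed
    ultimately show ?thesis by (simp add: absval_0[OF v])
  qed
qed

section \<open>Comparison of heights\<close>

lemma max_norm_ge: "k < dim_vec G \<Longrightarrow> v (G $ k) \<le> max_norm v G"
  unfolding max_norm_def by (intro Max_ge) auto

lemma max_norm_attained: "0 < dim_vec G \<Longrightarrow> \<exists>k<dim_vec G. max_norm v G = v (G $ k)"
proof -
  assume "0 < dim_vec G"
  hence "max_norm v G \<in> (\<lambda>i. v (G $ i)) ` {..<dim_vec G}" unfolding max_norm_def by (intro Max_in) auto
  thus ?thesis by auto
qed

lemma max_norm_le_l2_norm:
  assumes v: "absolute_value v" and G: "0 < dim_vec G"
  shows "max_norm v G \<le> l2_norm v G"
proof -
  obtain k where k: "k < dim_vec G" "max_norm v G = v (G $ k)" using max_norm_attained[OF G] by blast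
  have "(v (G $ k))\<^sup>2 \<le> (\<Sum>i<dim_vec G. (v (G $ i))\<^sup>2)" by (rule member_le_sum) (use k in auto)
  hence "sqrt ((v (G $ k))\<^sup>2) \<le> l2_norm v G" unfolding l2_norm_def by (rule real_sqrt_le_mono)
  thus ?thesis using k absval_nonneg[OF v] by simp
qed

context number_field_type
begin

text \<open>At every place the assumptions bound \<open>|(1, x)|\<^sub>v |c|\<^sub>v\<close> by
  \<open>|G|\<^sub>v\<close>. In the product over all places the factors of \<open>c\<close>
  disappear by the product formula.\<close>

lemma weil_height_le_mixed_height:
  fixes x G :: "'a vec" and c :: 'a
  assumes c: "c \<noteq> 0" and G: "0 < dim_vec G"
    and cG: "\<And>v. absolute_value v \<Longrightarrow> v c \<le> max_norm v G"
    and xG: "\<And>v i. absolute_value v \<Longrightarrow> i < dim_vec x \<Longrightarrow> v (x $ i) * v c \<le> max_norm v G"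
  shows "weil_height x \<le> mixed_height G" "0 \<le> mixed_height G"
proof -
  define f where "f = (\<lambda>v::'a \<Rightarrow> real. max_norm v (vCons 1 x) ^ local_degree v)"
  define g where "g = (\<lambda>v::'a \<Rightarrow> real. (if v \<in> arch_places then l2_norm v G else max_norm v G) ^ local_degree v)"
  define u where "u = (\<lambda>v::'a \<Rightarrow> real. v c ^ local_degree v)"
  define Y where "Y = insert c (((\<lambda>i. x $ i) ` {..<dim_vec x}) \<union> ((\<lambda>i. G $ i) ` {..<dim_vec G}))"
  \<comment> \<open>outside of this finite set of places, \<open>c\<close> and all nonzero entries
    of \<open>x\<close> and \<open>G\<close> have absolute value \<open>1\<close>\<close>
  define A :: "('a \<Rightarrow> real) set" where "A = arch_places \<union> (\<Union>y\<in>Y - {0}. {v \<in> places. v y \<noteq> 1})"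
  have "finite (arch_places :: ('a \<Rightarrow> real) set)"
    unfolding arch_places_eq by (rule finite_extensions[OF nontrivial_abs_inf])
  hence finA: "finite A" unfolding A_def by (auto simp: Y_def intro!: finite_places_support)
  have Apl: "A \<subseteq> places" unfolding A_def places_def by blast
  have av: "absolute_value v" if "v \<in> places" for v :: "'a \<Rightarrow> real"
    using that by (auto simp: places_def arch_places_def finite_places_def)
  have out: "v \<notin> arch_places" "v y \<le> 1" "v c = 1"
    if v: "v \<in> places" "v \<notin> A" and y: "y \<in> insert 0 Y" for v y
  proof -
    show "v \<notin> arch_places" using v by (simp add: A_def)
    have "v z = 1" if "z \<in> Y - {0}" for z using v that unfolding A_def by blast
    thus "v y \<le> 1" "v c = 1" using y c absval_0[OF av[OF v(1)]] by (cases "y = 0"; force simp: Y_def)+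
  qed
  have entry: "\<exists>y\<in>insert 1 Y. max_norm v (vCons 1 x) = v y" for v
  proof -
    have "0 < dim_vec (vCons 1 x)" by simp
    then obtain k where k: "k < dim_vec (vCons 1 x)" "max_norm v (vCons 1 x) = v (vCons 1 x $ k)"
      using max_norm_attained by blast
    thus ?thesis by (cases k) (auto simp: Y_def)
  qed
  have ge1: "1 \<le> max_norm v (vCons 1 x)" if "v \<in> places" for v
    using max_norm_ge[of 0 "vCons 1 x" v] absval_1[OF av[OF that]] by simp
  have f1: "f v = 1" if v: "v \<in> places" "v \<notin> A" for v
  proof -
    obtain y where y: "y \<in> insert 1 Y" "max_norm v (vCons 1 x) = v y" using entry by blast
    have "v y \<le> 1" using out(2)[OF v, of y] absval_1[OF av[OF v(1)]] y(1) by auto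
    hence "max_norm v (vCons 1 x) = 1" using ge1[OF v(1)] y(2) by simp
    thus ?thesis by (simp add: f_def)
  qed
  have g1: "g v = 1" if v: "v \<in> places" "v \<notin> A" for v
  proof -
    obtain k where k: "k < dim_vec G" "max_norm v G = v (G $ k)" using max_norm_attained[OF G] by blast
    have "v (G $ k) \<le> 1" by (rule out(2)[OF v]) (use k in \<open>auto simp: Y_def\<close>)
    moreover have "1 \<le> max_norm v G" using cG[OF av[OF v(1)]] out(3)[OF v, of 0] by simp
    ultimately have "max_norm v G = 1" using k by simp
    thus ?thesis using out(1)[OF v, of 0] by (simp add: g_def)
  qed
  have u1: "u v = 1" if v: "v \<in> places" "v \<notin> A" for v
    using out(3)[OF v, of 0] by (simp add: u_def)
  have le: "f v * u v \<le> g v" if v: "v \<in> A" for v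
  proof -
    have avv: "absolute_value v" using v Apl av by blast
    obtain k where k: "k < dim_vec (vCons 1 x)" "max_norm v (vCons 1 x) = v (vCons 1 x $ k)"
      using max_norm_attained[of "vCons 1 x"] by auto
    have "v (vCons 1 x $ k) * v c \<le> max_norm v G"
    proof (cases k)
      case 0
      thus ?thesis using cG[OF avv] by (simp add: absval_1[OF avv])
    next
      case (Suc i)
      thus ?thesis using xG[OF avv, of i] k(1) by simp
    qed
    also have "\<dots> \<le> (if v \<in> arch_places then l2_norm v G else max_norm v G)"
      using max_norm_le_l2_norm[OF avv G] by simp
    finally have "(max_norm v (vCons 1 x) * v c) ^ local_degree v \<le> g v"
      unfolding g_def k(2) using absval_nonneg[OF avv] by (intro power_mono) auto
    thus ?thesis by (simp add: f_def u_def power_mult_distrib)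
  qed
  have nn: "0 \<le> f v" "0 \<le> u v" if v: "v \<in> A" for v
  proof -
    have vp: "v \<in> places" using v Apl by blast
    show "0 \<le> f v" "0 \<le> u v" using ge1[OF vp] absval_nonneg[OF av[OF vp]] by (auto simp: f_def u_def)
  qed
  have "places_prod u = prod u A" by (rule places_prod_eq[OF finA Apl u1])
  moreover have "places_prod u = 1" unfolding u_def by (rule product_formula[OF c])
  ultimately have pu: "prod u A = 1" by simp
  have pf: "places_prod f = prod f A" by (rule places_prod_eq[OF finA Apl f1])
  have pg: "places_prod g = prod g A" by (rule places_prod_eq[OF finA Apl g1])
  have "prod f A = (\<Prod>v\<in>A. f v * u v)" by (simp add: prod.distrib pu)
  also have "\<dots> \<le> prod g A" by (intro prod_mono) (use le nn in auto)
  finally have fg: "places_prod f \<le> places_prod g" by (simp add: pf pg)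
  have "0 \<le> places_prod f" unfolding pf using nn by (intro prod_nonneg) auto
  hence g0: "0 \<le> places_prod g" using fg by simp
  have w: "weil_height x = root d (places_prod f)"
    by (simp add: weil_height_def max_height_def f_def nf_degree_def)
  have h: "mixed_height G = root d (places_prod g)"
    by (simp add: mixed_height_def g_def nf_degree_def)
  show "weil_height x \<le> mixed_height G" unfolding w h by (rule real_root_le_mono[OF d_pos fg])
  show "0 \<le> mixed_height G" unfolding h by (rule real_root_ge_zero[OF g0])
qed

section \<open>The sparse basis\<close>

text \<open>The columns of the reduced echelon form vanish at \<open>m - 1\<close> of the
  \<open>n\<close> coordinates, and their entries are quotients of maximal minors of the given basis
  by one fixed minor.\<close>

lemma sparse_basis_of_height_le_schmidt_height:
  fixes V :: "'a vec set" and n m :: nat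
  assumes sub: "VectorSpace.subspace class_ring V (module_vec TYPE('a) n)"
    and dim: "vectorspace.dim class_ring (subvs n V) = m"
    and mn: "m \<le> n"
  shows "\<exists>xs. is_basis_of n V xs \<and> length xs = m \<and>
    (\<forall>i<m. sparse_vec (n - m + 1) (xs ! i) \<and> weil_height (xs ! i) \<le> schmidt_height n V \<and> 0 \<le> schmidt_height n V)"
proof -
  \<comment> \<open>the basis by which the Schmidt height is defined\<close>
  define bs where "bs = (SOME bs. is_basis_of n V bs)"
  have bs: "is_basis_of n V bs" unfolding bs_def by (rule someI_ex[OF basis_exists[OF sub]])
  have len: "length bs = m" using basis_length[OF sub bs] dim by simp
  have bV: "set bs \<subseteq> V" by (rule basis_subset[OF sub bs])
  have ind: "u j = 0" if "\<And>i. i < n \<Longrightarrow> (\<Sum>j<m. u j * bs ! j $ i) = 0" "j < m" for u j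
  proof (rule basis_independent[OF sub bs])
    show "(\<Sum>j<length bs. u j * bs ! j $ i) = 0" if "i < n" for i
      unfolding len by (rule \<open>\<And>i. i < n \<Longrightarrow> (\<Sum>j<m. u j * bs ! j $ i) = 0\<close>[OF that])
    show "j < length bs" unfolding len by fact
  qed
  have "\<exists>r x. (\<forall>j<m. x j \<in> V) \<and> (\<forall>i<m. r i < n) \<and>
     (\<forall>i<m. \<forall>j<m. x j $ r i = (if i = j then 1 else 0)) \<and>
     (\<forall>l<m. \<exists>c. \<forall>i<n. bs ! l $ i = (\<Sum>j<m. c j * x j $ i))"
  proof (rule reduced_echelon_exists[OF subspace_closed(1)[OF sub]])
    show "bs ! j \<in> V" if "j < m" for j using bV len that by (simp add: subset_iff)
  qed (rule subspace_closed(2,3)[OF sub] ind; assumption)+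
  then obtain r x where x: "\<forall>j<m. x j \<in> V" and r: "\<forall>i<m. r i < n"
    and unit: "\<forall>i<m. \<forall>j<m. x j $ r i = (if i = j then 1 else 0)"
    and span: "\<forall>l<m. \<exists>c. \<forall>i<n. bs ! l $ i = (\<Sum>j<m. c j * x j $ i)"
    by (elim exE conjE) (rule that)
  have dimx: "dim_vec (x j) = n" if "j < m" for j using x that subspace_closed(1)[OF sub] by auto
  have expand: "bs ! l $ i = (\<Sum>j<m. bs ! l $ r j * x j $ i)" if l: "l < m" and i: "i < n" for l i
  proof -
    obtain c where c: "\<forall>i<n. bs ! l $ i = (\<Sum>j<m. c j * x j $ i)" using span l by blast
    have "bs ! l $ r k = c k" if k: "k < m" for k
    proof -
      have "bs ! l $ r k = (\<Sum>j<m. c j * x j $ r k)" using c r k by blast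
      also have "\<dots> = (\<Sum>j<m. if j = k then c k else 0)" by (rule sum.cong) (use unit k in auto)
      finally show ?thesis using k by simp
    qed
    thus ?thesis using c i by (auto intro!: sum.cong)
  qed
  \<comment> \<open>the rows at which the echelon basis restricts to the identity; a vector killed
    by this block gives a relation of the basis vectors, by the expansion in the echelon
    basis\<close>
  define Ar where "Ar = mat m m (\<lambda>(i, j). bs ! j $ r i)"
  have Ar: "Ar \<in> carrier_mat m m" by (simp add: Ar_def)
  have det0: "det Ar \<noteq> 0"
  proof
    assume "det Ar = 0"
    then obtain u where u: "u \<in> carrier_vec m" "u \<noteq> 0\<^sub>v m" "Ar *\<^sub>v u = 0\<^sub>v m"
      using det_0_iff_vec_prod_zero_field[OF Ar] by blast
    have z: "(\<Sum>l<m. u $ l * bs ! l $ r j) = 0" if "j < m" for j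
    proof -
      have "(Ar *\<^sub>v u) $ j = (\<Sum>l<m. u $ l * bs ! l $ r j)"
        using that u(1) by (simp add: Ar_def scalar_prod_def lessThan_atLeast0 mult.commute)
      thus ?thesis using u(3) that by simp
    qed
    have "(\<Sum>l<m. u $ l * bs ! l $ i) = 0" if i: "i < n" for i
    proof -
      have "(\<Sum>l<m. u $ l * bs ! l $ i) = (\<Sum>l<m. \<Sum>j<m. u $ l * bs ! l $ r j * x j $ i)"
        by (rule sum.cong) (simp_all add: expand[OF _ i] sum_distrib_left mult.assoc)
      also have "\<dots> = (\<Sum>j<m. (\<Sum>l<m. u $ l * bs ! l $ r j) * x j $ i)"
        by (subst sum.swap) (simp add: sum_distrib_right)
      also have "\<dots> = 0" by (rule sum.neutral) (use z in auto)
      finally show ?thesis .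
    qed
    hence "u $ j = 0" if "j < m" for j using ind[of "\<lambda>l. u $ l" j] that by blast
    hence "u = 0\<^sub>v m" using u(1) by (intro eq_vecI) auto
    thus False using u(2) by simp
  qed
  \<comment> \<open>Cramer's rule: replacing one row of the chosen minor multiplies it by a coordinate\<close>
  have cramer: "det (mat m m (\<lambda>(i, l). bs ! l $ (r(j := k)) i)) = x j $ k * det Ar" if j: "j < m" and k: "k < n" for j k
  proof -
    define X where "X = mat m m (\<lambda>(i, q). if i = j then x q $ k else if i = q then 1 else 0)"
    have X: "X \<in> carrier_mat m m" by (simp add: X_def)
    have "mat m m (\<lambda>(i, l). bs ! l $ (r(j := k)) i) = X * Ar"
    proof (rule eq_matI)
      fix i l assume "i < dim_row (X * Ar)" "l < dim_col (X * Ar)"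
      hence il: "i < m" "l < m" using X Ar by auto
      have s: "(r(j := k)) i < n" using r k il by simp
      have Xi: "X $$ (i, q) = x q $ (r(j := k)) i" if "q < m" for q
        using that il unit by (auto simp: X_def)
      have "(X * Ar) $$ (i, l) = (\<Sum>q<m. X $$ (i, q) * bs ! l $ r q)"
        using il X Ar by (simp add: scalar_prod_def lessThan_atLeast0) (simp add: Ar_def)
      also have "\<dots> = (\<Sum>q<m. bs ! l $ r q * x q $ (r(j := k)) i)"
        by (rule sum.cong) (simp_all add: Xi mult.commute del: fun_upd_apply)
      also have "\<dots> = bs ! l $ (r(j := k)) i" by (rule expand[OF il(2) s, symmetric])
      finally show "mat m m (\<lambda>(i, l). bs ! l $ (r(j := k)) i) $$ (i, l) = (X * Ar) $$ (i, l)" using il by simp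
    qed (use X Ar in auto)
    moreover have "det X = x j $ k" unfolding X_def by (rule det_replaced_row[OF j, of "\<lambda>q. x q $ k"])
    ultimately show ?thesis using det_mult[OF X Ar] by simp
  qed
  let ?G = "grassmann_coords n bs"
  have G0: "0 < dim_vec ?G"
    using grassmann_coordinate_mem[of "{..<m}" n bs] mn len by fastforce
  have cG: "v (det Ar) \<le> max_norm v ?G" if "absolute_value v" for v
    using det_selection_le_max_norm[OF that, of bs r n] r mn len unfolding Ar_def by simp
  have xG: "v (x j $ k) * v (det Ar) \<le> max_norm v ?G"
    if v: "absolute_value v" and j: "j < m" and k: "k < n" for v j k
  proof -
    have "v (det (mat m m (\<lambda>(i, l). bs ! l $ (r(j := k)) i))) \<le> max_norm v ?G"
      using det_selection_le_max_norm[OF v, of bs "r(j := k)" n] r k mn len by simp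
    thus ?thesis unfolding cramer[OF j k] absval_mult[OF v] .
  qed
  define xs where "xs = map x [0..<m]"
  have xsi: "xs ! j = x j" if "j < m" for j using that by (simp add: xs_def)
  have "is_basis_of n V xs"
    by (rule unit_coordinates_basis[OF sub dim, of xs r]) (use x unit r in \<open>auto simp: xs_def\<close>)
  moreover have "sparse_vec (n - m + 1) (x j)" if j: "j < m" for j
  proof -
    have inj: "inj_on r {..<m}"
    proof (rule inj_onI, rule ccontr)
      fix i i' assume ii: "i \<in> {..<m}" "i' \<in> {..<m}" "r i = r i'" "i \<noteq> i'"
      have "x i $ r i = 1" "x i $ r i' = 0" using unit ii(1,2,4) by simp_all
      thus False using ii(3) by simp
    qed
    have "{i. i < dim_vec (x j) \<and> x j $ i \<noteq> 0} \<subseteq> {..<n} - r ` ({..<m} - {j})"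
      using unit j dimx[OF j] by (auto split: if_splits)
    hence "card {i. i < dim_vec (x j) \<and> x j $ i \<noteq> 0} \<le> card ({..<n} - r ` ({..<m} - {j}))"
      by (intro card_mono) auto
    also have "\<dots> = n - (m - 1)"
    proof (subst card_Diff_subset)
      have "card (r ` ({..<m} - {j})) = m - 1"
        using inj j by (subst card_image) (auto intro: inj_on_subset)
      thus "card {..<n} - card (r ` ({..<m} - {j})) = n - (m - 1)" by simp
    qed (use r in auto)
    finally show ?thesis unfolding sparse_vec_def using j mn by simp
  qed
  moreover have "weil_height (x j) \<le> schmidt_height n V" "0 \<le> schmidt_height n V" if j: "j < m" for j
    unfolding schmidt_height_def bs_def[symmetric]
    using weil_height_le_mixed_height[OF det0 G0 cG, of "x j"] xG[OF _ j] dimx[OF j] by auto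
  ultimately show ?thesis by (intro exI[of _ xs]) (simp add: xsi, simp add: xs_def)
qed

end

theorem theorem3p3:
  fixes V :: "'a::field_char_0 vec set" and n m :: nat
  assumes "number_field TYPE('a)"
    and "VectorSpace.subspace class_ring V (module_vec TYPE('a) n)"
    and "vectorspace.dim class_ring (subvs n V) = m"
    and "1 \<le> m" and "m \<le> n"
  shows "\<exists>xs. is_basis_of n V xs \<and> length xs = m \<and>
    (\<forall>i<m. sparse_vec (n - m + 1) (xs ! i) \<and>
      weil_height (xs ! i) \<le>
        sqrt 2 * real m
        * \<bar>real_of_rat (nf_discriminant TYPE('a))\<bar> powr ((real m + 1) / (2 * real (nf_degree TYPE('a))))
        * schmidt_height n V)"
proof -
  interpret number_field_type "TYPE('a)" by unfold_locales (rule assms(1))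
  obtain xs where xs: "is_basis_of n V xs" "length xs = m"
    "\<And>i. i < m \<Longrightarrow> sparse_vec (n - m + 1) (xs ! i)"
    "\<And>i. i < m \<Longrightarrow> weil_height (xs ! i) \<le> schmidt_height n V"
    "\<And>i. i < m \<Longrightarrow> 0 \<le> schmidt_height n V"
    using sparse_basis_of_height_le_schmidt_height[OF assms(2,3,5)] by blast
  let ?D = "\<bar>real_of_rat (nf_discriminant TYPE('a))\<bar> powr ((real m + 1) / (2 * real (nf_degree TYPE('a))))"
  have "real_of_rat 1 \<le> real_of_rat \<bar>nf_discriminant TYPE('a)\<bar>"
    unfolding of_rat_less_eq by (rule abs_discriminant_ge_1)
  hence D: "1 \<le> ?D" by (intro ge_one_powr_ge_zero) auto
  have "1 * 1 * 1 \<le> sqrt 2 * real m * ?D"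
    using D assms(4) by (intro mult_mono) auto
  hence K: "1 \<le> sqrt 2 * real m * ?D" by simp
  have "weil_height (xs ! i) \<le> sqrt 2 * real m * ?D * schmidt_height n V" if i: "i < m" for i
  proof -
    have "1 * schmidt_height n V \<le> sqrt 2 * real m * ?D * schmidt_height n V"
      using K xs(5)[OF i] by (rule mult_right_mono)
    thus ?thesis using xs(4)[OF i] by simp
  qed
  thus ?thesis using xs(1-3) by blast
qed

end
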